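(* Let $p$ be a prime and let $H$ be a square-free graph such that $H^{*p}$ is not a star. Then there are integers $\lambda_1,\lambda_2\not\equiv 0 \pmod p$ such that $\#_pBIS_{\lambda_1,\lambda_2}$ is polynomial-time (Turing) reducible to $\#_p\mathsf{GraphHom}(H)$.
   Context: All graphs are finite, undirected, without loops and without parallel edges. A graph is square-free if it contains no cycle of length 4. A star is a complete bipartite graph $K_{1,n}$. The problem $\#_p\mathsf{GraphHom}(H)$: given a graph $G$, output $|\mathsf{Hom}(G,H)| \bmod p$, where $\mathsf{Hom}(G,H)$ is the set of homomorphisms (edge-preserving vertex maps) from $G$ to $H$. For an automorphism $\pi$ of $H$, $H^\pi$ is the subgraph induced by the fixed points of $\pi$; $H\Rightarrow_p H'$ means $H'\cong H^\pi$ for some automorphism $\pi$ of $H$ of order $p$, and $\Rightarrow_p^*$ is its reflexive-transitive closure (up to isomorphism). $H^{*p}$ denotes the (unique up to isomorphism, by Faben and Jerrum) graph with the fewest vertices such that $H\Rightarrow_p^* H^{*p}$. For $\lambda_1,\lambda_2$, the problem $\#_pBIS_{\lambda_1,\lambda_2}$: given a bipartite graph $G$ with bipartition $V_L\cup V_R$, output $Z_{\lambda_1,\lambda_2}(G)=\sum_{I}\lambda_1^{|V_L\cap I|}\lambda_2^{|V_R\cap I|} \bmod p$, the sum over all independent sets $I$ of $G$.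
   Formalization: "H^{*p} is not a star" is read as "some connected component of H^{*p} is not a star" (a single vertex counts as a star): if H^{*p} is empty or a disjoint union of stars, #_pGraphHom(H) is polynomial-time and the claim fails unless #_pP-hard problems are easy. *)

theory Defs
  imports
    "Graph_Theory.Graph_Theory"
    "HOL-Combinatorics.Permutations"
    "HOL-Computational_Algebra.Computational_Algebra"
    "HOL-Number_Theory.Cong"
begin

section \<open>Graphs\<close>

text \<open>
  A finite undirected graph without loops and parallel edges is a \<^locale>\<open>pair_graph\<close>: a finite
  vertex set with a symmetric irreflexive set of arcs.
\<close>

definition square_free :: "'a pair_pre_digraph \<Rightarrow> bool" where
  "square_free G \<longleftrightarrow> \<not> (\<exists>es. pre_digraph.cycle (with_proj G) es \<and> length es = 4)"

text \<open>The case \<open>n = 0\<close> is included: a single vertex is a star.\<close>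

definition star :: "('a, 'b) pre_digraph \<Rightarrow> bool" where
  "star G \<longleftrightarrow> (\<exists>n. complete_bipartite_digraph 1 n G)"

text \<open>
  "Is a star" has to be read componentwise: for disjoint unions of stars (two isolated vertices,
  say) counting homomorphisms is as trivial as for a single star.  The graph without vertices, which
  is for instance the reduced form of \<open>K\<^sub>2\<close> at the prime 2, has no components and belongs to this
  case, too.  For connected graphs this is the property of being a star, as the lemma below shows.
  The strongly connected components of a symmetric digraph are its connected components.
\<close>

definition union_of_stars :: "'a pair_pre_digraph \<Rightarrow> bool" where
  "union_of_stars G \<longleftrightarrow> (\<forall>C \<in> pre_digraph.sccs (with_proj G). star C)"

lemma union_of_stars_connected_iff:
  assumes "pair_graph G" and "strongly_connected (with_proj G)"
  shows "union_of_stars G \<longleftrightarrow> star (with_proj G)"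
proof -
  interpret pair_graph G by fact
  have wf: "wf_digraph (with_proj G)" by (rule wf_digraph)
  have arcs: "{e \<in> parcs G. fst e \<in> pverts G \<and> snd e \<in> pverts G} = parcs G"
    using arc_fst_in_verts arc_snd_in_verts by blast
  have self: "induced_subgraph (with_proj G) (with_proj G)"
    using wf arcs by (simp add: induced_subgraph_def subgraph_def compatible_def)
  have sub: "verts C \<subseteq> pverts G" if "induced_subgraph C (with_proj G)" for C
    using that by (auto simp: induced_subgraph_def subgraph_def)
  have eq: "C = with_proj G" if "induced_subgraph C (with_proj G)" "verts C = pverts G" for C
  proof -
    have "arcs C = parcs G"
      using that arcs by (simp add: induced_subgraph_def)
    then show ?thesis
      using that by (auto simp: induced_subgraph_def subgraph_def compatible_def)
  qed
  have "pre_digraph.sccs (with_proj G) = {with_proj G}"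
  proof (intro equalityI subsetI)
    fix C assume "C \<in> pre_digraph.sccs (with_proj G)"
    then have C: "induced_subgraph C (with_proj G)"
      "\<not> (\<exists>D. induced_subgraph D (with_proj G) \<and> strongly_connected D \<and> verts C \<subset> verts D)"
      unfolding pre_digraph.sccs_def by auto
    then have "\<not> verts C \<subset> pverts G"
      using self assms(2) by (metis with_proj_simps(1))
    then show "C \<in> {with_proj G}"
      using sub[OF C(1)] eq[OF C(1)] by blast
  next
    fix C assume "C \<in> {with_proj G}"
    then have C: "C = with_proj G" by simp
    have "\<not> (\<exists>D. induced_subgraph D (with_proj G) \<and> strongly_connected D \<and> pverts G \<subset> verts D)"
      using sub by blast
    then show "C \<in> pre_digraph.sccs (with_proj G)"
      unfolding pre_digraph.sccs_def C with_proj_simps using self assms(2) by blast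
  qed
  then show ?thesis by (simp add: union_of_stars_def)
qed

definition homs :: "'a pair_pre_digraph \<Rightarrow> 'b pair_pre_digraph \<Rightarrow> ('a \<Rightarrow> 'b) set" where
  "homs G H = {f \<in> pverts G \<rightarrow>\<^sub>E pverts H. \<forall>(u, v) \<in> parcs G. (f u, f v) \<in> parcs H}"

section \<open>Reduction by automorphisms of order \<open>p\<close>\<close>

definition automorphism :: "'a pair_pre_digraph \<Rightarrow> ('a \<Rightarrow> 'a) \<Rightarrow> bool" where
  "automorphism H \<pi> \<longleftrightarrow> \<pi> permutes pverts H \<and>
    (\<forall>u \<in> pverts H. \<forall>v \<in> pverts H. (u, v) \<in> parcs H \<longleftrightarrow> (\<pi> u, \<pi> v) \<in> parcs H)"

definition has_order :: "('a \<Rightarrow> 'a) \<Rightarrow> nat \<Rightarrow> bool" where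
  "has_order \<pi> k \<longleftrightarrow> 0 < k \<and> \<pi> ^^ k = id \<and> (\<forall>j. 0 < j \<and> j < k \<longrightarrow> \<pi> ^^ j \<noteq> id)"

definition reduction_step :: "nat \<Rightarrow> 'a pair_pre_digraph \<Rightarrow> 'a pair_pre_digraph \<Rightarrow> bool" where
  "reduction_step p H H' \<longleftrightarrow> (\<exists>\<pi>. automorphism H \<pi> \<and> has_order \<pi> p \<and>
    digraph_iso (with_proj H \<restriction> {v \<in> pverts H. \<pi> v = v}) (with_proj H'))"

definition reduces_to :: "nat \<Rightarrow> 'a pair_pre_digraph \<Rightarrow> 'a pair_pre_digraph \<Rightarrow> bool" where
  "reduces_to p = (\<lambda>H H'. digraph_iso (with_proj H) (with_proj H') \<or> reduction_step p H H')\<^sup>*\<^sup>*"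

text \<open>
  The reduced form is determined only up to isomorphism, hence it is given as a relation.
\<close>

definition reduced_form :: "nat \<Rightarrow> 'a pair_pre_digraph \<Rightarrow> 'a pair_pre_digraph \<Rightarrow> bool" where
  "reduced_form p H K \<longleftrightarrow> reduces_to p H K \<and>
    (\<forall>K'. reduces_to p H K' \<longrightarrow> card (pverts K) \<le> card (pverts K'))"

section \<open>Polynomial-time Turing reductions\<close>

text \<open>
  The machine model is structured programs over finitely many stacks of bits, with unit-cost push,
  pop and inspection of the top element.  A stack is one half of a Turing machine tape, and a tape
  is a pair of stacks, so this is the multi-tape oracle Turing machine up to a constant factor in
  the running time.  An oracle call costs the length of the query plus that of the answer.
\<close>

type_synonym state = "nat \<Rightarrow> bool list"

datatype test = Nonempty nat | Top nat

primrec holds :: "test \<Rightarrow> state \<Rightarrow> bool" where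
  "holds (Nonempty r) s \<longleftrightarrow> s r \<noteq> []"
| "holds (Top r) s \<longleftrightarrow> s r \<noteq> [] \<and> hd (s r)"

datatype prog =
    Skip
  | Push nat bool
  | Pop nat
  | Query nat nat
  | Seq prog prog
  | If test prog prog
  | While test prog

text \<open>
  \<open>exec \<O> c s t s'\<close>: with oracle \<open>\<O>\<close>, program \<open>c\<close> started in \<open>s\<close> halts in \<open>s'\<close> after time \<open>t\<close>.
\<close>

inductive exec :: "(bool list \<Rightarrow> bool list) \<Rightarrow> prog \<Rightarrow> state \<Rightarrow> nat \<Rightarrow> state \<Rightarrow> bool"
  for \<O> :: "bool list \<Rightarrow> bool list" where
  Skip: "exec \<O> Skip s 1 s"
| Push: "exec \<O> (Push r b) s 1 (s(r := b # s r))"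
| Pop: "exec \<O> (Pop r) s 1 (s(r := tl (s r)))"
| Query: "exec \<O> (Query q a) s (1 + length (s q) + length (\<O> (s q))) (s(a := \<O> (s q)))"
| Seq: "exec \<O> c s t s' \<Longrightarrow> exec \<O> d s' t' s'' \<Longrightarrow> exec \<O> (Seq c d) s (t + t') s''"
| IfTrue: "holds b s \<Longrightarrow> exec \<O> c s t s' \<Longrightarrow> exec \<O> (If b c d) s (1 + t) s'"
| IfFalse: "\<not> holds b s \<Longrightarrow> exec \<O> d s t s' \<Longrightarrow> exec \<O> (If b c d) s (1 + t) s'"
| WhileFalse: "\<not> holds b s \<Longrightarrow> exec \<O> (While b c) s 1 s"
| WhileTrue: "holds b s \<Longrightarrow> exec \<O> c s t s' \<Longrightarrow> exec \<O> (While b c) s' t' s'' \<Longrightarrow>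
    exec \<O> (While b c) s (1 + t + t') s''"

lemma exec_deterministic:
  "exec \<O> c s t s' \<Longrightarrow> exec \<O> c s u s'' \<Longrightarrow> t = u \<and> s' = s''"
proof (induction arbitrary: u s'' rule: exec.induct)
  case (Seq c s t s' d t' s2)
  from Seq.prems obtain v w z where "exec \<O> c s v z" "exec \<O> d z w s''" "u = v + w"
    by (cases rule: exec.cases) auto
  then show ?case using Seq.IH by blast
next
  case (WhileTrue b s c t s' t' s2)
  from WhileTrue.prems WhileTrue.hyps obtain v w z where
    "exec \<O> c s v z" "exec \<O> (While b c) z w s''" "u = 1 + v + w"
    by (cases rule: exec.cases) auto
  then show ?case using WhileTrue.IH by blast
qed (erule exec.cases; force)+

text \<open>
  A problem is the set of pairs of an encoded instance and the encoded correct answer.  Words that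
  encode no instance are unconstrained: the oracle may answer them arbitrarily.
\<close>

type_synonym problem = "(bool list \<times> bool list) set"

definition turing_reducible :: "problem \<Rightarrow> problem \<Rightarrow> bool" where
  "turing_reducible P Q \<longleftrightarrow> (\<exists>(c :: prog) (q :: nat poly).
    \<forall>\<O>. (\<forall>(x, y) \<in> Q. \<O> x = y) \<longrightarrow>
      (\<forall>(x, y) \<in> P. \<exists>t s'. exec \<O> c (\<lambda>r. if r = 0 then x else []) t s' \<and>
        t \<le> poly q (length x) \<and> s' 0 = y))"

section \<open>The counting problems\<close>

definition nat_code :: "nat \<Rightarrow> bool list" where
  "nat_code n = replicate n True @ [False]"

text \<open>
  Graphs on \<open>{0, \<dots>, n - 1}\<close> are encoded by \<open>n\<close> followed by a list of the edges \<open>u < v\<close>, each listed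
  once, in any order.  Since the vertices are listed in unary by \<open>n\<close> anyway, unary vertex names
  change the length of the code only polynomially.
\<close>

definition graph_code :: "nat \<Rightarrow> (nat \<times> nat) list \<Rightarrow> bool list" where
  "graph_code n es = nat_code n @ concat (map (\<lambda>(u, v). nat_code u @ nat_code v) es)"

definition encodes_graph :: "bool list \<Rightarrow> nat pair_pre_digraph \<Rightarrow> bool" where
  "encodes_graph x G \<longleftrightarrow> pair_graph G \<and> (\<exists>n es. pverts G = {..<n} \<and> distinct es \<and>
    set es = {(u, v) \<in> parcs G. u < v} \<and> x = graph_code n es)"

definition graph_hom_problem :: "nat \<Rightarrow> 'a pair_pre_digraph \<Rightarrow> problem" where
  "graph_hom_problem p H =
    {(x, nat_code (card (homs G H) mod p)) | x G. encodes_graph x G}"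

definition bipartition :: "'a pair_pre_digraph \<Rightarrow> 'a set \<Rightarrow> 'a set \<Rightarrow> bool" where
  "bipartition G L R \<longleftrightarrow> pverts G = L \<union> R \<and> L \<inter> R = {} \<and> parcs G \<subseteq> L \<times> R \<union> R \<times> L"

definition independent_sets :: "'a pair_pre_digraph \<Rightarrow> 'a set set" where
  "independent_sets G = {I. I \<subseteq> pverts G \<and> (\<forall>u \<in> I. \<forall>v \<in> I. (u, v) \<notin> parcs G)}"

definition Z_BIS :: "int \<Rightarrow> int \<Rightarrow> 'a pair_pre_digraph \<Rightarrow> 'a set \<Rightarrow> 'a set \<Rightarrow> int" where
  "Z_BIS lam1 lam2 G L R = (\<Sum>I \<in> independent_sets G. lam1 ^ card (L \<inter> I) * lam2 ^ card (R \<inter> I))"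

text \<open>
  The vertices of a bipartite instance are numbered with the left side first; the instance is the
  size \<open>l\<close> of the left side followed by the code of the graph.
\<close>

definition bis_problem :: "nat \<Rightarrow> int \<Rightarrow> int \<Rightarrow> problem" where
  "bis_problem p lam1 lam2 =
    {(nat_code l @ x, nat_code (nat (Z_BIS lam1 lam2 G L R mod int p))) | l x G L R.
      encodes_graph x G \<and> bipartition G L R \<and> L = {..<l}}"

text \<open>The encodings are uniquely decodable, so every instance has exactly one answer.\<close>

lemma nat_code_append_eq_iff: "nat_code m @ x = nat_code n @ y \<longleftrightarrow> m = n \<and> x = y"
proof (induction m arbitrary: n)
  case 0
  show ?case by (cases n) (auto simp: nat_code_def)
next
  case (Suc m)
  show ?case
  proof (cases n)
    case 0
    then show ?thesis by (auto simp: nat_code_def)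
  next
    case (Suc k)
    then show ?thesis using Suc.IH[of k] by (simp add: nat_code_def)
  qed
qed

lemma graph_code_eq_iff: "graph_code m es = graph_code n fs \<longleftrightarrow> m = n \<and> es = fs"
proof -
  have "concat (map (\<lambda>(u, v). nat_code u @ nat_code v) es) =
      concat (map (\<lambda>(u, v). nat_code u @ nat_code v) fs) \<longleftrightarrow> es = fs"
  proof (induction es arbitrary: fs)
    case Nil
    show ?case by (cases fs) (auto simp: nat_code_def)
  next
    case (Cons e es)
    show ?case
    proof (cases fs)
      case Nil
      then show ?thesis by (cases e) (auto simp: nat_code_def)
    next
      case (Cons f gs)
      then show ?thesis
        using Cons.IH[of gs] by (cases e; cases f) (simp add: nat_code_append_eq_iff)
    qed
  qed
  then show ?thesis by (simp add: graph_code_def nat_code_append_eq_iff)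
qed

lemma encodes_graph_unique:
  assumes "encodes_graph x G" and "encodes_graph x G'"
  shows "G = G'"
proof -
  have arcs: "parcs A = {(u, v) \<in> parcs A. u < v} \<union> {(u, v) \<in> parcs A. u < v}\<inverse>"
    if "pair_graph A" for A :: "nat pair_pre_digraph"
  proof -
    interpret pair_graph A by fact
    show ?thesis using arcs_symmetric no_loops' by (auto simp: neq_iff)
  qed
  from assms have "pverts G = pverts G'"
    and "{(u, v) \<in> parcs G. u < v} = {(u, v) \<in> parcs G'. u < v}"
    by (auto simp: encodes_graph_def graph_code_eq_iff)
  moreover from assms have "pair_graph G" and "pair_graph G'"
    by (auto simp: encodes_graph_def)
  ultimately have "pverts G = pverts G'" and "parcs G = parcs G'"
    using arcs[of G] arcs[of G'] by simp_all
  then show ?thesis by simp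
qed

lemma single_valued_graph_hom_problem: "single_valued (graph_hom_problem p H)"
  unfolding single_valued_def graph_hom_problem_def using encodes_graph_unique by blast

lemma single_valued_bis_problem: "single_valued (bis_problem p lam1 lam2)"
proof -
  have sides: "R = R'" if "bipartition G L R" "bipartition G L R'"
    for G :: "nat pair_pre_digraph" and L R R'
    using that by (auto simp: bipartition_def)
  show ?thesis
  proof (rule single_valuedI)
    have elim: "\<exists>l x G R. w = nat_code l @ x \<and> encodes_graph x G \<and> bipartition G {..<l} R \<and>
        y = nat_code (nat (Z_BIS lam1 lam2 G {..<l} R mod int p))"
      if "(w, y) \<in> bis_problem p lam1 lam2" for w y
      using that by (auto simp: bis_problem_def)
    fix w y z assume "(w, y) \<in> bis_problem p lam1 lam2" "(w, z) \<in> bis_problem p lam1 lam2"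
    from elim[OF this(1)] elim[OF this(2)] obtain l x G R l' x' G' R' where
      *: "w = nat_code l @ x" "encodes_graph x G" "bipartition G {..<l} R"
      "y = nat_code (nat (Z_BIS lam1 lam2 G {..<l} R mod int p))"
      "w = nat_code l' @ x'" "encodes_graph x' G'" "bipartition G' {..<l'} R'"
      "z = nat_code (nat (Z_BIS lam1 lam2 G' {..<l'} R' mod int p))"
      by (elim exE conjE)
    then have "nat_code l @ x = nat_code l' @ x'" by simp
    then have "l = l'" and "x = x'" by (simp_all add: nat_code_append_eq_iff)
    have "G = G'" using encodes_graph_unique * \<open>x = x'\<close> by simp
    have "R = R'" using sides * \<open>l = l'\<close> \<open>G = G'\<close> by simp
    show "y = z" using * \<open>l = l'\<close> \<open>G = G'\<close> \<open>R = R'\<close> by simp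
  qed
qed

end

theory Submission
  imports Defs
begin

text \<open>
  Let \<open>K\<close> be the reduced form of \<open>H\<close>.  Orbits of an automorphism of order \<open>p\<close> on the homomorphisms
  into \<open>H\<close> have \<open>1\<close> or \<open>p\<close> elements, so the counts for \<open>H\<close> and \<open>K\<close> agree modulo \<open>p\<close>.  Since \<open>K\<close> has no
  automorphism of order \<open>p\<close>, the number of its automorphisms is invertible modulo \<open>p\<close> by Cauchy's
  theorem.  Hence constants can be pinned: put a copy of \<open>K\<close> into the query and keep, by inclusion and
  exclusion over identifications of its vertices, only the homomorphisms that are injective on the
  copy.

  In a square-free graph two vertices have at most one common neighbour.  Take a walk \<open>x\<^sub>0, \<dots>, x\<^sub>k\<close>
  without backtracking whose inner vertices have degree \<open>1\<close> modulo \<open>p\<close>.  The number of walks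
  \<open>u, z\<^sub>1, \<dots>, z\<^bsub>k-1\<^esub>, v\<close> with \<open>z\<^sub>i\<close> adjacent to \<open>x\<^sub>i\<close>, for \<open>u\<close> adjacent to \<open>x\<^sub>0\<close> and \<open>v\<close> adjacent to \<open>x\<^sub>k\<close>,
  is \<open>1\<close> modulo \<open>p\<close> if \<open>u = x\<^sub>1\<close> or \<open>v = x\<^bsub>k-1\<^esub>\<close>, and \<open>0\<close> otherwise: an edge of the independent set problem.
  If both end points have degree other than \<open>1\<close> modulo \<open>p\<close>, the weights are these degrees minus one.
  If the walk is closed, with \<open>x\<^sub>1 \<noteq> x\<^bsub>k-1\<^esub>\<close>, going through it in both directions cuts out the two
  vertices \<open>x\<^sub>1, x\<^bsub>k-1\<^esub>\<close>, and the weights are \<open>1\<close>.  One of the two kinds of walks exists: start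
  from an edge between two vertices of degree at least \<open>2\<close>, which exists as \<open>K\<close> is not a union of stars,
  and never enter a leaf.  This is possible because \<open>p\<close> leaves at one vertex could be permuted
  cyclically.
\<close>

text \<open>Pinning can fix the constants only up to an automorphism \<kappa> of \<open>K\<close>.
  This does no harm: the gadget weights depend on adjacency and degrees alone, hence agree modulo p
  for all \<kappa>. The signed sum of the counts is therefore the partition function times the
  number of automorphisms, and this is the factor that has to be inverted. A walk whose end has
  degree 1 modulo p would give the weight 0. This is the obstacle that forces the second kind of
  walk: on a closed walk the degree of the base point does not enter, because each instance vertex
  is confined to two of its neighbours. The oracle is bound only on words that code graphs, where
  each edge is listed once and as u < v. This dictates the numbering of the query vertices and the
  orientation of all gadget edges, and it rules out identifications that create a loop. Those
  contribute 0 in any case, since \<open>K\<close> is loopless. The list of queries depends only on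
  p and \<open>K\<close>, so it can be hard-wired in the program.\<close>

section \<open>Programs on stacks\<close>

text \<open>The exact time of \<open>exec\<close> depends on the data. An upper bound composes along
  \<open>Seq\<close> and \<open>While\<close>, can be shared by both branches of an
  \<open>If\<close>, and can be weakened.\<close>

definition runs :: "(bool list \<Rightarrow> bool list) \<Rightarrow> prog \<Rightarrow> state \<Rightarrow> nat \<Rightarrow> state \<Rightarrow> bool" where
  "runs \<O> c s T s' \<longleftrightarrow> (\<exists>t\<le>T. exec \<O> c s t s')"

lemma runsI: "exec \<O> c s t s' \<Longrightarrow> t \<le> T \<Longrightarrow> runs \<O> c s T s'"
  by (auto simp: runs_def)

lemma runs_mono: "runs \<O> c s T s' \<Longrightarrow> T \<le> T' \<Longrightarrow> runs \<O> c s T' s'"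
  by (auto simp: runs_def intro: order_trans)

lemma runs_eq: "runs \<O> c s T s' \<Longrightarrow> s' = s'' \<Longrightarrow> T \<le> T' \<Longrightarrow> runs \<O> c s T' s''"
  by (auto intro: runs_mono)

lemma runs_Skip: "runs \<O> Skip s 1 s"
  by (rule runsI[OF exec.Skip order_refl])

lemma runs_Push: "runs \<O> (Push r b) s 1 (s(r := b # s r))"
  by (rule runsI[OF exec.Push order_refl])

lemma runs_Pop: "runs \<O> (Pop r) s 1 (s(r := tl (s r)))"
  by (rule runsI[OF exec.Pop order_refl])

lemma runs_Query: "runs \<O> (Query q a) s (1 + length (s q) + length (\<O> (s q))) (s(a := \<O> (s q)))"
  by (rule runsI[OF exec.Query order_refl])

lemma runs_Seq:
  assumes "runs \<O> c s T s'" and "runs \<O> d s' T' s''"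
  shows "runs \<O> (Seq c d) s (T + T') s''"
proof -
  from assms obtain t t' where "t \<le> T" "exec \<O> c s t s'" "t' \<le> T'" "exec \<O> d s' t' s''"
    by (auto simp: runs_def)
  then have "exec \<O> (Seq c d) s (t + t') s''" "t + t' \<le> T + T'"
    by (auto intro: exec.Seq)
  then show ?thesis by (auto simp: runs_def)
qed

lemma runs_If:
  assumes "holds b s \<Longrightarrow> runs \<O> c s T s'" and "\<not> holds b s \<Longrightarrow> runs \<O> d s T s'"
  shows "runs \<O> (If b c d) s (1 + T) s'"
proof (cases "holds b s")
  case True
  then obtain t where "t \<le> T" "exec \<O> c s t s'" using assms by (auto simp: runs_def)
  then have "exec \<O> (If b c d) s (1 + t) s'" "1 + t \<le> 1 + T" using exec.IfTrue[OF True] by (blast, simp)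
  then show ?thesis unfolding runs_def by blast
next
  case False
  then obtain t where "t \<le> T" "exec \<O> d s t s'" using assms by (auto simp: runs_def)
  then have "exec \<O> (If b c d) s (1 + t) s'" "1 + t \<le> 1 + T" using exec.IfFalse[OF False] by (blast, simp)
  then show ?thesis unfolding runs_def by blast
qed

lemma runs_While_done: "\<not> holds b s \<Longrightarrow> runs \<O> (While b c) s 1 s"
  by (rule runsI[OF exec.WhileFalse order_refl])

lemma runs_While_step:
  assumes "holds b s" and "runs \<O> c s T s'" and "runs \<O> (While b c) s' T' s''"
  shows "runs \<O> (While b c) s (1 + T + T') s''"
proof -
  from assms obtain t t' where "t \<le> T" "exec \<O> c s t s'" "t' \<le> T'" "exec \<O> (While b c) s' t' s''"
    by (auto simp: runs_def)
  then have "exec \<O> (While b c) s (1 + t + t') s''" "1 + t + t' \<le> 1 + T + T'"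
    using exec.WhileTrue[OF assms(1)] by (blast, simp)
  then show ?thesis unfolding runs_def by blast
qed

primrec pushes :: "nat \<Rightarrow> bool list \<Rightarrow> prog" where
  "pushes r [] = Skip"
| "pushes r (b # bs) = Seq (Push r b) (pushes r bs)"

lemma runs_pushes: "runs \<O> (pushes r bs) s (1 + length bs) (s(r := rev bs @ s r))"
proof (induction bs arbitrary: s)
  case Nil
  show ?case using runs_Skip[of \<O> s] by simp
next
  case (Cons b bs)
  show ?case
    unfolding pushes.simps
    by (rule runs_eq[OF runs_Seq[OF runs_Push Cons.IH]]) auto
qed

definition push_top :: "nat \<Rightarrow> nat \<Rightarrow> prog" where
  "push_top a b = If (Top a) (Push b True) (Push b False)"

lemma runs_push_top:
  assumes "s a = x # xs"
  shows "runs \<O> (push_top a b) s 2 (s(b := x # s b))"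
proof -
  have "runs \<O> (push_top a b) s (1 + 1) (s(b := x # s b))"
    unfolding push_top_def
  proof (rule runs_If)
    assume "holds (Top a) s"
    then have "x" using assms by simp
    then show "runs \<O> (Push b True) s 1 (s(b := x # s b))" using runs_Push[of \<O> b True s] by simp
  next
    assume "\<not> holds (Top a) s"
    then have "\<not> x" using assms by simp
    then show "runs \<O> (Push b False) s 1 (s(b := x # s b))" using runs_Push[of \<O> b False s] by simp
  qed
  then show ?thesis by (simp add: numeral_2_eq_2)
qed

definition clear :: "nat \<Rightarrow> prog" where
  "clear a = While (Nonempty a) (Pop a)"

lemma runs_clear: "runs \<O> (clear a) s (1 + 2 * length (s a)) (s(a := []))"
  unfolding clear_def
proof (induction "s a" arbitrary: s)
  case Nil
  then show ?case using runs_While_done[of "Nonempty a" s \<O> "Pop a"] by (simp add: fun_upd_idem)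
next
  case (Cons x xs)
  have "xs = (s(a := tl (s a))) a" using Cons.hyps(2)[symmetric] by simp
  from runs_While_step[where b="Nonempty a", OF _ runs_Pop Cons.hyps(1)[of "s(a := tl (s a))", OF this]] Cons.hyps(2)[symmetric]
  show ?case by (auto elim!: runs_eq)
qed

definition transfer :: "nat \<Rightarrow> nat \<Rightarrow> prog" where
  "transfer a b = While (Nonempty a) (Seq (push_top a b) (Pop a))"

lemma runs_transfer:
  assumes "a \<noteq> b"
  shows "runs \<O> (transfer a b) s (1 + 4 * length (s a)) (s(a := [], b := rev (s a) @ s b))"
  unfolding transfer_def
proof (induction "s a" arbitrary: s)
  case Nil
  then show ?case using runs_While_done[of "Nonempty a" s] by (simp add: fun_upd_idem)
next
  case (Cons x xs)
  note sa = Cons.hyps(2)[symmetric]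
  let ?s = "(s(b := x # s b))(a := tl ((s(b := x # s b)) a))"
  have "xs = ?s a" using sa assms by simp
  from runs_While_step[where b="Nonempty a", OF _ runs_Seq[OF runs_push_top[where s=s, OF sa] runs_Pop]
      Cons.hyps(1)[of ?s, OF this]] sa assms
  show ?case by (auto elim!: runs_eq simp: fun_eq_iff)
qed

text \<open>A stack can be read only by emptying it, so its content passes through the scratch stack
  \<open>t\<close> and back. The length alone is copied because vertex names are unary.\<close>

definition copy_length :: "nat \<Rightarrow> nat \<Rightarrow> nat \<Rightarrow> prog" where
  "copy_length a b t =
    Seq (While (Nonempty a) (Seq (push_top a t) (Seq (Pop a) (Push b True)))) (transfer t a)"

lemma runs_copy_length:
  assumes "a \<noteq> b" "a \<noteq> t" "b \<noteq> t" "s t = []"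
  shows "runs \<O> (copy_length a b t) s (2 + 9 * length (s a))
    (s(b := replicate (length (s a)) True @ s b))"
proof -
  let ?c = "While (Nonempty a) (Seq (push_top a t) (Seq (Pop a) (Push b True)))"
  have loop: "runs \<O> ?c s (1 + 5 * length (s a))
    (s(a := [], t := rev (s a) @ s t, b := replicate (length (s a)) True @ s b))" for s
  proof (induction "s a" arbitrary: s)
    case Nil
    then show ?case using runs_While_done[of "Nonempty a" s] by (simp add: fun_upd_idem)
  next
    case (Cons x xs)
    note sa = Cons.hyps(2)[symmetric]
    let ?s1 = "s(t := x # s t)"
    let ?s2 = "?s1(a := tl (?s1 a))"
    let ?s3 = "?s2(b := True # ?s2 b)"
    have "xs = ?s3 a" using sa assms by simp
    from runs_While_step[where b="Nonempty a", OF _ runs_Seq[OF runs_push_top[where s=s, OF sa] runs_Seq[OF runs_Pop runs_Push]]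
        Cons.hyps(1)[of ?s3, OF this]] sa assms(1-3)
    show ?case by (auto elim!: runs_eq simp: fun_eq_iff replicate_append_same)
  qed
  show ?thesis unfolding copy_length_def
    by (rule runs_eq[OF runs_Seq[OF loop runs_transfer]]) (use assms in \<open>auto simp: fun_eq_iff\<close>)
qed

section \<open>Query words written from a fixed description, in quadratic time\<close>

section \<open>Writing the queries\<close>

text \<open>Writing a state as the list of its first registers turns it into an explicit term, on
  which the simplifier can compute reads and updates. All other registers are empty.\<close>

definition stk :: "bool list list \<Rightarrow> state" where
  "stk xs = (\<lambda>r. if r < length xs then xs ! r else [])"

lemma stk_apply: "r < length xs \<Longrightarrow> stk xs r = xs ! r"
  by (simp add: stk_def)

lemma stk_update: "r < length xs \<Longrightarrow> (stk xs)(r := y) = stk (xs[r := y])"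
  by (auto simp: stk_def fun_eq_iff nth_list_update)

lemma list_update_Cons_numeral: "(x # xs)[numeral k := y] = x # xs[pred_numeral k := y]"
  by (simp add: numeral_eq_Suc)

lemma list_update_Cons_1: "(x # xs)[1 := y] = x # xs[0 := y]"
  by simp

lemmas stk_simps = stk_apply stk_update list_update_Cons_numeral list_update_Cons_1 nth_Cons_numeral

text \<open>
  In a gadget, \<open>U\<close> and \<open>W\<close> stand for the vertices of the instance to which it is attached; for a
  vertex gadget \<open>W\<close> is not used.
\<close>

datatype 'c endpoint = Const 'c | U | W | Fresh nat

text \<open>Numbering of the query vertices: first the constants, then the vertices of the instance,
  then the fresh vertices in consecutive blocks. The current block starts at \<open>c\<close>, so
  its vertices exceed everything placed before.\<close>

primrec place :: "nat \<Rightarrow> nat \<Rightarrow> nat \<Rightarrow> nat endpoint \<Rightarrow> nat" where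
  "place c u w (Const i) = i"
| "place c u w U = u"
| "place c u w W = w"
| "place c u w (Fresh i) = c + i"

definition inst :: "nat \<Rightarrow> nat \<Rightarrow> nat \<Rightarrow> (nat endpoint \<times> nat endpoint) list \<Rightarrow> (nat \<times> nat) list" where
  "inst c u w = map (map_prod (place c u w) (place c u w))"

definition edges_code :: "(nat \<times> nat) list \<Rightarrow> bool list" where
  "edges_code es = concat (map (\<lambda>(u, v). nat_code u @ nat_code v) es)"

lemma edges_code_simps [simp]:
  "edges_code [] = []"
  "edges_code ((u, v) # es) = nat_code u @ nat_code v @ edges_code es"
  by (simp_all add: edges_code_def)

lemma graph_code_eq: "graph_code n es = nat_code n @ edges_code es"
  by (simp add: graph_code_def edges_code_def)

text \<open>
  Register conventions: 0 holds the edges of the instance (1 those already read), 2 the sides of its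
  vertices (3 those already popped), 4 and 5 the ends of the current edge, 6 the next fresh vertex,
  8 the query, 9 its answer and 10 the weighted sum of the answers; 7 is scratch space.  The query is
  written back to front.
\<close>

primrec emit_name :: "nat \<Rightarrow> nat \<Rightarrow> nat \<Rightarrow> nat endpoint \<Rightarrow> prog" where
  "emit_name m ru rw (Const i) = pushes 8 (replicate i True)"
| "emit_name m ru rw U = Seq (copy_length ru 8 7) (pushes 8 (replicate m True))"
| "emit_name m ru rw W = Seq (copy_length rw 8 7) (pushes 8 (replicate m True))"
| "emit_name m ru rw (Fresh i) = Seq (copy_length 6 8 7) (pushes 8 (replicate i True))"

text \<open>Pushing produces a word from its end, so the terminator of the unary name goes first.
  For the same reason \<open>emit_edges\<close> writes the second end of an edge before the
  first.\<close>

definition emit_vertex :: "nat \<Rightarrow> nat \<Rightarrow> nat \<Rightarrow> nat endpoint \<Rightarrow> prog" where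
  "emit_vertex m ru rw x = Seq (Push 8 False) (emit_name m ru rw x)"

primrec emit_edges :: "nat \<Rightarrow> nat \<Rightarrow> nat \<Rightarrow> (nat endpoint \<times> nat endpoint) list \<Rightarrow> prog" where
  "emit_edges m ru rw [] = Skip"
| "emit_edges m ru rw (e # T) =
    Seq (Seq (emit_vertex m ru rw (snd e)) (emit_vertex m ru rw (fst e))) (emit_edges m ru rw T)"

abbreviation place_in :: "nat \<Rightarrow> nat \<Rightarrow> nat \<Rightarrow> state \<Rightarrow> nat endpoint \<Rightarrow> nat" where
  "place_in m ru rw s \<equiv> place (length (s 6)) (m + length (s ru)) (m + length (s rw))"

text \<open>The order of the quantifiers is the point: \<open>K\<close> is chosen before the oracle,
  the state and the size bound \<open>N\<close>, so it depends only on the data built into the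
  program. The later predicates with suffix \<open>_time\<close> have the same purpose.\<close>

definition emit_vertex_time :: "nat \<Rightarrow> nat \<Rightarrow> nat \<Rightarrow> nat endpoint \<Rightarrow> nat \<Rightarrow> bool" where
  "emit_vertex_time m ru rw x K \<longleftrightarrow> (\<forall>\<O> s N. s 7 = [] \<longrightarrow> length (s ru) \<le> N \<longrightarrow> length (s rw) \<le> N \<longrightarrow>
      length (s 6) \<le> N \<longrightarrow> runs \<O> (emit_vertex m ru rw x) s (K * (N + 1))
      (s(8 := nat_code (place_in m ru rw s x) @ s 8)))"

lemma runs_emit_vertex:
  assumes "ru \<notin> {7, 8}" and "rw \<notin> {7, 8}"
  obtains K where "emit_vertex_time m ru rw x K"
proof -
  have copy: "runs \<O> (Seq (Push 8 False) (Seq (copy_length r 8 7) (pushes 8 (replicate i True)))) s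
      ((i + 13) * (N + 1)) (s(8 := nat_code (i + length (s r)) @ s 8))"
    if "r \<notin> {7, 8}" "s 7 = []" "length (s r) \<le> N" for \<O> r s N i
  proof -
    have "runs \<O> (Seq (Push 8 False) (Seq (copy_length r 8 7) (pushes 8 (replicate i True)))) s
      (1 + ((2 + 9 * length (s r)) + (1 + i))) (s(8 := nat_code (i + length (s r)) @ s 8))"
      by (rule runs_eq[OF runs_Seq[OF runs_Push runs_Seq[OF runs_copy_length runs_pushes]]])
        (use that in \<open>auto simp: nat_code_def replicate_add\<close>)
    then show ?thesis
      by (rule runs_mono) (use that in \<open>simp add: algebra_simps\<close>)
  qed
  show thesis
  proof (cases x)
    case (Const i)
    have "runs \<O> (emit_vertex m ru rw x) s (2 + i) (s(8 := nat_code i @ s 8))" for \<O> s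
      unfolding Const emit_vertex_def emit_name.simps
      by (rule runs_eq[OF runs_Seq[OF runs_Push runs_pushes]]) (auto simp: nat_code_def)
    then have "runs \<O> (emit_vertex m ru rw x) s ((2 + i) * (N + 1)) (s(8 := nat_code i @ s 8))"
      for \<O> s N by (rule runs_mono) simp
    then show ?thesis using that[of "2 + i"] unfolding Const emit_vertex_time_def by simp
  next
    case U
    show ?thesis
      by (rule that[of "m + 13"])
        (unfold emit_vertex_time_def emit_vertex_def U emit_name.simps place.simps, intro allI impI copy[OF assms(1)])
  next
    case W
    show ?thesis
      by (rule that[of "m + 13"])
        (unfold emit_vertex_time_def emit_vertex_def W emit_name.simps place.simps, intro allI impI copy[OF assms(2)])
  next
    case (Fresh i)
    have 6: "(6::nat) \<notin> {7, 8}" by simp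
    show ?thesis
      by (rule that[of "i + 13"])
        (unfold emit_vertex_time_def emit_vertex_def Fresh emit_name.simps place.simps add.commute[of _ i], intro allI impI copy[OF 6])
  qed
qed

definition emit_edges_time :: "nat \<Rightarrow> nat \<Rightarrow> nat \<Rightarrow> (nat endpoint \<times> nat endpoint) list \<Rightarrow> nat \<Rightarrow> bool" where
  "emit_edges_time m ru rw T K \<longleftrightarrow> (\<forall>\<O> s N es. s 7 = [] \<longrightarrow> length (s ru) \<le> N \<longrightarrow> length (s rw) \<le> N \<longrightarrow>
      length (s 6) \<le> N \<longrightarrow> s 8 = edges_code es \<longrightarrow>
    runs \<O> (emit_edges m ru rw T) s (K * (N + 1)) (s(8 := edges_code
      (rev (inst (length (s 6)) (m + length (s ru)) (m + length (s rw)) T) @ es))))"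

lemma runs_emit_edges:
  assumes "ru \<notin> {7, 8}" and "rw \<notin> {7, 8}"
  obtains K where "emit_edges_time m ru rw T K"
proof (induction T arbitrary: thesis)
  case Nil
  have "runs \<O> Skip s (1 * (N + 1)) s" if "s 8 = edges_code es" for \<O> s N es
    by (rule runs_eq[OF runs_Skip]) (use that in auto)
  then show ?case by (intro Nil[of 1]) (simp add: emit_edges_time_def inst_def fun_upd_idem)
next
  case (Cons e T)
  obtain K where K': "emit_edges_time m ru rw T K"
    by (rule Cons.IH)
  note K = K'[unfolded emit_edges_time_def, rule_format]
  obtain L1 where L1': "emit_vertex_time m ru rw (snd e) L1"
    by (rule runs_emit_vertex[OF assms])
  note L1 = L1'[unfolded emit_vertex_time_def, rule_format]
  obtain L2 where L2': "emit_vertex_time m ru rw (fst e) L2"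
    by (rule runs_emit_vertex[OF assms])
  note L2 = L2'[unfolded emit_vertex_time_def, rule_format]
  have "runs \<O> (emit_edges m ru rw (e # T)) s ((L1 + L2 + K) * (N + 1)) (s(8 := edges_code
      (rev (inst (length (s 6)) (m + length (s ru)) (m + length (s rw)) (e # T)) @ es)))"
    if that: "s 7 = []" "length (s ru) \<le> N" "length (s rw) \<le> N" "length (s 6) \<le> N"
      "s 8 = edges_code es" for \<O> s N es
  proof -
    let ?p = "place_in m ru rw s"
    let ?s1 = "s(8 := nat_code (?p (snd e)) @ s 8)"
    let ?s2 = "?s1(8 := nat_code (place_in m ru rw ?s1 (fst e)) @ ?s1 8)"
    have [simp]: "ru \<noteq> 8" "rw \<noteq> 8" using assms by auto
    have "runs \<O> (emit_edges m ru rw (e # T)) s (L1 * (N + 1) + L2 * (N + 1) + K * (N + 1))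
      (?s2(8 := edges_code (rev (inst (length (?s2 6)) (m + length (?s2 ru)) (m + length (?s2 rw)) T)
        @ (?p (fst e), ?p (snd e)) # es)))"
      unfolding emit_edges.simps
      by (rule runs_Seq[OF runs_Seq[OF L1[of s N] L2[of ?s1 N]] K[of ?s2 N]]) (use that in auto)
    then show ?thesis
      by (rule runs_eq) (auto simp: inst_def map_prod_def split_beta algebra_simps)
  qed
  then show ?case by (intro Cons.prems emit_edges_time_def[THEN iffD2] allI impI)
qed

text \<open>The part of a query that does not depend on the instance. Left and right gadgets share
  \<open>vertex_fresh\<close>, so the block of fresh vertices advances by the same amount at every
  vertex.\<close>

record blueprint =
  cnum :: nat
  const_edges :: "(nat \<times> nat) list"
  vertex_fresh :: nat
  left_edges :: "(nat endpoint \<times> nat endpoint) list"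
  right_edges :: "(nat endpoint \<times> nat endpoint) list"
  edge_fresh :: nat
  bis_edges :: "(nat endpoint \<times> nat endpoint) list"

text \<open>The vertices are met in the order in which they are popped, so the current one has as
  its number the count \<open>length bs\<close> of those still on the stack.\<close>

primrec vertex_edges :: "blueprint \<Rightarrow> bool list \<Rightarrow> nat \<Rightarrow> (nat \<times> nat) list \<Rightarrow> (nat \<times> nat) list" where
  "vertex_edges D [] c acc = acc"
| "vertex_edges D (b # bs) c acc = vertex_edges D bs (c + vertex_fresh D)
    (rev (inst c (cnum D + length bs) (cnum D + length bs)
      (if b then right_edges D else left_edges D)) @ acc)"

primrec edge_edges :: "blueprint \<Rightarrow> (nat \<times> nat) list \<Rightarrow> nat \<Rightarrow> (nat \<times> nat) list \<Rightarrow> (nat \<times> nat) list" where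
  "edge_edges D [] c acc = acc"
| "edge_edges D (e # es) c acc = edge_edges D es (c + edge_fresh D)
    (rev (inst c (cnum D + fst e) (cnum D + snd e) (bis_edges D)) @ acc)"

definition query_size :: "blueprint \<Rightarrow> nat \<Rightarrow> nat \<Rightarrow> nat" where
  "query_size D n k = cnum D + n + vertex_fresh D * n + edge_fresh D * k"

text \<open>
  The sides of the vertices \<open>n - 1, \<dots>, 0\<close>, in the order in which they are popped; \<open>True\<close> is the
  right side.
\<close>

abbreviation sides :: "nat \<Rightarrow> nat \<Rightarrow> bool list" where
  "sides l n \<equiv> replicate (n - l) True @ replicate l False"

definition query_edges :: "blueprint \<Rightarrow> bool list \<Rightarrow> (nat \<times> nat) list \<Rightarrow> (nat \<times> nat) list" where
  "query_edges D bs es = edge_edges D es (query_size D (length bs) 0)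
    (vertex_edges D bs (cnum D + length bs) (const_edges D))"

text \<open>After the pop, the height of register 2 is the number of the vertex just removed. Hence
  register 2 itself can serve as the unary name of \<open>U\<close>.\<close>

definition vertex_loop :: "blueprint \<Rightarrow> prog" where
  "vertex_loop D = While (Nonempty 2) (Seq
    (If (Top 2) (Seq (Push 3 True) (Seq (Pop 2) (emit_edges (cnum D) 2 2 (right_edges D))))
      (Seq (Push 3 False) (Seq (Pop 2) (emit_edges (cnum D) 2 2 (left_edges D)))))
    (pushes 6 (replicate (vertex_fresh D) True)))"

definition vertex_loop_time :: "blueprint \<Rightarrow> nat \<Rightarrow> bool" where
  "vertex_loop_time D K \<longleftrightarrow> (\<forall>\<O> N bs e e' v' u w c q a ac.
    length bs \<le> N \<longrightarrow> c + vertex_fresh D * length bs \<le> N \<longrightarrow>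
    runs \<O> (vertex_loop D)
      (stk [e, e', bs, v', u, w, replicate c True, [], edges_code q, a, ac])
      (1 + K * (N + 1) * length bs)
      (stk [e, e', [], rev bs @ v', u, w, replicate (c + vertex_fresh D * length bs) True, [],
        edges_code (vertex_edges D bs c q), a, ac]))"

lemma runs_vertex_loop:
  obtains K where "vertex_loop_time D K"
proof -
  have reg: "(2::nat) \<notin> {7, 8}" by simp
  obtain K1 where K1': "emit_edges_time (cnum D) 2 2 (left_edges D) K1"
    by (rule runs_emit_edges[OF reg reg, of "cnum D" "left_edges D"])
  note K1 = K1'[unfolded emit_edges_time_def, rule_format]
  obtain K2 where K2': "emit_edges_time (cnum D) 2 2 (right_edges D) K2"
    by (rule runs_emit_edges[OF reg reg, of "cnum D" "right_edges D"])
  note K2 = K2'[unfolded emit_edges_time_def, rule_format]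
  define K where "K = K1 + K2 + vertex_fresh D + 5"
  have "runs \<O> (vertex_loop D)
      (stk [e, e', bs, v', u, w, replicate c True, [], edges_code q, a, ac])
      (1 + K * (N + 1) * length bs)
      (stk [e, e', [], rev bs @ v', u, w, replicate (c + vertex_fresh D * length bs) True, [],
        edges_code (vertex_edges D bs c q), a, ac])"
    if "length bs \<le> N" "c + vertex_fresh D * length bs \<le> N" for \<O> N bs e e' v' u w c q a ac
    using that
  proof (induction bs arbitrary: c v' q)
    case Nil
    show ?case unfolding vertex_loop_def
      by (rule runs_eq[OF runs_While_done]) (auto simp: stk_simps)
  next
    case (Cons b bs)
    let ?s = "stk [e, e', b # bs, v', u, w, replicate c True, [], edges_code q, a, ac]"
    let ?q = "rev (inst c (cnum D + length bs) (cnum D + length bs)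
      (if b then right_edges D else left_edges D)) @ q"
    let ?s1 = "stk [e, e', bs, b # v', u, w, replicate c True, [], edges_code ?q, a, ac]"
    let ?s2 = "stk [e, e', bs, b # v', u, w, replicate (c + vertex_fresh D) True, [], edges_code ?q, a, ac]"
    have 1: "runs \<O> (If (Top 2) (Seq (Push 3 True) (Seq (Pop 2) (emit_edges (cnum D) 2 2 (right_edges D))))
      (Seq (Push 3 False) (Seq (Pop 2) (emit_edges (cnum D) 2 2 (left_edges D)))))
      ?s (1 + (2 + (K1 + K2) * (N + 1))) ?s1"
    proof (rule runs_If)
      assume "holds (Top 2) ?s"
      then have b: "b" by (simp add: stk_simps)
      show "runs \<O> (Seq (Push 3 True) (Seq (Pop 2) (emit_edges (cnum D) 2 2 (right_edges D)))) ?s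
        (2 + (K1 + K2) * (N + 1)) ?s1"
        by (rule runs_eq[OF runs_Seq[OF runs_Push runs_Seq[OF runs_Pop K2[of _ N q]]]])
          (use b Cons.prems in \<open>auto simp: stk_simps algebra_simps\<close>)
    next
      assume "\<not> holds (Top 2) ?s"
      then have b: "\<not> b" by (simp add: stk_simps)
      show "runs \<O> (Seq (Push 3 False) (Seq (Pop 2) (emit_edges (cnum D) 2 2 (left_edges D)))) ?s
        (2 + (K1 + K2) * (N + 1)) ?s1"
        by (rule runs_eq[OF runs_Seq[OF runs_Push runs_Seq[OF runs_Pop K1[of _ N q]]]])
          (use b Cons.prems in \<open>auto simp: stk_simps algebra_simps\<close>)
    qed
    have 2: "runs \<O> (pushes 6 (replicate (vertex_fresh D) True)) ?s1 (1 + vertex_fresh D) ?s2"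
      by (rule runs_eq[OF runs_pushes]) (auto simp: stk_simps replicate_add[symmetric] add.commute)
    have 3: "runs \<O> (vertex_loop D) ?s2 (1 + K * (N + 1) * length bs)
      (stk [e, e', [], rev bs @ (b # v'), u, w,
        replicate (c + vertex_fresh D + vertex_fresh D * length bs) True, [],
        edges_code (vertex_edges D bs (c + vertex_fresh D) ?q), a, ac])"
      using Cons.prems by (intro Cons.IH) (auto simp: algebra_simps)
    show ?case
      unfolding vertex_loop_def
      by (rule runs_eq[OF runs_While_step[OF _ runs_Seq[OF 1 2] 3[unfolded vertex_loop_def]]])
        (auto simp: stk_simps K_def algebra_simps)
  qed
  then show thesis by (intro that vertex_loop_time_def[THEN iffD2] allI impI)
qed

text \<open>The bits read are saved in register 1 in reverse order, from where a single
  \<open>transfer\<close> restores the edge list for the next query.\<close>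

definition read_unary :: "nat \<Rightarrow> prog" where
  "read_unary r = Seq (While (Top 0) (Seq (Pop 0) (Seq (Push 1 True) (Push r True))))
    (Seq (Pop 0) (Push 1 False))"

lemma runs_read_unary:
  assumes "r \<notin> {0, 1}" and "s 0 = nat_code k @ rest"
  shows "runs \<O> (read_unary r) s (3 + 4 * k)
    (s(0 := rest, 1 := rev (nat_code k) @ s 1, r := replicate k True @ s r))"
proof -
  have loop: "runs \<O> (While (Top 0) (Seq (Pop 0) (Seq (Push 1 True) (Push r True)))) s (1 + 4 * k)
      (s(0 := False # rest, 1 := replicate k True @ s 1, r := replicate k True @ s r))"
    if "s 0 = nat_code k @ rest" for s
    using that
  proof (induction k arbitrary: s)
    case 0
    then show ?case
      by (intro runs_eq[OF runs_While_done]) (auto simp: nat_code_def fun_eq_iff)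
  next
    case (Suc k)
    let ?s1 = "s(0 := tl (s 0))"
    let ?s2 = "?s1(1 := True # ?s1 1)"
    let ?s3 = "?s2(r := True # ?s2 r)"
    have "?s3 0 = nat_code k @ rest" using Suc.prems assms(1) by (simp add: nat_code_def)
    note IH = Suc.IH[of ?s3, OF this]
    have "holds (Top 0) s" using Suc.prems by (simp add: nat_code_def)
    from runs_While_step[OF this runs_Seq[OF runs_Pop runs_Seq[OF runs_Push runs_Push]] IH] assms(1)
    show ?case by (auto elim!: runs_eq simp: fun_eq_iff replicate_append_same)
  qed
  show ?thesis unfolding read_unary_def
    by (rule runs_eq[OF runs_Seq[OF loop[of s, OF assms(2)] runs_Seq[OF runs_Pop runs_Push]]])
      (use assms(1) in \<open>auto simp: fun_eq_iff nat_code_def\<close>)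
qed

definition edge_loop :: "blueprint \<Rightarrow> prog" where
  "edge_loop D = While (Nonempty 0)
    (Seq (read_unary 4) (Seq (read_unary 5) (Seq (emit_edges (cnum D) 4 5 (bis_edges D))
      (Seq (clear 4) (Seq (clear 5) (pushes 6 (replicate (edge_fresh D) True)))))))"

definition edge_loop_time :: "blueprint \<Rightarrow> nat \<Rightarrow> bool" where
  "edge_loop_time D K \<longleftrightarrow> (\<forall>\<O> N es e' v v' c q a ac. set es \<subseteq> {..N} \<times> {..N} \<longrightarrow>
      c + edge_fresh D * length es \<le> N \<longrightarrow>
    runs \<O> (edge_loop D)
      (stk [edges_code es, e', v, v', [], [], replicate c True, [], edges_code q, a, ac])
      (1 + K * (N + 1) * length es)
      (stk [[], rev (edges_code es) @ e', v, v', [], [],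
        replicate (c + edge_fresh D * length es) True, [],
        edges_code (edge_edges D es c q), a, ac]))"

lemma runs_edge_loop:
  obtains K where "edge_loop_time D K"
proof -
  have reg: "(4::nat) \<notin> {7, 8}" "(5::nat) \<notin> {7, 8}" by simp_all
  obtain K1 where K1': "emit_edges_time (cnum D) 4 5 (bis_edges D) K1"
    by (rule runs_emit_edges[OF reg, of "cnum D" "bis_edges D"])
  note K1 = K1'[unfolded emit_edges_time_def, rule_format]
  define K where "K = K1 + edge_fresh D + 22"
  have "runs \<O> (edge_loop D)
      (stk [edges_code es, e', v, v', [], [], replicate c True, [], edges_code q, a, ac])
      (1 + K * (N + 1) * length es)
      (stk [[], rev (edges_code es) @ e', v, v', [], [],
        replicate (c + edge_fresh D * length es) True, [],
        edges_code (edge_edges D es c q), a, ac])"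
    if "set es \<subseteq> {..N} \<times> {..N}" "c + edge_fresh D * length es \<le> N"
    for \<O> N es e' v v' c q a ac
    using that
  proof (induction es arbitrary: c e' q)
    case Nil
    show ?case unfolding edge_loop_def
      by (rule runs_eq[OF runs_While_done]) (auto simp: stk_simps)
  next
    case (Cons e es)
    obtain x y where e: "e = (x, y)" by force
    have le: "x \<le> N" "y \<le> N" "c \<le> N" using Cons.prems e by auto
    let ?q = "rev (inst c (cnum D + x) (cnum D + y) (bis_edges D)) @ q"
    let ?e = "rev (nat_code y) @ rev (nat_code x) @ e'"
    let ?s0 = "stk [edges_code (e # es), e', v, v', [], [], replicate c True, [], edges_code q, a, ac]"
    let ?s1 = "stk [nat_code y @ edges_code es, rev (nat_code x) @ e', v, v',
      replicate x True, [], replicate c True, [], edges_code q, a, ac]"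
    let ?s2 = "stk [edges_code es, ?e, v, v',
      replicate x True, replicate y True, replicate c True, [], edges_code q, a, ac]"
    let ?s3 = "stk [edges_code es, ?e, v, v',
      replicate x True, replicate y True, replicate c True, [], edges_code ?q, a, ac]"
    let ?s4 = "stk [edges_code es, ?e, v, v', [], [],
      replicate (c + edge_fresh D) True, [], edges_code ?q, a, ac]"
    have 1: "runs \<O> (read_unary 4) ?s0 (3 + 4 * x) ?s1"
      by (rule runs_eq[OF runs_read_unary]) (auto simp: stk_simps e)
    have 2: "runs \<O> (read_unary 5) ?s1 (3 + 4 * y) ?s2"
      by (rule runs_eq[OF runs_read_unary]) (auto simp: stk_simps)
    have 3: "runs \<O> (emit_edges (cnum D) 4 5 (bis_edges D)) ?s2 (K1 * (N + 1)) ?s3"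
      by (rule runs_eq[OF K1[of _ N q]]) (use le in \<open>auto simp: stk_simps\<close>)
    have 4: "runs \<O> (Seq (clear 4) (Seq (clear 5) (pushes 6 (replicate (edge_fresh D) True))))
      ?s3 ((1 + 2 * x) + ((1 + 2 * y) + (1 + edge_fresh D))) ?s4"
      by (rule runs_eq[OF runs_Seq[OF runs_clear runs_Seq[OF runs_clear runs_pushes]]])
        (auto simp: stk_simps replicate_add[symmetric] add.commute)
    have 5: "runs \<O> (edge_loop D) ?s4 (1 + K * (N + 1) * length es)
      (stk [[], rev (edges_code es) @ ?e, v, v', [], [],
        replicate (c + edge_fresh D + edge_fresh D * length es) True, [],
        edges_code (edge_edges D es (c + edge_fresh D) ?q), a, ac])"
      using Cons.prems by (intro Cons.IH) (auto simp: algebra_simps)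
    have ne: "holds (Nonempty 0) ?s0" by (simp add: stk_simps e nat_code_def)
    have time: "1 + ((3 + 4 * x) + ((3 + 4 * y) + (K1 * (N + 1) +
        ((1 + 2 * x) + ((1 + 2 * y) + (1 + edge_fresh D)))))) + (1 + K * (N + 1) * length es)
      \<le> 1 + K * (N + 1) * length (e # es)"
    proof -
      have "1 + ((3 + 4 * x) + ((3 + 4 * y) + (K1 * (N + 1) +
        ((1 + 2 * x) + ((1 + 2 * y) + (1 + edge_fresh D)))))) \<le> K * (N + 1)"
        using le by (simp add: K_def algebra_simps)
      then show ?thesis by simp
    qed
    show ?case
      unfolding edge_loop_def
      by (rule runs_eq[OF runs_While_step[OF ne runs_Seq[OF 1 runs_Seq[OF 2 runs_Seq[OF 3 4]]]
        5[unfolded edge_loop_def]] _ time]) (auto simp: e algebra_simps)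
  qed
  then show thesis by (intro that edge_loop_time_def[THEN iffD2] allI impI)
qed

text \<open>A step of cost t lengthens a stack by at most t, since an oracle call pays for the
  length of its answer. Thus the time spent on writing a query bounds its length.\<close>

lemma exec_growth: "exec \<O> c s t s' \<Longrightarrow> length (s' r) \<le> length (s r) + t"
  by (induction rule: exec.induct) auto

lemma runs_growth: "runs \<O> c s T s' \<Longrightarrow> length (s' r) \<le> length (s r) + T"
  unfolding runs_def using exec_growth by (meson add_left_mono order_trans)

text \<open>Register 6 starts as the number of constants and instance vertices, which is the first
  free number, and ends as the number of all query vertices. This total is the header of the code
  and is therefore written last. The transfers put sides and edges of the instance back for the next
  query.\<close>

definition build_query :: "blueprint \<Rightarrow> prog" where
  "build_query D =
    Seq (pushes 8 (rev (edges_code (const_edges D))))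
    (Seq (copy_length 2 6 7)
    (Seq (pushes 6 (replicate (cnum D) True))
    (Seq (vertex_loop D)
    (Seq (transfer 3 2)
    (Seq (edge_loop D)
    (Seq (transfer 1 0)
    (Seq (Push 8 False)
    (copy_length 6 8 7))))))))"

definition build_query_time :: "blueprint \<Rightarrow> nat \<Rightarrow> bool" where
  "build_query_time D K \<longleftrightarrow> (\<forall>\<O> N bs es ac. set es \<subseteq> {..N} \<times> {..N} \<longrightarrow>
      query_size D (length bs) (length es) \<le> N \<longrightarrow> length es \<le> N \<longrightarrow> length (edges_code es) \<le> N \<longrightarrow>
    runs \<O> (build_query D)
      (stk [edges_code es, [], bs, [], [], [], [], [], [], [], ac]) (K * (N + 1) ^ 2)
      (stk [edges_code es, [], bs, [], [], [],
        replicate (query_size D (length bs) (length es)) True, [],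
        graph_code (query_size D (length bs) (length es)) (query_edges D bs es), [], ac]))"

lemma runs_build_query:
  obtains K where "build_query_time D K"
proof -
  obtain K1 where K1': "vertex_loop_time D K1"
    by (rule runs_vertex_loop[of D])
  note K1 = K1'[unfolded vertex_loop_time_def, rule_format]
  obtain K2 where K2': "edge_loop_time D K2"
    by (rule runs_edge_loop[of D])
  note K2 = K2'[unfolded edge_loop_time_def, rule_format]
  define L where "L = length (edges_code (const_edges D))"
  define K where "K = K1 + K2 + L + cnum D + 40"
  have "runs \<O> (build_query D)
      (stk [edges_code es, [], bs, [], [], [], [], [], [], [], ac]) (K * (N + 1) ^ 2)
      (stk [edges_code es, [], bs, [], [], [],
        replicate (query_size D (length bs) (length es)) True, [],
        graph_code (query_size D (length bs) (length es)) (query_edges D bs es), [], ac])"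
    if es: "set es \<subseteq> {..N} \<times> {..N}"
      and N: "query_size D (length bs) (length es) \<le> N" "length es \<le> N" "length (edges_code es) \<le> N"
    for \<O> N bs es ac
  proof -
    let ?E = "edges_code es"
    let ?n = "length bs"
    let ?c = "cnum D + ?n"
    let ?q1 = "vertex_edges D bs ?c (const_edges D)"
    let ?n' = "query_size D ?n (length es)"
    have n: "?n \<le> N" using N by (simp add: query_size_def)
    have 1: "runs \<O> (pushes 8 (rev (edges_code (const_edges D))))
      (stk [?E, [], bs, [], [], [], [], [], [], [], ac]) (1 + L)
      (stk [?E, [], bs, [], [], [], [], [], edges_code (const_edges D), [], ac])"
      by (rule runs_eq[OF runs_pushes]) (auto simp: stk_simps L_def)
    have 2: "runs \<O> (copy_length 2 6 7)
      (stk [?E, [], bs, [], [], [], [], [], edges_code (const_edges D), [], ac]) (2 + 9 * ?n)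
      (stk [?E, [], bs, [], [], [], replicate ?n True, [], edges_code (const_edges D), [], ac])"
      by (rule runs_eq[OF runs_copy_length]) (auto simp: stk_simps)
    have 3: "runs \<O> (pushes 6 (replicate (cnum D) True))
      (stk [?E, [], bs, [], [], [], replicate ?n True, [], edges_code (const_edges D), [], ac])
      (1 + cnum D)
      (stk [?E, [], bs, [], [], [], replicate ?c True, [], edges_code (const_edges D), [], ac])"
      by (rule runs_eq[OF runs_pushes]) (auto simp: stk_simps replicate_add)
    have 4: "runs \<O> (vertex_loop D)
      (stk [?E, [], bs, [], [], [], replicate ?c True, [], edges_code (const_edges D), [], ac])
      (1 + K1 * (N + 1) * ?n)
      (stk [?E, [], [], rev bs, [], [], replicate (query_size D ?n 0) True, [],
        edges_code ?q1, [], ac])"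
      by (rule runs_eq[OF K1[of _ N]]) (use N n in \<open>auto simp: query_size_def\<close>)
    have 5: "runs \<O> (transfer 3 2)
      (stk [?E, [], [], rev bs, [], [], replicate (query_size D ?n 0) True, [], edges_code ?q1, [], ac])
      (1 + 4 * ?n)
      (stk [?E, [], bs, [], [], [], replicate (query_size D ?n 0) True, [], edges_code ?q1, [], ac])"
      by (rule runs_eq[OF runs_transfer]) (auto simp: stk_simps)
    have 6: "runs \<O> (edge_loop D)
      (stk [?E, [], bs, [], [], [], replicate (query_size D ?n 0) True, [], edges_code ?q1, [], ac])
      (1 + K2 * (N + 1) * length es)
      (stk [[], rev ?E, bs, [], [], [], replicate ?n' True, [],
        edges_code (query_edges D bs es), [], ac])"
      by (rule runs_eq[OF K2[of _ N]])
        (use N n es in \<open>auto simp: query_size_def query_edges_def\<close>)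
    have 7: "runs \<O> (transfer 1 0)
      (stk [[], rev ?E, bs, [], [], [], replicate ?n' True, [], edges_code (query_edges D bs es), [], ac])
      (1 + 4 * length ?E)
      (stk [?E, [], bs, [], [], [], replicate ?n' True, [], edges_code (query_edges D bs es), [], ac])"
      by (rule runs_eq[OF runs_transfer]) (auto simp: stk_simps)
    have 8: "runs \<O> (Seq (Push 8 False) (copy_length 6 8 7))
      (stk [?E, [], bs, [], [], [], replicate ?n' True, [], edges_code (query_edges D bs es), [], ac])
      (1 + (2 + 9 * ?n'))
      (stk [?E, [], bs, [], [], [], replicate ?n' True, [],
        graph_code ?n' (query_edges D bs es), [], ac])"
      by (rule runs_eq[OF runs_Seq[OF runs_Push runs_copy_length]])
        (auto simp: stk_simps graph_code_eq nat_code_def)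
    have "(1 + L) + ((2 + 9 * ?n) + ((1 + cnum D) + ((1 + K1 * (N + 1) * ?n) + ((1 + 4 * ?n) +
      ((1 + K2 * (N + 1) * length es) + ((1 + 4 * length ?E) + (1 + (2 + 9 * ?n'))))))))
      \<le> (L + 1) + (9 * N + 2) + (cnum D + 1) + (K1 * (N + 1) * N + 1) + (4 * N + 1) +
        (K2 * (N + 1) * N + 1) + (4 * N + 1) + (9 * N + 3)"
    proof -
      have "K1 * (N + 1) * ?n \<le> K1 * (N + 1) * N" "K2 * (N + 1) * length es \<le> K2 * (N + 1) * N"
        using n N by (auto intro: mult_left_mono)
      then show ?thesis using n N by linarith
    qed
    also have "\<dots> \<le> K * (N + 1) ^ 2"
      by (simp add: K_def power2_eq_square algebra_simps)
    finally show ?thesis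
      unfolding build_query_def
      by (rule runs_mono[OF runs_Seq[OF 1 runs_Seq[OF 2 runs_Seq[OF 3 runs_Seq[OF 4 runs_Seq[OF 5
        runs_Seq[OF 6 runs_Seq[OF 7 8]]]]]]]])
  qed
  then show thesis by (intro that build_query_time_def[THEN iffD2] allI impI)
qed

text \<open>The answer is unary, so a multiplication by the weight amounts to pushing
  \<open>snd Dk\<close> marks onto register 10 for every mark of the answer.\<close>

definition ask :: "blueprint \<times> nat \<Rightarrow> prog" where
  "ask Dk = Seq (build_query (fst Dk)) (Seq (Query 8 9) (Seq (clear 8) (Seq (clear 6)
    (Seq (While (Top 9) (Seq (Pop 9) (pushes 10 (replicate (snd Dk) True)))) (Pop 9)))))"

definition ask_time :: "blueprint \<Rightarrow> nat \<Rightarrow> nat \<Rightarrow> bool" where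
  "ask_time D k K \<longleftrightarrow> (\<forall>\<O> N bs es r a. set es \<subseteq> {..N} \<times> {..N} \<longrightarrow>
      query_size D (length bs) (length es) \<le> N \<longrightarrow> length es \<le> N \<longrightarrow> length (edges_code es) \<le> N \<longrightarrow>
      r \<le> N \<longrightarrow>
      \<O> (graph_code (query_size D (length bs) (length es)) (query_edges D bs es)) = nat_code r \<longrightarrow>
    runs \<O> (ask (D, k))
      (stk [edges_code es, [], bs, [], [], [], [], [], [], [], replicate a True]) (K * (N + 1) ^ 2)
      (stk [edges_code es, [], bs, [], [], [], [], [], [], [], replicate (k * r + a) True]))"

lemma runs_ask:
  obtains K where "ask_time D k K"
proof -
  obtain K1 where K1': "build_query_time D K1"
    by (rule runs_build_query[of D])
  note K1 = K1'[unfolded build_query_time_def, rule_format]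
  let ?loop = "While (Top 9) (Seq (Pop 9) (pushes 10 (replicate k True)))"
  have loop: "runs \<O> ?loop (stk [e, [], bs, [], [], [], [], [], [], nat_code r, replicate a True])
    (1 + (k + 3) * r) (stk [e, [], bs, [], [], [], [], [], [], [False], replicate (k * r + a) True])"
    for \<O> e bs r a
  proof (induction r arbitrary: a)
    case 0
    show ?case by (rule runs_eq[OF runs_While_done]) (auto simp: stk_simps nat_code_def)
  next
    case (Suc r)
    let ?s = "stk [e, [], bs, [], [], [], [], [], [], nat_code (Suc r), replicate a True]"
    have 1: "runs \<O> (Seq (Pop 9) (pushes 10 (replicate k True))) ?s (1 + (1 + k))
      (stk [e, [], bs, [], [], [], [], [], [], nat_code r, replicate (k + a) True])"
      by (rule runs_eq[OF runs_Seq[OF runs_Pop runs_pushes]])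
        (auto simp: stk_simps nat_code_def replicate_add)
    have "holds (Top 9) ?s" by (simp add: stk_simps nat_code_def)
    then show ?case
      by (rule runs_eq[OF runs_While_step[OF _ 1 Suc.IH]]) (auto simp: algebra_simps)
  qed
  \<comment> \<open>The length of the query is bounded by the time of writing it, and it is paid
    three more times: once by the oracle call and twice by \<open>clear\<close>.\<close>
  define K where "K = 4 * K1 + k + 20"
  have "runs \<O> (ask (D, k))
      (stk [edges_code es, [], bs, [], [], [], [], [], [], [], replicate a True]) (K * (N + 1) ^ 2)
      (stk [edges_code es, [], bs, [], [], [], [], [], [], [], replicate (k * r + a) True])"
    if es: "set es \<subseteq> {..N} \<times> {..N}"
      and N: "query_size D (length bs) (length es) \<le> N" "length es \<le> N" "length (edges_code es) \<le> N"
      and r: "r \<le> N"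
      "\<O> (graph_code (query_size D (length bs) (length es)) (query_edges D bs es)) = nat_code r"
    for \<O> N bs es r a
  proof -
    let ?E = "edges_code es"
    let ?n' = "query_size D (length bs) (length es)"
    let ?q = "graph_code ?n' (query_edges D bs es)"
    let ?a = "replicate a True"
    have 1: "runs \<O> (build_query D) (stk [?E, [], bs, [], [], [], [], [], [], [], ?a])
      (K1 * (N + 1) ^ 2) (stk [?E, [], bs, [], [], [], replicate ?n' True, [], ?q, [], ?a])"
      by (rule K1[OF es N])
    from runs_growth[OF this, of 8] have q: "length ?q \<le> K1 * (N + 1) ^ 2"
      by (simp add: stk_simps)
    have 2: "runs \<O> (Query 8 9) (stk [?E, [], bs, [], [], [], replicate ?n' True, [], ?q, [], ?a])
      (1 + length ?q + (r + 1)) (stk [?E, [], bs, [], [], [], replicate ?n' True, [], ?q, nat_code r, ?a])"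
      by (rule runs_eq[OF runs_Query]) (use r in \<open>auto simp: stk_simps nat_code_def\<close>)
    have 3: "runs \<O> (clear 8) (stk [?E, [], bs, [], [], [], replicate ?n' True, [], ?q, nat_code r, ?a])
      (1 + 2 * length ?q)
      (stk [?E, [], bs, [], [], [], replicate ?n' True, [], [], nat_code r, ?a])"
      by (rule runs_eq[OF runs_clear]) (auto simp: stk_simps)
    have 4: "runs \<O> (clear 6) (stk [?E, [], bs, [], [], [], replicate ?n' True, [], [], nat_code r, ?a])
      (1 + 2 * ?n') (stk [?E, [], bs, [], [], [], [], [], [], nat_code r, ?a])"
      by (rule runs_eq[OF runs_clear]) (auto simp: stk_simps)
    have 5: "runs \<O> (Pop 9)
      (stk [?E, [], bs, [], [], [], [], [], [], [False], replicate (k * r + a) True]) 1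
      (stk [?E, [], bs, [], [], [], [], [], [], [], replicate (k * r + a) True])"
      by (rule runs_eq[OF runs_Pop]) (auto simp: stk_simps)
    have "(k + 3) * r \<le> (k + 3) * N" using r by simp
    then have "K1 * (N + 1) ^ 2 + ((1 + length ?q + (r + 1)) + ((1 + 2 * length ?q) + ((1 + 2 * ?n') +
        ((1 + (k + 3) * r) + 1))))
      \<le> 4 * (K1 * (N + 1) ^ 2) + ((k + 3) * N + 3 * N + 6)"
      using q r N by linarith
    also have "\<dots> \<le> K * (N + 1) ^ 2"
      by (simp add: K_def power2_eq_square algebra_simps)
    finally show ?thesis
      unfolding ask_def fst_conv snd_conv
      by (rule runs_mono[OF runs_Seq[OF 1 runs_Seq[OF 2 runs_Seq[OF 3 runs_Seq[OF 4 runs_Seq[OF loop 5]]]]]])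
  qed
  then show thesis by (intro that ask_time_def[THEN iffD2] allI impI)
qed

section \<open>Parsing, weighted sum of the answers and the final residue\<close>

section \<open>The reduction program\<close>

text \<open>The marks of the vertex count are matched against the copy of l in register 4: those
  that find a partner become left vertices, the others right ones. \<open>read_unary\<close> has
  also saved l in register 1, which must be empty before edges are read.\<close>

definition parse_input :: prog where
  "parse_input = Seq (read_unary 4)
    (Seq (While (Top 0) (Seq (Pop 0) (If (Nonempty 4) (Seq (Pop 4) (Push 2 False)) (Push 2 True))))
    (Seq (Pop 0) (clear 1)))"

lemma runs_parse_input:
  assumes "l \<le> n"
  shows "runs \<O> parse_input
    (stk [nat_code l @ graph_code n es, [], [], [], [], [], [], [], [], [], []])
    (9 + 6 * l + 5 * n)
    (stk [edges_code es, [], sides l n,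
      [], [], [], [], [], [], [], []])"
proof -
  let ?body = "Seq (Pop 0) (If (Nonempty 4) (Seq (Pop 4) (Push 2 False)) (Push 2 True))"
  \<comment> \<open>Generalised to \<open>l\<close> left and \<open>j\<close> right vertices already
    pushed and \<open>k\<close> left ones still to come. The side condition says that no right
    vertex precedes a left one.\<close>
  have loop: "runs \<O> (While (Top 0) ?body)
      (stk [nat_code n @ e, e', replicate j True @ replicate l False, [], replicate k True, [], [], [], [], [], []])
      (1 + 5 * n)
      (stk [False # e, e', replicate (j + (n - k)) True @ replicate (l + min k n) False, [],
        replicate (k - n) True, [], [], [], [], [], []])"
    if "0 < k \<Longrightarrow> j = 0" for e e' j l k n
    using that
  proof (induction n arbitrary: j l k)
    case 0
    show ?case by (rule runs_eq[OF runs_While_done]) (auto simp: stk_simps nat_code_def)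
  next
    case (Suc n)
    let ?s = "stk [nat_code (Suc n) @ e, e', replicate j True @ replicate l False, [],
      replicate k True, [], [], [], [], [], []]"
    have top: "holds (Top 0) ?s" by (simp add: stk_simps nat_code_def)
    show ?case
    proof (cases k)
      case 0
      let ?s1 = "stk [nat_code n @ e, e', replicate (Suc j) True @ replicate l False, [],
        replicate 0 True, [], [], [], [], [], []]"
      have "runs \<O> (If (Nonempty 4) (Seq (Pop 4) (Push 2 False)) (Push 2 True))
        (?s(0 := tl (?s 0))) (1 + 2) ?s1"
        by (rule runs_If) (auto simp: stk_simps 0 nat_code_def
          intro!: runs_eq[OF runs_Push])
      from runs_While_step[OF top runs_Seq[OF runs_Pop this] Suc.IH[of 0 "Suc j" l]]
      show ?thesis by (rule runs_eq) (auto simp: 0)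
    next
      case (Suc k')
      have j: "j = 0" using Suc Suc.prems by simp
      let ?s1 = "stk [nat_code n @ e, e', replicate 0 True @ replicate (Suc l) False, [],
        replicate k' True, [], [], [], [], [], []]"
      have "runs \<O> (If (Nonempty 4) (Seq (Pop 4) (Push 2 False)) (Push 2 True))
        (?s(0 := tl (?s 0))) (1 + (1 + 1)) ?s1"
        by (rule runs_If) (auto simp: stk_simps Suc j nat_code_def
          intro!: runs_eq[OF runs_Seq[OF runs_Pop runs_Push]])
      from runs_While_step[OF top runs_Seq[OF runs_Pop this] Suc.IH[of k' 0 "Suc l"]]
      show ?thesis by (rule runs_eq) (auto simp: Suc j)
    qed
  qed
  have 1: "runs \<O> (read_unary 4)
      (stk [nat_code l @ graph_code n es, [], [], [], [], [], [], [], [], [], []]) (3 + 4 * l)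
      (stk [nat_code n @ edges_code es, rev (nat_code l), replicate 0 True @ replicate 0 False, [],
        replicate l True, [], [], [], [], [], []])"
    by (rule runs_eq[OF runs_read_unary[where k = l]]) (auto simp: stk_simps graph_code_eq)
  have 2: "runs \<O> (Seq (Pop 0) (clear 1))
      (stk [False # edges_code es, rev (nat_code l), replicate (0 + (n - l)) True @
        replicate (0 + min l n) False, [], replicate (l - n) True, [], [], [], [], [], []])
      (1 + (1 + 2 * (l + 1)))
      (stk [edges_code es, [], sides l n,
        [], [], [], [], [], [], [], []])"
    by (rule runs_eq[OF runs_Seq[OF runs_Pop runs_clear]])
      (use assms in \<open>auto simp: stk_simps nat_code_def min_def\<close>)
  show ?thesis unfolding parse_input_def
    by (rule runs_mono[OF runs_Seq[OF 1 runs_Seq[OF loop 2]]]) auto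
qed

primrec asks :: "(blueprint \<times> nat) list \<Rightarrow> prog" where
  "asks [] = Skip"
| "asks (q # qs) = Seq (ask q) (asks qs)"

definition asks_time :: "(blueprint \<times> nat) list \<Rightarrow> nat \<Rightarrow> bool" where
  "asks_time qs K \<longleftrightarrow> (\<forall>\<O> N bs es r a. set es \<subseteq> {..N} \<times> {..N} \<longrightarrow>
      length es \<le> N \<longrightarrow> length (edges_code es) \<le> N \<longrightarrow>
      (\<forall>(D, k) \<in> set qs. query_size D (length bs) (length es) \<le> N \<and> r D \<le> N \<and>
        \<O> (graph_code (query_size D (length bs) (length es)) (query_edges D bs es)) = nat_code (r D)) \<longrightarrow>
    runs \<O> (asks qs)
      (stk [edges_code es, [], bs, [], [], [], [], [], [], [], replicate a True]) (K * (N + 1) ^ 2)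
      (stk [edges_code es, [], bs, [], [], [], [], [], [], [],
        replicate ((\<Sum>(D, k) \<leftarrow> qs. k * r D) + a) True]))"

lemma runs_asks:
  obtains K where "asks_time qs K"
proof (induction qs arbitrary: thesis)
  case Nil
  show ?case
    by (rule Nil[of 1]) (auto simp: asks_time_def intro!: runs_eq[OF runs_Skip])
next
  case (Cons q qs)
  obtain D k where q: "q = (D, k)" by force
  obtain K1 where K1': "ask_time D k K1"
    by (rule runs_ask)
  obtain K2 where K2': "asks_time qs K2"
    by (rule Cons.IH)
  show ?case
  proof (rule Cons.prems[of "K1 + K2"], unfold asks_time_def, intro allI impI)
    fix \<O> :: "bool list \<Rightarrow> bool list" and N bs es and r :: "blueprint \<Rightarrow> nat" and a
    assume es: "set es \<subseteq> {..N} \<times> {..N}" "length es \<le> N" "length (edges_code es) \<le> N"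
      and all: "\<forall>(D, k) \<in> set (q # qs). query_size D (length bs) (length es) \<le> N \<and> r D \<le> N \<and>
        \<O> (graph_code (query_size D (length bs) (length es)) (query_edges D bs es)) = nat_code (r D)"
    have D: "query_size D (length bs) (length es) \<le> N" "r D \<le> N"
        "\<O> (graph_code (query_size D (length bs) (length es)) (query_edges D bs es)) = nat_code (r D)"
      using all q by auto
    have 1: "runs \<O> (ask (D, k))
      (stk [edges_code es, [], bs, [], [], [], [], [], [], [], replicate a True]) (K1 * (N + 1) ^ 2)
      (stk [edges_code es, [], bs, [], [], [], [], [], [], [], replicate (k * r D + a) True])"
      using K1'[unfolded ask_time_def] es D by blast
    have "\<forall>(D, k) \<in> set qs. query_size D (length bs) (length es) \<le> N \<and> r D \<le> N \<and>
        \<O> (graph_code (query_size D (length bs) (length es)) (query_edges D bs es)) = nat_code (r D)"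
      using all by auto
    then have 2: "runs \<O> (asks qs)
      (stk [edges_code es, [], bs, [], [], [], [], [], [], [], replicate (k * r D + a) True])
      (K2 * (N + 1) ^ 2)
      (stk [edges_code es, [], bs, [], [], [], [], [], [], [],
        replicate ((\<Sum>(D, k) \<leftarrow> qs. k * r D) + (k * r D + a)) True])"
      using K2'[unfolded asks_time_def] es by blast
    show "runs \<O> (asks (q # qs))
      (stk [edges_code es, [], bs, [], [], [], [], [], [], [], replicate a True])
      ((K1 + K2) * (N + 1) ^ 2)
      (stk [edges_code es, [], bs, [], [], [], [], [], [], [],
        replicate ((\<Sum>(D, k) \<leftarrow> q # qs. k * r D) + a) True])"
      unfolding asks.simps q
      by (rule runs_eq[OF runs_Seq[OF 1 2]]) (auto simp: algebra_simps)
  qed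
qed

text \<open>
  The weighted sum of the answers is bounded by a constant \<open>B\<close>, so nested tests suffice to reduce it
  modulo \<open>p\<close>.
\<close>

primrec decide :: "nat \<Rightarrow> nat \<Rightarrow> nat \<Rightarrow> prog" where
  "decide p 0 i = pushes 0 (rev (nat_code (i mod p)))"
| "decide p (Suc B) i = If (Nonempty 10) (Seq (Pop 10) (decide p B (Suc i)))
    (pushes 0 (rev (nat_code (i mod p))))"

lemma runs_decide:
  assumes "0 < p" "length (s 10) \<le> B" "s 0 = []"
  shows "\<exists>s'. runs \<O> (decide p B i) s (2 * B + p + 1) s' \<and>
    s' 0 = nat_code ((i + length (s 10)) mod p)"
  using assms(2,3)
proof (induction B arbitrary: i s)
  case 0
  have "1 + length (rev (nat_code (i mod p))) \<le> 2 * 0 + p + 1"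
    using mod_less_divisor[OF assms(1), of i] by (simp add: nat_code_def)
  from runs_mono[OF runs_pushes this, of \<O> 0 s] show ?case
    unfolding decide.simps using 0
    by (intro exI[of _ "s(0 := rev (rev (nat_code (i mod p))) @ s 0)"] conjI)
      (simp_all add: fun_upd_same del: fun_upd_apply)
next
  case (Suc B)
  show ?case
  proof (cases "s 10 = []")
    case True
    have "length (nat_code (i mod p)) \<le> p"
      using mod_less_divisor[OF assms(1), of i] by (simp add: nat_code_def)
    moreover have "runs \<O> (decide p (Suc B) i) s (1 + (1 + length (rev (nat_code (i mod p)))))
      (s(0 := rev (rev (nat_code (i mod p))) @ s 0))"
      unfolding decide.simps by (rule runs_If[OF _ runs_pushes]) (use True in simp)
    ultimately have "runs \<O> (decide p (Suc B) i) s (2 * Suc B + p + 1)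
      (s(0 := rev (rev (nat_code (i mod p))) @ s 0))"
      by (elim runs_mono) simp
    then show ?thesis using Suc.prems True
      by (intro exI[of _ "s(0 := rev (rev (nat_code (i mod p))) @ s 0)"] conjI)
      (simp_all add: fun_upd_same del: fun_upd_apply)
  next
    case False
    let ?s = "s(10 := tl (s 10))"
    have len: "Suc (length (tl (s 10))) = length (s 10)" using False by (cases "s 10") auto
    have "length (?s 10) \<le> B" "?s 0 = []" using len Suc.prems by auto
    from Suc.IH[OF this, of "Suc i"] obtain s' where
      s': "runs \<O> (decide p B (Suc i)) ?s (2 * B + p + 1) s'"
      "s' 0 = nat_code ((Suc i + length (tl (s 10))) mod p)"
      unfolding fun_upd_same by blast
    have "runs \<O> (decide p (Suc B) i) s (1 + (1 + (2 * B + p + 1))) s'"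
      unfolding decide.simps
      by (rule runs_If[OF runs_Seq[OF runs_Pop s'(1)]]) (use False in auto)
    moreover have eq: "Suc i + length (tl (s 10)) = i + length (s 10)" using len by linarith
    ultimately have "runs \<O> (decide p (Suc B) i) s (2 * Suc B + p + 1) s'"
      by (elim runs_mono) simp
    then show ?thesis using s'(2) unfolding eq by blast
  qed
qed

definition query_graph :: "blueprint \<Rightarrow> bool list \<Rightarrow> (nat \<times> nat) list \<Rightarrow> nat pair_pre_digraph" where
  "query_graph D bs es = \<lparr>pverts = {..<query_size D (length bs) (length es)},
    parcs = set (query_edges D bs es) \<union> (set (query_edges D bs es))\<inverse>\<rparr>"

lemma length_edges_code: "length es \<le> length (edges_code es)"
  by (induction es) (auto simp: nat_code_def)

text \<open>This separates the machine from the mathematics. What remains is to supply a fixed list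
  of weighted blueprints such that every query word codes a graph, as the oracle is bound on no
  other words, and such that the weighted residues sum to the partition function modulo
  \<open>p\<close>.\<close>

lemma turing_reducible_by_queries:
  fixes H :: "'a pair_pre_digraph"
  assumes p: "0 < p"
    and valid: "\<And>G l n es R D k. encodes_graph (graph_code n es) G \<Longrightarrow> pverts G = {..<n} \<Longrightarrow>
      bipartition G {..<l} R \<Longrightarrow> set es = {(u, v) \<in> parcs G. u < v} \<Longrightarrow> distinct es \<Longrightarrow> (D, k) \<in> set qs \<Longrightarrow>
      encodes_graph (graph_code (query_size D n (length es))
          (query_edges D (sides l n) es))
        (query_graph D (sides l n) es)"
    and correct: "\<And>G l n es R. encodes_graph (graph_code n es) G \<Longrightarrow> pverts G = {..<n} \<Longrightarrow>
      bipartition G {..<l} R \<Longrightarrow> set es = {(u, v) \<in> parcs G. u < v} \<Longrightarrow> distinct es \<Longrightarrow>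
      nat (Z_BIS lam1 lam2 G {..<l} R mod int p) = (\<Sum>(D, k) \<leftarrow> qs.
        k * (card (homs (query_graph D (sides l n) es) H) mod p)) mod p"
  shows "turing_reducible (bis_problem p lam1 lam2) (graph_hom_problem p H)"
proof -
  obtain K where K': "asks_time qs K"
    by (rule runs_asks)
  define B where "B = (\<Sum>(D, k) \<leftarrow> qs. k * p)"
  define C where "C = (\<Sum>(D, k) \<leftarrow> qs. cnum D + vertex_fresh D + edge_fresh D) + p + 1"
  define prg where "prg = Seq parse_input (Seq (asks qs) (Seq (clear 0) (decide p B 0)))"
  \<comment> \<open>The queries take at most K (C + 1)^2 (X + 1)^2 steps, where X is the input
    length. The other phases are linear in X up to a constant and are absorbed into the same
    quadratic polynomial.\<close>
  define c where "c = K * (C + 1) ^ 2 + 2 * B + p + 40"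
  have main: "\<exists>t s'. exec \<O> prg (\<lambda>r. if r = 0 then x else []) t s' \<and>
      t \<le> poly (smult c ([:1, 1:] ^ 2)) (length x) \<and> s' 0 = y"
    if O: "\<forall>(x, y) \<in> graph_hom_problem p H. \<O> x = y" and xy: "(x, y) \<in> bis_problem p lam1 lam2"
    for \<O> x y
  proof -
    obtain l g G R where x: "x = nat_code l @ g" and G: "encodes_graph g G"
      and bip: "bipartition G {..<l} R"
      and y: "y = nat_code (nat (Z_BIS lam1 lam2 G {..<l} R mod int p))"
      using xy unfolding bis_problem_def by blast
    obtain n es where n: "pverts G = {..<n}" and es: "distinct es" "set es = {(u, v) \<in> parcs G. u < v}"
      and g: "g = graph_code n es" and pg: "pair_graph G"
      using G unfolding encodes_graph_def by blast
    interpret pair_graph G by fact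
    have ln: "l \<le> n" using bip n unfolding bipartition_def by (metis Un_upper1 lessThan_subset_iff)
    define X where "X = length x"
    \<comment> \<open>One number that bounds the query sizes, the vertex names, the number of edges,
      the length of their code and the residues.\<close>
    define N where "N = C * (X + 1)"
    define bs where "bs = sides l n"
    have len_bs: "length bs = n" using ln by (simp add: bs_def)
    have X: "l \<le> X" "n \<le> X" "length (edges_code es) \<le> X" "length es \<le> X"
      using length_edges_code[of es] by (auto simp: X_def x g graph_code_eq nat_code_def)
    have XN: "X \<le> N" "p \<le> N" by (auto simp: N_def C_def)
    define r where "r D = card (homs (query_graph D bs es) H) mod p" for D
    have rp: "r D < p" for D using p by (simp add: r_def)
    have answer: "\<O> (graph_code (query_size D (length bs) (length es)) (query_edges D bs es)) = nat_code (r D)"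
      if "(D, k) \<in> set qs" for D k
    proof -
      have "encodes_graph (graph_code (query_size D (length bs) (length es)) (query_edges D bs es))
        (query_graph D bs es)"
        unfolding bs_def using valid[OF _ n bip es(2,1) that] G g len_bs by (simp add: bs_def)
      then have "(graph_code (query_size D (length bs) (length es)) (query_edges D bs es), nat_code (r D))
        \<in> graph_hom_problem p H"
        unfolding graph_hom_problem_def r_def by blast
      from bspec[OF O this] show ?thesis by simp
    qed
    have size: "query_size D (length bs) (length es) \<le> N" if "(D, k) \<in> set qs" for D k
    proof -
      have "cnum D + vertex_fresh D + edge_fresh D \<le> (\<Sum>(D, k) \<leftarrow> qs. cnum D + vertex_fresh D + edge_fresh D)"
        using that by (intro member_le_sum_list) force+
      then have "cnum D + vertex_fresh D + edge_fresh D + 1 \<le> C" by (simp add: C_def)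
      then have "(cnum D + vertex_fresh D + edge_fresh D + 1) * (X + 1) \<le> N"
        unfolding N_def by (rule mult_right_mono) simp
      moreover have "query_size D n (length es) \<le> cnum D + X + vertex_fresh D * X + edge_fresh D * X"
        unfolding query_size_def using X by (intro add_mono mult_left_mono) auto
      ultimately show ?thesis unfolding len_bs by (simp add: algebra_simps)
    qed
    have es_le: "set es \<subseteq> {..N} \<times> {..N}"
      using es(2) in_arcsD1 in_arcsD2 n X XN by fastforce
    define a where "a = (\<Sum>(D, k) \<leftarrow> qs. k * r D)"
    have aB: "a \<le> B" unfolding a_def B_def
      using less_imp_le[OF rp] by (intro sum_list_mono) auto
    have 1: "runs \<O> parse_input (\<lambda>r. if r = 0 then x else []) (9 + 6 * l + 5 * n)
      (stk [edges_code es, [], bs, [], [], [], [], [], [], [], []])"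
    proof -
      have "(\<lambda>r. if r = 0 then x else []) = stk [x, [], [], [], [], [], [], [], [], [], []]"
        by (auto simp: stk_def fun_eq_iff nth_Cons split: nat.splits)
      then show ?thesis using runs_parse_input[OF ln] by (simp add: x g bs_def)
    qed
    have 2: "runs \<O> (asks qs) (stk [edges_code es, [], bs, [], [], [], [], [], [], [], []])
      (K * (N + 1) ^ 2)
      (stk [edges_code es, [], bs, [], [], [], [], [], [], [], replicate a True])"
    proof -
      have "\<forall>(D, k) \<in> set qs. query_size D (length bs) (length es) \<le> N \<and> r D \<le> N \<and>
        \<O> (graph_code (query_size D (length bs) (length es)) (query_edges D bs es)) = nat_code (r D)"
        using size answer le_trans[OF less_imp_le[OF rp] XN(2)] by blast
      then have "runs \<O> (asks qs)
        (stk [edges_code es, [], bs, [], [], [], [], [], [], [], replicate 0 True]) (K * (N + 1) ^ 2)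
        (stk [edges_code es, [], bs, [], [], [], [], [], [], [], replicate (a + 0) True])"
        unfolding a_def using es_le X XN by (intro K'[unfolded asks_time_def, rule_format]) auto
      then show ?thesis by simp
    qed
    have 3: "runs \<O> (clear 0)
      (stk [edges_code es, [], bs, [], [], [], [], [], [], [], replicate a True])
      (1 + 2 * length (edges_code es))
      (stk [[], [], bs, [], [], [], [], [], [], [], replicate a True])"
      by (rule runs_eq[OF runs_clear]) (auto simp: stk_simps)
    obtain s' where 4: "runs \<O> (decide p B 0)
        (stk [[], [], bs, [], [], [], [], [], [], [], replicate a True]) (2 * B + p + 1) s'"
      and s': "s' 0 = nat_code (a mod p)"
      using runs_decide[OF p, of "stk [[], [], bs, [], [], [], [], [], [], [], replicate a True]" B \<O> 0] aB
      by (auto simp: stk_simps)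
    have "runs \<O> prg (\<lambda>r. if r = 0 then x else [])
      ((9 + 6 * l + 5 * n) + (K * (N + 1) ^ 2 + ((1 + 2 * length (edges_code es)) + (2 * B + p + 1)))) s'"
      unfolding prg_def by (rule runs_Seq[OF 1 runs_Seq[OF 2 runs_Seq[OF 3 4]]])
    then obtain t where t: "exec \<O> prg (\<lambda>r. if r = 0 then x else []) t s'"
      "t \<le> (9 + 6 * l + 5 * n) + (K * (N + 1) ^ 2 + ((1 + 2 * length (edges_code es)) + (2 * B + p + 1)))"
      unfolding runs_def by blast
    have "N + 1 \<le> (C + 1) * (X + 1)" by (simp add: N_def)
    then have "(N + 1) ^ 2 \<le> ((C + 1) * (X + 1)) ^ 2" by (rule power_mono) simp
    then have "K * (N + 1) ^ 2 \<le> K * ((C + 1) ^ 2 * (X + 1) ^ 2)"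
      by (intro mult_left_mono) (simp_all only: power_mult_distrib)
    moreover have "t \<le> K * (N + 1) ^ 2 + (2 * B + p) + 40 * (X + 1)"
    proof -
      define Y where "Y = K * (N + 1) ^ 2"
      have "t \<le> Y + (2 * B + p) + 13 * X + 11"
        using t(2) X(1-3) unfolding Y_def[symmetric] by linarith
      then show ?thesis unfolding Y_def by simp
    qed
    moreover have "2 * B + p \<le> (2 * B + p) * (X + 1) ^ 2" by simp
    moreover have "40 * (X + 1) \<le> 40 * (X + 1) ^ 2" by (simp add: power2_eq_square)
    ultimately have "t \<le> K * ((C + 1) ^ 2 * (X + 1) ^ 2) + (2 * B + p) * (X + 1) ^ 2 + 40 * (X + 1) ^ 2"
      by (meson add_mono order_trans)
    also have "\<dots> = poly (smult c ([:1, 1:] ^ 2)) X"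
      by (simp add: c_def algebra_simps)
    finally have "t \<le> poly (smult c ([:1, 1:] ^ 2)) (length x)" by (simp add: X_def)
    moreover have "s' 0 = y"
      unfolding s' y a_def r_def bs_def using correct[OF _ n bip es(2,1)] G g by simp
    ultimately show ?thesis using t(1) by blast
  qed
  show ?thesis unfolding turing_reducible_def using main by blast
qed

section \<open>Every query word is the code of a simple graph\<close>

section \<open>The query graphs\<close>

text \<open>Edges are allowed only in the orientation in which \<open>place\<close> increases,
  because codes list an edge as u < v. \<open>W\<close> is absent: a vertex gadget is placed with
  equal names for both ends, where \<open>W\<close> would collide with \<open>U\<close>.\<close>

definition vertex_slots :: "'c set \<Rightarrow> nat \<Rightarrow> ('c endpoint \<times> 'c endpoint) set" where
  "vertex_slots C f = Const ` C \<times> {U} \<union>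
    {(x, Fresh j) | x j. j < f \<and> x \<in> insert U (Const ` C \<union> Fresh ` {..<j})}"

text \<open>An edge from a constant to \<open>U\<close> would be repeated by every edge gadget at
  that vertex. So each edge other than \<open>(U, W)\<close> ends in a fresh vertex of its own
  gadget. The pair \<open>(U, W)\<close> is increasing because left vertices are numbered
  first.\<close>

definition edge_slots :: "'c set \<Rightarrow> nat \<Rightarrow> ('c endpoint \<times> 'c endpoint) set" where
  "edge_slots C g = insert (U, W)
    {(x, Fresh j) | x j. j < g \<and> x \<in> {U, W} \<union> (Const ` C \<union> Fresh ` {..<j})}"

lemma vertex_slots_subset:
  "vertex_slots (C :: 'c set) f \<subseteq> ({U, W} \<union> (Const ` C \<union> Fresh ` {..<f})) \<times>
    ({U, W} \<union> (Const ` C \<union> Fresh ` {..<f}))"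
proof (rule subrelI)
  fix x y :: "'c endpoint"
  assume "(x, y) \<in> vertex_slots C f"
  then show "(x, y) \<in> ({U, W} \<union> (Const ` C \<union> Fresh ` {..<f})) \<times>
    ({U, W} \<union> (Const ` C \<union> Fresh ` {..<f}))"
    unfolding vertex_slots_def by (cases x; cases y) (auto simp: image_iff)
qed

lemma edge_slots_subset:
  "edge_slots (C :: 'c set) f \<subseteq> ({U, W} \<union> (Const ` C \<union> Fresh ` {..<f})) \<times>
    ({U, W} \<union> (Const ` C \<union> Fresh ` {..<f}))"
proof (rule subrelI)
  fix x y :: "'c endpoint"
  assume "(x, y) \<in> edge_slots C f"
  then show "(x, y) \<in> ({U, W} \<union> (Const ` C \<union> Fresh ` {..<f})) \<times>
    ({U, W} \<union> (Const ` C \<union> Fresh ` {..<f}))"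
    unfolding edge_slots_def by (cases x; cases y) (auto simp: image_iff)
qed

definition valid_blueprint :: "blueprint \<Rightarrow> bool" where
  "valid_blueprint D \<longleftrightarrow>
    distinct (const_edges D) \<and> (\<forall>(x, y) \<in> set (const_edges D). x < y \<and> y < cnum D) \<and>
    distinct (left_edges D) \<and> set (left_edges D) \<subseteq> vertex_slots {..<cnum D} (vertex_fresh D) \<and>
    distinct (right_edges D) \<and> set (right_edges D) \<subseteq> vertex_slots {..<cnum D} (vertex_fresh D) \<and>
    distinct (bis_edges D) \<and> set (bis_edges D) \<subseteq> edge_slots {..<cnum D} (edge_fresh D)"

lemma set_inst: "set (inst c u w T) = map_prod (place c u w) (place c u w) ` set T"
  by (simp add: inst_def)

lemma inst_vertex:
  assumes "distinct T" "set T \<subseteq> vertex_slots {..<m} f" "m \<le> u" "u < c"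
  shows "distinct (inst c u u T)"
    and "(x, y) \<in> set (inst c u u T) \<Longrightarrow>
      x < y \<and> y < c + f \<and> (x < m \<and> y = u \<or> c \<le> y)"
proof -
  let ?A = "insert U (Const ` {..<m} \<union> range Fresh)"
  have inj: "inj_on (place c u u) ?A"
    using assms(3,4) by (auto simp: inj_on_def)
  have "set T \<subseteq> ?A \<times> ?A"
    using assms(2) unfolding vertex_slots_def by blast
  then have "inj_on (map_prod (place c u u) (place c u u)) (set T)"
    using map_prod_inj_on[OF inj inj] by (rule inj_on_subset[rotated])
  then show "distinct (inst c u u T)"
    using assms(1) by (simp add: inst_def distinct_map)
  show "x < y \<and> y < c + f \<and> (x < m \<and> y = u \<or> c \<le> y)" if "(x, y) \<in> set (inst c u u T)"
    using that assms(2-4) by (fastforce simp: set_inst vertex_slots_def)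
qed

lemma inst_edge:
  assumes "distinct T" "set T \<subseteq> edge_slots {..<m} g" "m \<le> u" "u < w" "w < c"
  shows "distinct (inst c u w T)"
    and "(x, y) \<in> set (inst c u w T) \<Longrightarrow>
      x < y \<and> y < c + g \<and> (x = u \<and> y = w \<or> c \<le> y)"
proof -
  let ?A = "{U, W} \<union> (Const ` {..<m} \<union> range Fresh)"
  have inj: "inj_on (place c u w) ?A"
    using assms(3-5) by (auto simp: inj_on_def)
  have "set T \<subseteq> ?A \<times> ?A"
    using assms(2) unfolding edge_slots_def by blast
  then have "inj_on (map_prod (place c u w) (place c u w)) (set T)"
    using map_prod_inj_on[OF inj inj] by (rule inj_on_subset[rotated])
  then show "distinct (inst c u w T)"
    using assms(1) by (simp add: inst_def distinct_map)
  show "x < y \<and> y < c + g \<and> (x = u \<and> y = w \<or> c \<le> y)" if "(x, y) \<in> set (inst c u w T)"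
    using that assms(2-5) by (fastforce simp: set_inst edge_slots_def)
qed

text \<open>New edges end in the current vertex or in its fresh block. The vertices are treated in
  descending order, so an earlier edge ending in an instance vertex ends in a larger one, and
  nothing is repeated. The condition \<open>x < cnum D \<or> cnum D + n \<le> y\<close> excludes
  edges between two instance vertices; this keeps the pairs \<open>(U, W)\<close> of the edge
  gadgets new.\<close>

lemma vertex_edges_valid:
  assumes D: "valid_blueprint D"
    and "cnum D + n \<le> c" "length bs \<le> n" "distinct acc"
    and "\<And>x y. (x, y) \<in> set acc \<Longrightarrow> x < y \<and> y < c \<and> (x < cnum D \<or> cnum D + n \<le> y) \<and>
      (y < cnum D \<or> cnum D + length bs \<le> y)"
  shows "distinct (vertex_edges D bs c acc) \<and> (\<forall>(x, y) \<in> set (vertex_edges D bs c acc).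
    x < y \<and> y < c + vertex_fresh D * length bs \<and> (x < cnum D \<or> cnum D + n \<le> y))"
  using assms(2-)
proof (induction bs arbitrary: c acc)
  case Nil
  then show ?case by auto
next
  case (Cons b bs)
  let ?T = "if b then right_edges D else left_edges D"
  let ?u = "cnum D + length bs"
  have T: "distinct ?T" "set ?T \<subseteq> vertex_slots {..<cnum D} (vertex_fresh D)"
    using D by (auto simp: valid_blueprint_def)
  have u: "cnum D \<le> ?u" "?u < c" using Cons.prems by auto
  note I = inst_vertex[OF T u]
  have "distinct (vertex_edges D bs (c + vertex_fresh D) (rev (inst c ?u ?u ?T) @ acc)) \<and>
    (\<forall>(x, y) \<in> set (vertex_edges D bs (c + vertex_fresh D) (rev (inst c ?u ?u ?T) @ acc)).
      x < y \<and> y < c + vertex_fresh D + vertex_fresh D * length bs \<and> (x < cnum D \<or> cnum D + n \<le> y))"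
  proof (rule Cons.IH)
    show "distinct (rev (inst c ?u ?u ?T) @ acc)"
      using I Cons.prems(3,4) by fastforce
    show "x < y \<and> y < c + vertex_fresh D \<and> (x < cnum D \<or> cnum D + n \<le> y) \<and>
      (y < cnum D \<or> cnum D + length bs \<le> y)" if "(x, y) \<in> set (rev (inst c ?u ?u ?T) @ acc)" for x y
      using that I(2)[of x y] Cons.prems(1,2) Cons.prems(4)[of x y] by auto
  qed (use Cons.prems in auto)
  then show ?case by (simp add: algebra_simps)
qed

lemma edge_edges_valid:
  assumes D: "valid_blueprint D"
    and "cnum D + n \<le> c" "distinct es" "\<And>u w. (u, w) \<in> set es \<Longrightarrow> u < w \<and> w < n" "distinct acc"
    and "\<And>x y. (x, y) \<in> set acc \<Longrightarrow> x < y \<and> y < c"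
    and "\<And>u w. (u, w) \<in> set es \<Longrightarrow> (cnum D + u, cnum D + w) \<notin> set acc"
  shows "distinct (edge_edges D es c acc) \<and> (\<forall>(x, y) \<in> set (edge_edges D es c acc).
    x < y \<and> y < c + edge_fresh D * length es)"
  using assms(2-)
proof (induction es arbitrary: c acc)
  case Nil
  then show ?case by auto
next
  case (Cons e es)
  obtain u w where e: "e = (u, w)" by force
  let ?I = "inst c (cnum D + u) (cnum D + w) (bis_edges D)"
  have T: "distinct (bis_edges D)" "set (bis_edges D) \<subseteq> edge_slots {..<cnum D} (edge_fresh D)"
    using D by (auto simp: valid_blueprint_def)
  have uw: "cnum D \<le> cnum D + u" "cnum D + u < cnum D + w" "cnum D + w < c"
    using Cons.prems(1) Cons.prems(3)[of u w] by (auto simp: e)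
  note I = inst_edge[OF T uw]
  have "distinct (edge_edges D es (c + edge_fresh D) (rev ?I @ acc)) \<and>
    (\<forall>(x, y) \<in> set (edge_edges D es (c + edge_fresh D) (rev ?I @ acc)).
      x < y \<and> y < c + edge_fresh D + edge_fresh D * length es)"
  proof (rule Cons.IH)
    show "distinct (rev ?I @ acc)"
      using I Cons.prems(4,5) Cons.prems(6)[of u w] e by fastforce
    show "x < y \<and> y < c + edge_fresh D" if "(x, y) \<in> set (rev ?I @ acc)" for x y
      using that I(2)[of x y] Cons.prems(5)[of x y] by auto
    show "(cnum D + u', cnum D + w') \<notin> set (rev ?I @ acc)" if "(u', w') \<in> set es" for u' w'
      using that I(2)[of "cnum D + u'" "cnum D + w'"] Cons.prems(1,2) Cons.prems(3)[of u' w']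
        Cons.prems(6)[of u' w'] e by auto
    show "u' < w' \<and> w' < n" if "(u', w') \<in> set es" for u' w'
      using that Cons.prems(3) by auto
  qed (use Cons.prems in auto)
  then show ?case by (simp add: e algebra_simps)
qed

lemma query_vertex_edges_valid:
  assumes D: "valid_blueprint D"
  shows "distinct (vertex_edges D bs (cnum D + length bs) (const_edges D)) \<and>
    (\<forall>(x, y) \<in> set (vertex_edges D bs (cnum D + length bs) (const_edges D)).
    x < y \<and> y < query_size D (length bs) 0 \<and> (x < cnum D \<or> cnum D + length bs \<le> y))"
proof -
  have F: "distinct (const_edges D)" "\<And>x y. (x, y) \<in> set (const_edges D) \<Longrightarrow> x < y \<and> y < cnum D"
    using D by (auto simp: valid_blueprint_def)
  have "query_size D (length bs) 0 = cnum D + length bs + vertex_fresh D * length bs"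
    by (simp add: query_size_def)
  then show ?thesis
    using vertex_edges_valid[OF D order_refl order_refl F(1)] F(2) by fastforce
qed

lemma query_edges_valid:
  assumes D: "valid_blueprint D" and "distinct es"
    and es: "\<And>u w. (u, w) \<in> set es \<Longrightarrow> u < w \<and> w < length bs"
  shows "distinct (query_edges D bs es)"
    and "(x, y) \<in> set (query_edges D bs es) \<Longrightarrow> x < y \<and> y < query_size D (length bs) (length es)"
proof -
  let ?n = "length bs"
  note V = query_vertex_edges_valid[OF D, of bs]
  have "distinct (query_edges D bs es) \<and> (\<forall>(x, y) \<in> set (query_edges D bs es).
    x < y \<and> y < query_size D ?n 0 + edge_fresh D * length es)"
    unfolding query_edges_def
  proof (rule edge_edges_valid[OF D])
    show "cnum D + ?n \<le> query_size D ?n 0" by (simp add: query_size_def)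
    show "(cnum D + u, cnum D + w) \<notin> set (vertex_edges D bs (cnum D + ?n) (const_edges D))"
      if "(u, w) \<in> set es" for u w
      using V es[OF that] by fastforce
  qed (use V assms in \<open>auto simp: query_size_def\<close>)
  then show "distinct (query_edges D bs es)"
    and "(x, y) \<in> set (query_edges D bs es) \<Longrightarrow> x < y \<and> y < query_size D ?n (length es)"
    by (auto simp: query_size_def)
qed

lemma encodes_query_graph:
  assumes "valid_blueprint D" and "distinct es"
    and "\<And>u w. (u, w) \<in> set es \<Longrightarrow> u < w \<and> w < length bs"
  shows "encodes_graph (graph_code (query_size D (length bs) (length es)) (query_edges D bs es))
    (query_graph D bs es)"
proof -
  note Q = query_edges_valid[OF assms]
  have "pair_graph (query_graph D bs es)"
  proof unfold_locales
    show "finite (pverts (query_graph D bs es))" "finite (parcs (query_graph D bs es))"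
      by (auto simp: query_graph_def)
    show "symmetric (with_proj (query_graph D bs es))"
      by (auto simp: symmetric_def query_graph_def intro!: symI)
  next
    fix e assume e: "e \<in> parcs (query_graph D bs es)"
    then consider "(fst e, snd e) \<in> set (query_edges D bs es)"
      | "(snd e, fst e) \<in> set (query_edges D bs es)"
      by (cases e) (auto simp: query_graph_def)
    then show "fst e \<in> pverts (query_graph D bs es)" "snd e \<in> pverts (query_graph D bs es)"
      "fst e \<noteq> snd e"
      by (cases; use Q(2)[of "fst e" "snd e"] Q(2)[of "snd e" "fst e"] in
          \<open>auto simp: query_graph_def\<close>)+
  qed
  moreover have "set (query_edges D bs es) = {(u, v) \<in> parcs (query_graph D bs es). u < v}"
    using Q(2) by (fastforce simp: query_graph_def)
  moreover have "pverts (query_graph D bs es) = {..<query_size D (length bs) (length es)}"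
    by (simp add: query_graph_def)
  ultimately show ?thesis using Q(1) unfolding encodes_graph_def by blast
qed

section \<open>Homomorphism counts as sums of products of gadget counts\<close>

section \<open>Counting homomorphisms from the query graphs\<close>

definition edges_ok :: "('b \<times> 'b) set \<Rightarrow> ('c \<Rightarrow> 'b) \<Rightarrow> ('c \<times> 'c) set \<Rightarrow> bool" where
  "edges_ok E \<phi> A \<longleftrightarrow> (\<forall>(x, y) \<in> A. (\<phi> x, \<phi> y) \<in> E)"

lemma edges_ok_Un: "edges_ok E \<phi> (A \<union> B) \<longleftrightarrow> edges_ok E \<phi> A \<and> edges_ok E \<phi> B"
  by (auto simp: edges_ok_def)

lemma edges_ok_image: "edges_ok E \<phi> (map_prod h h ` A) \<longleftrightarrow> edges_ok E (\<phi> \<circ> h) A"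
  by (auto simp: edges_ok_def)

lemma edges_ok_cong:
  assumes "\<And>x y. (x, y) \<in> A \<Longrightarrow> \<phi> x = \<psi> x \<and> \<phi> y = \<psi> y"
  shows "edges_ok E \<phi> A \<longleftrightarrow> edges_ok E \<psi> A"
  using assms unfolding edges_ok_def by fastforce

primrec value_at :: "('c \<Rightarrow> 'b) \<Rightarrow> 'b \<Rightarrow> 'b \<Rightarrow> (nat \<Rightarrow> 'b) \<Rightarrow> 'c endpoint \<Rightarrow> 'b" where
  "value_at \<kappa> a b \<psi> (Const i) = \<kappa> i"
| "value_at \<kappa> a b \<psi> U = a"
| "value_at \<kappa> a b \<psi> W = b"
| "value_at \<kappa> a b \<psi> (Fresh i) = \<psi> i"

definition gadget_count :: "'b set \<Rightarrow> ('b \<times> 'b) set \<Rightarrow> ('c endpoint \<times> 'c endpoint) set \<Rightarrow> nat \<Rightarrow>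
    ('c \<Rightarrow> 'b) \<Rightarrow> 'b \<Rightarrow> 'b \<Rightarrow> nat" where
  "gadget_count V E T f \<kappa> a b = card {\<psi> \<in> {..<f} \<rightarrow>\<^sub>E V. edges_ok E (value_at \<kappa> a b \<psi>) T}"

definition set_consts :: "('c endpoint \<times> 'c endpoint) set \<Rightarrow> 'c set" where
  "set_consts T = (\<Union>(x, y) \<in> T. set_endpoint x \<union> set_endpoint y)"

lemma gadget_count_cong:
  assumes "\<And>i. i \<in> set_consts T \<Longrightarrow> \<kappa> i = \<kappa>' i"
  shows "gadget_count V E T f \<kappa> a b = gadget_count V E T f \<kappa>' a b"
proof -
  have "value_at \<kappa> a b \<psi> x = value_at \<kappa>' a b \<psi> x" if "set_endpoint x \<subseteq> set_consts T" for \<psi> x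
    using that assms by (cases x) auto
  then have "edges_ok E (value_at \<kappa> a b \<psi>) T \<longleftrightarrow> edges_ok E (value_at \<kappa>' a b \<psi>) T" for \<psi>
    by (intro edges_ok_cong) (fastforce simp: set_consts_def)
  then show ?thesis by (simp add: gadget_count_def)
qed

lemma gadget_count_map:
  "gadget_count V E (map_prod (map_endpoint h) (map_endpoint h) ` T) f \<kappa> a b =
    gadget_count V E T f (\<kappa> \<circ> h) a b"
proof -
  have "value_at \<kappa> a b \<psi> \<circ> map_endpoint h = value_at (\<kappa> \<circ> h) a b \<psi>" for \<psi>
  proof
    fix x show "(value_at \<kappa> a b \<psi> \<circ> map_endpoint h) x = value_at (\<kappa> \<circ> h) a b \<psi> x"
      by (cases x) auto
  qed
  then show ?thesis by (simp add: gadget_count_def edges_ok_image)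
qed

lemma sum_PiE_append:
  fixes g :: "(nat \<Rightarrow> 'b) \<Rightarrow> 'd::comm_monoid_add"
  shows "(\<Sum>\<phi> \<in> {..<c + f} \<rightarrow>\<^sub>E V. g \<phi>) =
    (\<Sum>\<phi> \<in> {..<c} \<rightarrow>\<^sub>E V. \<Sum>\<psi> \<in> {..<f} \<rightarrow>\<^sub>E V.
      g (\<lambda>x. if x < c then \<phi> x else if x < c + f then \<psi> (x - c) else undefined))"
proof -
  have "(\<Sum>\<phi> \<in> {..<c + f} \<rightarrow>\<^sub>E V. g \<phi>) =
    (\<Sum>(\<phi>, \<psi>) \<in> ({..<c} \<rightarrow>\<^sub>E V) \<times> ({..<f} \<rightarrow>\<^sub>E V).
      g (\<lambda>x. if x < c then \<phi> x else if x < c + f then \<psi> (x - c) else undefined))"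
    by (rule sum.reindex_bij_witness[
        where i = "\<lambda>(\<phi>, \<psi>) x. if x < c then \<phi> x else if x < c + f then \<psi> (x - c) else undefined"
          and j = "\<lambda>\<phi>. (restrict \<phi> {..<c}, restrict (\<lambda>i. \<phi> (c + i)) {..<f})"])
      (auto simp: PiE_iff extensional_def fun_eq_iff split: prod.splits intro!: arg_cong[where f = g])
  then show ?thesis by (simp add: sum.cartesian_product)
qed

text \<open>One block of fresh vertices is summed out. The remaining factor \<open>P\<close> does
  not see the block, so the edges of the gadget are replaced by the number of ways to complete
  them.\<close>

lemma sum_block:
  fixes P :: "(nat \<Rightarrow> 'b) \<Rightarrow> nat"
  assumes V: "finite V" and T: "T \<subseteq> A \<times> A" "A \<subseteq> {U, W} \<union> (Const ` {..<m} \<union> Fresh ` {..<f})"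
    and le: "m \<le> c" "u < c" "w < c"
    and P: "\<And>\<phi> \<psi>. (\<And>x. x < c \<Longrightarrow> \<phi> x = \<psi> x) \<Longrightarrow> P \<phi> = P \<psi>"
  shows "(\<Sum>\<phi> \<in> {..<c + f} \<rightarrow>\<^sub>E V. P \<phi> * of_bool (edges_ok E \<phi> (map_prod (place c u w) (place c u w) ` T)))
    = (\<Sum>\<phi> \<in> {..<c} \<rightarrow>\<^sub>E V. P \<phi> * gadget_count V E T f \<phi> (\<phi> u) (\<phi> w))"
  unfolding sum_PiE_append
proof (rule sum.cong[OF refl])
  fix \<phi> :: "nat \<Rightarrow> 'b"
  let ?j = "\<lambda>\<psi> x. if x < c then \<phi> x else if x < c + f then \<psi> (x - c) else undefined"
  have 1: "P (?j \<psi>) = P \<phi>" for \<psi> by (rule P) simp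
  have "(?j \<psi> \<circ> place c u w) x = value_at \<phi> (\<phi> u) (\<phi> w) \<psi> x" if "x \<in> A" for \<psi> x
    using that T(2) le by auto
  then have 2: "edges_ok E (?j \<psi>) (map_prod (place c u w) (place c u w) ` T) \<longleftrightarrow>
    edges_ok E (value_at \<phi> (\<phi> u) (\<phi> w) \<psi>) T" for \<psi>
    unfolding edges_ok_image using T(1) by (intro edges_ok_cong) blast
  have "finite ({..<f} \<rightarrow>\<^sub>E V)" using V by (simp add: finite_PiE)
  then show "(\<Sum>\<psi> \<in> {..<f} \<rightarrow>\<^sub>E V.
      P (?j \<psi>) * of_bool (edges_ok E (?j \<psi>) (map_prod (place c u w) (place c u w) ` T))) =
    P \<phi> * gadget_count V E T f \<phi> (\<phi> u) (\<phi> w)"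
    unfolding 1 2 by (simp add: sum_distrib_left[symmetric] gadget_count_def Int_def)
qed

lemma vertex_slots_consts: "T \<subseteq> vertex_slots C f \<Longrightarrow> set_consts T \<subseteq> C"
  by (fastforce simp: set_consts_def vertex_slots_def)

lemma edge_slots_consts: "T \<subseteq> edge_slots C f \<Longrightarrow> set_consts T \<subseteq> C"
  by (fastforce simp: set_consts_def edge_slots_def)

primrec vertex_weight :: "'b set \<Rightarrow> ('b \<times> 'b) set \<Rightarrow> blueprint \<Rightarrow> bool list \<Rightarrow> (nat \<Rightarrow> 'b) \<Rightarrow> nat" where
  "vertex_weight V E D [] \<phi> = 1"
| "vertex_weight V E D (b # bs) \<phi> =
    gadget_count V E (set (if b then right_edges D else left_edges D)) (vertex_fresh D) \<phi>
      (\<phi> (cnum D + length bs)) (\<phi> (cnum D + length bs)) * vertex_weight V E D bs \<phi>"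

definition edge_weight :: "'b set \<Rightarrow> ('b \<times> 'b) set \<Rightarrow> blueprint \<Rightarrow> (nat \<times> nat) list \<Rightarrow> (nat \<Rightarrow> 'b) \<Rightarrow> nat" where
  "edge_weight V E D es \<phi> = (\<Prod>(u, w) \<leftarrow> es.
    gadget_count V E (set (bis_edges D)) (edge_fresh D) \<phi> (\<phi> (cnum D + u)) (\<phi> (cnum D + w)))"

lemma vertex_weight_cong:
  assumes D: "valid_blueprint D" and "\<And>x. x < cnum D + length bs \<Longrightarrow> \<phi> x = \<psi> x"
  shows "vertex_weight V E D bs \<phi> = vertex_weight V E D bs \<psi>"
  using assms(2)
proof (induction bs)
  case (Cons b bs)
  have "set_consts (set (if b then right_edges D else left_edges D)) \<subseteq> {..<cnum D}"
    using D vertex_slots_consts by (auto simp: valid_blueprint_def)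
  then have "gadget_count V E (set (if b then right_edges D else left_edges D)) (vertex_fresh D) \<phi> a a =
    gadget_count V E (set (if b then right_edges D else left_edges D)) (vertex_fresh D) \<psi> a a" for a
    using Cons.prems by (intro gadget_count_cong) auto
  moreover have "\<phi> (cnum D + length bs) = \<psi> (cnum D + length bs)" using Cons.prems by simp
  moreover have "vertex_weight V E D bs \<phi> = vertex_weight V E D bs \<psi>"
    using Cons.prems by (intro Cons.IH) auto
  ultimately show ?case by simp
qed simp

lemma edge_weight_cong:
  assumes D: "valid_blueprint D" and "\<And>x. x < cnum D + n \<Longrightarrow> \<phi> x = \<psi> x"
    and "\<And>u w. (u, w) \<in> set es \<Longrightarrow> u < n \<and> w < n"
  shows "edge_weight V E D es \<phi> = edge_weight V E D es \<psi>"
proof -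
  have "set_consts (set (bis_edges D)) \<subseteq> {..<cnum D}"
    using D edge_slots_consts by (auto simp: valid_blueprint_def)
  then have "gadget_count V E (set (bis_edges D)) (edge_fresh D) \<phi> a b =
    gadget_count V E (set (bis_edges D)) (edge_fresh D) \<psi> a b" for a b
    using assms(2) by (intro gadget_count_cong) auto
  then show ?thesis
    unfolding edge_weight_def using assms(2,3)
    by (intro arg_cong[where f = prod_list] map_cong) (auto split: prod.splits)
qed

text \<open>Blocks with larger numbers are summed out first. Hence the factors of the edge gadgets
  are already present when the vertex gadgets are treated; they enter through
  \<open>P\<close>.\<close>

lemma sum_vertex_edges:
  assumes V: "finite V" and D: "valid_blueprint D"
    and "cnum D + length bs \<le> c" "\<And>x y. (x, y) \<in> set acc \<Longrightarrow> x < c \<and> y < c"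
    and "\<And>\<phi> \<psi>. (\<And>x. x < c \<Longrightarrow> \<phi> x = \<psi> x) \<Longrightarrow> P \<phi> = P \<psi>"
  shows "(\<Sum>\<phi> \<in> {..<c + vertex_fresh D * length bs} \<rightarrow>\<^sub>E V.
      P \<phi> * of_bool (edges_ok E \<phi> (set (vertex_edges D bs c acc)))) =
    (\<Sum>\<phi> \<in> {..<c} \<rightarrow>\<^sub>E V. P \<phi> * of_bool (edges_ok E \<phi> (set acc)) * vertex_weight V E D bs \<phi>)"
  using assms(3-)
proof (induction bs arbitrary: c acc)
  case Nil
  show ?case by simp
next
  case (Cons b bs)
  let ?T = "if b then right_edges D else left_edges D"
  let ?f = "vertex_fresh D"
  let ?u = "cnum D + length bs"
  let ?P = "\<lambda>\<phi>. P \<phi> * of_bool (edges_ok E \<phi> (set acc)) * vertex_weight V E D bs \<phi>"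
  let ?A = "{U, W} \<union> (Const ` {..<cnum D} \<union> Fresh ` {..<?f})"
  have T: "distinct ?T" "set ?T \<subseteq> vertex_slots {..<cnum D} ?f"
    using D by (auto simp: valid_blueprint_def)
  have u: "cnum D \<le> ?u" "?u < c" using Cons.prems(1) by auto
  note I = inst_vertex[OF T u]
  have TA: "set ?T \<subseteq> ?A \<times> ?A"
    by (rule order_trans[OF T(2) vertex_slots_subset])
  have P: "?P \<phi> = ?P \<psi>" if "\<And>x. x < c \<Longrightarrow> \<phi> x = \<psi> x" for \<phi> \<psi>
  proof -
    have "edges_ok E \<phi> (set acc) \<longleftrightarrow> edges_ok E \<psi> (set acc)"
      using that Cons.prems(2) by (intro edges_ok_cong) blast
    moreover have "vertex_weight V E D bs \<phi> = vertex_weight V E D bs \<psi>"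
      using that Cons.prems(1) by (intro vertex_weight_cong[OF D]) auto
    ultimately show ?thesis using Cons.prems(3)[OF that] by simp
  qed
  have "(\<Sum>\<phi> \<in> {..<c + ?f * length (b # bs)} \<rightarrow>\<^sub>E V.
      P \<phi> * of_bool (edges_ok E \<phi> (set (vertex_edges D (b # bs) c acc)))) =
    (\<Sum>\<phi> \<in> {..<c + ?f + ?f * length bs} \<rightarrow>\<^sub>E V.
      P \<phi> * of_bool (edges_ok E \<phi> (set (vertex_edges D bs (c + ?f) (rev (inst c ?u ?u ?T) @ acc)))))"
    by (simp add: algebra_simps)
  also have "\<dots> = (\<Sum>\<phi> \<in> {..<c + ?f} \<rightarrow>\<^sub>E V.
      P \<phi> * of_bool (edges_ok E \<phi> (set (rev (inst c ?u ?u ?T) @ acc))) * vertex_weight V E D bs \<phi>)"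
  proof (rule Cons.IH)
    show "cnum D + length bs \<le> c + ?f" using Cons.prems(1) by simp
    show "x < c + ?f \<and> y < c + ?f" if "(x, y) \<in> set (rev (inst c ?u ?u ?T) @ acc)" for x y
      using that I(2)[of x y] Cons.prems(2)[of x y] by auto
    show "P \<phi> = P \<psi>" if "\<And>x. x < c + ?f \<Longrightarrow> \<phi> x = \<psi> x" for \<phi> \<psi>
      using that by (intro Cons.prems(3)) auto
  qed
  also have "\<dots> = (\<Sum>\<phi> \<in> {..<c + ?f} \<rightarrow>\<^sub>E V.
      ?P \<phi> * of_bool (edges_ok E \<phi> (map_prod (place c ?u ?u) (place c ?u ?u) ` set ?T)))"
    by (rule sum.cong) (auto simp: edges_ok_Un set_inst)
  also have "\<dots> = (\<Sum>\<phi> \<in> {..<c} \<rightarrow>\<^sub>E V. ?P \<phi> * gadget_count V E (set ?T) ?f \<phi> (\<phi> ?u) (\<phi> ?u))"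
    by (rule sum_block[where P = ?P, OF V TA order_refl le_trans[OF u(1) less_imp_le[OF u(2)]] u(2) u(2)], rule P) blast
  also have "\<dots> = (\<Sum>\<phi> \<in> {..<c} \<rightarrow>\<^sub>E V. P \<phi> * of_bool (edges_ok E \<phi> (set acc)) *
      vertex_weight V E D (b # bs) \<phi>)"
    by (simp add: algebra_simps)
  finally show ?case .
qed

lemma sum_edge_edges:
  assumes V: "finite V" and D: "valid_blueprint D"
    and "cnum D + n \<le> c" "\<And>u w. (u, w) \<in> set es \<Longrightarrow> u < w \<and> w < n"
    and "\<And>x y. (x, y) \<in> set acc \<Longrightarrow> x < c \<and> y < c"
  shows "(\<Sum>\<phi> \<in> {..<c + edge_fresh D * length es} \<rightarrow>\<^sub>E V.
      of_bool (edges_ok E \<phi> (set (edge_edges D es c acc)))) =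
    (\<Sum>\<phi> \<in> {..<c} \<rightarrow>\<^sub>E V. of_bool (edges_ok E \<phi> (set acc)) * edge_weight V E D es \<phi>)"
  using assms(3-)
proof (induction es arbitrary: c acc)
  case Nil
  show ?case by (simp add: edge_weight_def)
next
  case (Cons e es)
  obtain u w where e: "e = (u, w)" by force
  let ?T = "bis_edges D"
  let ?f = "edge_fresh D"
  let ?u = "cnum D + u"
  let ?w = "cnum D + w"
  let ?P = "\<lambda>\<phi>. of_bool (edges_ok E \<phi> (set acc)) * edge_weight V E D es \<phi>"
  let ?A = "{U, W} \<union> (Const ` {..<cnum D} \<union> Fresh ` {..<?f})"
  have T: "distinct ?T" "set ?T \<subseteq> edge_slots {..<cnum D} ?f"
    using D by (auto simp: valid_blueprint_def)
  have u: "cnum D \<le> ?u" "?u < ?w" "?w < c" using Cons.prems(1) Cons.prems(2)[of u w] e by auto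
  note I = inst_edge[OF T u]
  have TA: "set ?T \<subseteq> ?A \<times> ?A"
    by (rule order_trans[OF T(2) edge_slots_subset])
  have P: "?P \<phi> = ?P \<psi>" if "\<And>x. x < c \<Longrightarrow> \<phi> x = \<psi> x" for \<phi> \<psi>
  proof -
    have "edges_ok E \<phi> (set acc) \<longleftrightarrow> edges_ok E \<psi> (set acc)"
      using that Cons.prems(3) by (intro edges_ok_cong) blast
    moreover have "edge_weight V E D es \<phi> = edge_weight V E D es \<psi>"
    proof (rule edge_weight_cong[OF D])
      show "\<phi> x = \<psi> x" if "x < cnum D + n" for x
        using that \<open>\<And>x. x < c \<Longrightarrow> \<phi> x = \<psi> x\<close> Cons.prems(1) by simp
      show "u < n \<and> w < n" if "(u, w) \<in> set es" for u w
        using Cons.prems(2)[of u w] that by auto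
    qed
    ultimately show ?thesis by simp
  qed
  have "(\<Sum>\<phi> \<in> {..<c + ?f * length (e # es)} \<rightarrow>\<^sub>E V.
      of_bool (edges_ok E \<phi> (set (edge_edges D (e # es) c acc)))) =
    (\<Sum>\<phi> \<in> {..<c + ?f + ?f * length es} \<rightarrow>\<^sub>E V.
      (of_bool (edges_ok E \<phi> (set (edge_edges D es (c + ?f) (rev (inst c ?u ?w ?T) @ acc)))) :: nat))"
    by (simp add: algebra_simps e)
  also have "\<dots> = (\<Sum>\<phi> \<in> {..<c + ?f} \<rightarrow>\<^sub>E V.
      of_bool (edges_ok E \<phi> (set (rev (inst c ?u ?w ?T) @ acc))) * edge_weight V E D es \<phi>)"
  proof (rule Cons.IH)
    show "cnum D + n \<le> c + ?f" using Cons.prems(1) by simp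
    show "x < c + ?f \<and> y < c + ?f" if "(x, y) \<in> set (rev (inst c ?u ?w ?T) @ acc)" for x y
      using that I(2)[of x y] Cons.prems(3)[of x y] by auto
    show "u < w \<and> w < n" if "(u, w) \<in> set es" for u w
      using Cons.prems(2)[of u w] that by auto
  qed
  also have "\<dots> = (\<Sum>\<phi> \<in> {..<c + ?f} \<rightarrow>\<^sub>E V.
      ?P \<phi> * of_bool (edges_ok E \<phi> (map_prod (place c ?u ?w) (place c ?u ?w) ` set ?T)))"
    by (rule sum.cong) (auto simp: edges_ok_Un set_inst)
  also have "\<dots> = (\<Sum>\<phi> \<in> {..<c} \<rightarrow>\<^sub>E V. ?P \<phi> * gadget_count V E (set ?T) ?f \<phi> (\<phi> ?u) (\<phi> ?w))"
    by (rule sum_block[where P = ?P, OF V TA order_refl le_trans[OF u(1) less_imp_le[OF less_trans[OF u(2,3)]]] less_trans[OF u(2,3)] u(3)], rule P) blast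
  also have "\<dots> = (\<Sum>\<phi> \<in> {..<c} \<rightarrow>\<^sub>E V. of_bool (edges_ok E \<phi> (set acc)) *
      edge_weight V E D (e # es) \<phi>)"
    by (simp add: algebra_simps edge_weight_def e)
  finally show ?case .
qed

lemma card_homs_query_graph:
  assumes K: "pair_graph K" and D: "valid_blueprint D"
    and es: "\<And>u w. (u, w) \<in> set es \<Longrightarrow> u < w \<and> w < length bs"
  shows "card (homs (query_graph D bs es) K) = (\<Sum>\<phi> \<in> {..<cnum D + length bs} \<rightarrow>\<^sub>E pverts K.
    edge_weight (pverts K) (parcs K) D es \<phi> *
    of_bool (edges_ok (parcs K) \<phi> (set (const_edges D))) *
    vertex_weight (pverts K) (parcs K) D bs \<phi>)"
proof -
  interpret K: pair_graph K by fact
  let ?V = "pverts K"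
  let ?E = "parcs K"
  let ?n = "length bs"
  have sym: "(\<forall>(u, v) \<in> A \<union> A\<inverse>. (\<phi> u, \<phi> v) \<in> ?E) \<longleftrightarrow> edges_ok ?E \<phi> A"
    for A and \<phi> :: "nat \<Rightarrow> 'a"
    unfolding edges_ok_def ball_Un using K.arcs_symmetric by fastforce
  have V: "finite ?V" by (rule K.pair_finite_verts)
  have F: "\<And>x y. (x, y) \<in> set (const_edges D) \<Longrightarrow> x < y \<and> y < cnum D"
    using D by (auto simp: valid_blueprint_def)
  have bound: "x < query_size D ?n 0 \<and> y < query_size D ?n 0"
    if "(x, y) \<in> set (vertex_edges D bs (cnum D + ?n) (const_edges D))" for x y
    using query_vertex_edges_valid[OF D, of bs] that by fastforce
  have "homs (query_graph D bs es) K =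
    {\<phi> \<in> {..<query_size D ?n (length es)} \<rightarrow>\<^sub>E ?V. edges_ok ?E \<phi> (set (query_edges D bs es))}"
    by (simp add: homs_def query_graph_def sym)
  then have "card (homs (query_graph D bs es) K) =
    (\<Sum>\<phi> \<in> {..<query_size D ?n (length es)} \<rightarrow>\<^sub>E ?V.
      of_bool (edges_ok ?E \<phi> (set (query_edges D bs es))))"
    using V by (simp add: finite_PiE Int_def)
  also have "\<dots> = (\<Sum>\<phi> \<in> {..<query_size D ?n 0 + edge_fresh D * length es} \<rightarrow>\<^sub>E ?V.
      of_bool (edges_ok ?E \<phi> (set (edge_edges D es (query_size D ?n 0)
        (vertex_edges D bs (cnum D + ?n) (const_edges D))))))"
    by (simp add: query_edges_def query_size_def)
  also have "\<dots> = (\<Sum>\<phi> \<in> {..<query_size D ?n 0} \<rightarrow>\<^sub>E ?V.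
      of_bool (edges_ok ?E \<phi> (set (vertex_edges D bs (cnum D + ?n) (const_edges D)))) *
      edge_weight ?V ?E D es \<phi>)"
    by (rule sum_edge_edges[OF V D _ es bound]) (auto simp: query_size_def)
  also have "\<dots> = (\<Sum>\<phi> \<in> {..<cnum D + ?n + vertex_fresh D * ?n} \<rightarrow>\<^sub>E ?V.
      edge_weight ?V ?E D es \<phi> *
      of_bool (edges_ok ?E \<phi> (set (vertex_edges D bs (cnum D + ?n) (const_edges D)))))"
    by (simp add: query_size_def mult.commute)
  also have "\<dots> = (\<Sum>\<phi> \<in> {..<cnum D + ?n} \<rightarrow>\<^sub>E ?V. edge_weight ?V ?E D es \<phi> *
    of_bool (edges_ok ?E \<phi> (set (const_edges D))) * vertex_weight ?V ?E D bs \<phi>)"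
  proof (rule sum_vertex_edges[OF V D order_refl])
    show "x < cnum D + ?n \<and> y < cnum D + ?n" if "(x, y) \<in> set (const_edges D)" for x y
      using F[OF that] by simp
    show "edge_weight ?V ?E D es \<phi> = edge_weight ?V ?E D es \<psi>"
      if "\<And>x. x < cnum D + ?n \<Longrightarrow> \<phi> x = \<psi> x" for \<phi> \<psi>
      using es by (intro edge_weight_cong[OF D that]) force+
  qed
  finally show ?thesis .
qed

lemma vertex_weight_sides:
  "vertex_weight V E D (replicate k True @ replicate l False) \<phi> = (\<Prod>i<l + k.
    gadget_count V E (set (if i < l then left_edges D else right_edges D)) (vertex_fresh D) \<phi>
      (\<phi> (cnum D + i)) (\<phi> (cnum D + i)))"
proof (induction k)
  case 0
  show ?case by (induction l) (auto simp: mult.commute)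
next
  case (Suc k)
  then show ?case by (simp add: mult.commute add.commute)
qed

text \<open>With the constants held at \<kappa>, this is the partition function of a spin system on
  the instance, the spins being the elements of \<open>V\<close>. The gadgets are designed to make
  it congruent to that of the weighted independent sets.\<close>

definition bis_weight :: "'b set \<Rightarrow> ('b \<times> 'b) set \<Rightarrow> ('c endpoint \<times> 'c endpoint) set \<Rightarrow>
    ('c endpoint \<times> 'c endpoint) set \<Rightarrow> nat \<Rightarrow> ('c endpoint \<times> 'c endpoint) set \<Rightarrow> nat \<Rightarrow>
    nat \<Rightarrow> nat \<Rightarrow> (nat \<times> nat) set \<Rightarrow> ('c \<Rightarrow> 'b) \<Rightarrow> nat" where
  "bis_weight V E TL TR f TE g l n A \<kappa> = (\<Sum>a \<in> {..<n} \<rightarrow>\<^sub>E V.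
    (\<Prod>i<n. gadget_count V E (if i < l then TL else TR) f \<kappa> (a i) (a i)) *
    (\<Prod>(u, w) \<in> A. gadget_count V E TE g \<kappa> (a u) (a w)))"

lemma card_homs_query:
  assumes K: "pair_graph K" and D: "valid_blueprint D" and "distinct es" and "l \<le> n"
    and es: "\<And>u w. (u, w) \<in> set es \<Longrightarrow> u < w \<and> w < n"
  shows "card (homs (query_graph D (sides l n) es) K) =
    (\<Sum>\<kappa> \<in> {..<cnum D} \<rightarrow>\<^sub>E pverts K. of_bool (edges_ok (parcs K) \<kappa> (set (const_edges D))) *
      bis_weight (pverts K) (parcs K) (set (left_edges D)) (set (right_edges D)) (vertex_fresh D)
        (set (bis_edges D)) (edge_fresh D) l n (set es) \<kappa>)"
proof -
  let ?V = "pverts K"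
  let ?E = "parcs K"
  let ?m = "cnum D"
  let ?bs = "sides l n"
  let ?T = "\<lambda>i. if i < l then left_edges D else right_edges D"
  have len: "length ?bs = n" using \<open>l \<le> n\<close> by simp
  have C: "set_consts (set (?T i)) \<subseteq> {..<?m}" "set_consts (set (bis_edges D)) \<subseteq> {..<?m}" for i
    by (rule vertex_slots_consts[of _ _ "vertex_fresh D"], use D in \<open>simp add: valid_blueprint_def\<close>)
      (rule edge_slots_consts[of _ _ "edge_fresh D"], use D in \<open>simp add: valid_blueprint_def\<close>)
  have F: "\<And>x y. (x, y) \<in> set (const_edges D) \<Longrightarrow> x < y \<and> y < cnum D"
    using D by (auto simp: valid_blueprint_def)
  have "card (homs (query_graph D ?bs es) K) = (\<Sum>\<phi> \<in> {..<?m + n} \<rightarrow>\<^sub>E ?V.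
    edge_weight ?V ?E D es \<phi> * of_bool (edges_ok ?E \<phi> (set (const_edges D))) *
    vertex_weight ?V ?E D ?bs \<phi>)"
    using card_homs_query_graph[OF K D, of es ?bs] es unfolding len by blast
  also have "\<dots> = (\<Sum>\<kappa> \<in> {..<?m} \<rightarrow>\<^sub>E ?V. \<Sum>a \<in> {..<n} \<rightarrow>\<^sub>E ?V.
    of_bool (edges_ok ?E \<kappa> (set (const_edges D))) *
    ((\<Prod>i<n. gadget_count ?V ?E (set (?T i)) (vertex_fresh D) \<kappa> (a i) (a i)) *
    (\<Prod>(u, w) \<in> set es. gadget_count ?V ?E (set (bis_edges D)) (edge_fresh D) \<kappa> (a u) (a w))))"
    unfolding sum_PiE_append
  proof (intro sum.cong[OF refl])
    fix \<kappa> a :: "nat \<Rightarrow> 'a"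
    let ?j = "\<lambda>x. if x < ?m then \<kappa> x else if x < ?m + n then a (x - ?m) else undefined"
    have 1: "edges_ok ?E ?j (set (const_edges D)) \<longleftrightarrow> edges_ok ?E \<kappa> (set (const_edges D))"
    proof (rule edges_ok_cong)
      fix x y assume "(x, y) \<in> set (const_edges D)"
      then have "x < ?m" "y < ?m" using F[of x y] by auto
      then show "?j x = \<kappa> x \<and> ?j y = \<kappa> y" by simp
    qed
    have "vertex_weight ?V ?E D ?bs ?j =
      (\<Prod>i<n. gadget_count ?V ?E (set (?T i)) (vertex_fresh D) ?j (?j (?m + i)) (?j (?m + i)))"
      unfolding vertex_weight_sides using \<open>l \<le> n\<close> by simp
    also have "\<dots> = (\<Prod>i<n. gadget_count ?V ?E (set (?T i)) (vertex_fresh D) \<kappa> (a i) (a i))"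
    proof (rule prod.cong[OF refl])
      fix i assume "i \<in> {..<n}"
      then have "?j (?m + i) = a i" by simp
      then show "gadget_count ?V ?E (set (?T i)) (vertex_fresh D) ?j (?j (?m + i)) (?j (?m + i)) =
        gadget_count ?V ?E (set (?T i)) (vertex_fresh D) \<kappa> (a i) (a i)"
        by (simp only:) (rule gadget_count_cong, use C(1)[of i] in auto)
    qed
    finally have 2: "vertex_weight ?V ?E D ?bs ?j =
      (\<Prod>i<n. gadget_count ?V ?E (set (?T i)) (vertex_fresh D) \<kappa> (a i) (a i))" .
    have "edge_weight ?V ?E D es ?j = (\<Prod>(u, w) \<in> set es.
      gadget_count ?V ?E (set (bis_edges D)) (edge_fresh D) ?j (?j (?m + u)) (?j (?m + w)))"
      unfolding edge_weight_def by (rule prod.distinct_set_conv_list[OF \<open>distinct es\<close>, symmetric])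
    also have "\<dots> = (\<Prod>(u, w) \<in> set es.
      gadget_count ?V ?E (set (bis_edges D)) (edge_fresh D) \<kappa> (a u) (a w))"
    proof (rule prod.cong[OF refl], clarify)
      fix u w assume "(u, w) \<in> set es"
      then have "?j (?m + u) = a u" "?j (?m + w) = a w" using es[of u w] by auto
      then show "gadget_count ?V ?E (set (bis_edges D)) (edge_fresh D) ?j (?j (?m + u)) (?j (?m + w)) =
        gadget_count ?V ?E (set (bis_edges D)) (edge_fresh D) \<kappa> (a u) (a w)"
        by (simp only:) (rule gadget_count_cong, use C(2) in auto)
    qed
    finally show "edge_weight ?V ?E D es ?j * of_bool (edges_ok ?E ?j (set (const_edges D))) *
        vertex_weight ?V ?E D ?bs ?j =
      of_bool (edges_ok ?E \<kappa> (set (const_edges D))) *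
      ((\<Prod>i<n. gadget_count ?V ?E (set (?T i)) (vertex_fresh D) \<kappa> (a i) (a i)) *
      (\<Prod>(u, w) \<in> set es. gadget_count ?V ?E (set (bis_edges D)) (edge_fresh D) \<kappa> (a u) (a w)))"
      unfolding 1 2 by simp
  qed
  also have "\<dots> = (\<Sum>\<kappa> \<in> {..<?m} \<rightarrow>\<^sub>E ?V. of_bool (edges_ok ?E \<kappa> (set (const_edges D))) *
      bis_weight ?V ?E (set (left_edges D)) (set (right_edges D)) (vertex_fresh D)
        (set (bis_edges D)) (edge_fresh D) l n (set es) \<kappa>)"
    unfolding bis_weight_def sum_distrib_left if_distrib[of set] ..
  finally show ?thesis .
qed

section \<open>Inclusion and exclusion over identifications of the constants\<close>

section \<open>Pinning\<close>

lemma bis_weight_map: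
  "bis_weight V E (map_prod (map_endpoint h) (map_endpoint h) ` TL)
      (map_prod (map_endpoint h) (map_endpoint h) ` TR) f
      (map_prod (map_endpoint h) (map_endpoint h) ` TE) g l n A \<kappa> =
    bis_weight V E TL TR f TE g l n A (\<kappa> \<circ> h)"
  unfolding bis_weight_def
  by (simp add: gadget_count_map if_distrib[of "\<lambda>T. gadget_count V E T f \<kappa> _ _"]
      if_distrib[of "\<lambda>T. gadget_count V E T f (\<kappa> \<circ> h) _ _"] cong: if_cong)

lemma bis_weight_cong:
  assumes "TL \<subseteq> vertex_slots C f" "TR \<subseteq> vertex_slots C f" "TE \<subseteq> edge_slots C g"
    and "\<And>x. x \<in> C \<Longrightarrow> \<kappa> x = \<kappa>' x"
  shows "bis_weight V E TL TR f TE g l n A \<kappa> = bis_weight V E TL TR f TE g l n A \<kappa>'"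
proof -
  have *: "gadget_count V E T h \<kappa> a b = gadget_count V E T h \<kappa>' a b"
    if "set_consts T \<subseteq> C" for T h a b
    using assms(4) that by (intro gadget_count_cong) auto
  have "gadget_count V E TL f \<kappa> a b = gadget_count V E TL f \<kappa>' a b"
    "gadget_count V E TR f \<kappa> a b = gadget_count V E TR f \<kappa>' a b"
    "gadget_count V E TE g \<kappa> a b = gadget_count V E TE g \<kappa>' a b" for a b
    by (rule *[OF vertex_slots_consts[OF assms(1)]], rule *[OF vertex_slots_consts[OF assms(2)]],
        rule *[OF edge_slots_consts[OF assms(3)]])
  then show ?thesis
    unfolding bis_weight_def by (simp add: if_distrib[of "\<lambda>T. gadget_count V E T f _ _ _"] cong: if_cong)
qed

lemma map_endpoint_vertex_slots:
  assumes "T \<subseteq> vertex_slots C f" "h ` C \<subseteq> C'"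
  shows "map_prod (map_endpoint h) (map_endpoint h) ` T \<subseteq> vertex_slots C' f"
proof -
  have "map_prod (map_endpoint h) (map_endpoint h) (x, y) \<in> vertex_slots C' f"
    if "(x, y) \<in> vertex_slots C f" for x y
    using that assms(2) unfolding vertex_slots_def by (cases x; cases y) (auto simp: image_iff)
  then show ?thesis using assms(1) by auto
qed

lemma map_endpoint_edge_slots:
  assumes "T \<subseteq> edge_slots C f" "h ` C \<subseteq> C'"
  shows "map_prod (map_endpoint h) (map_endpoint h) ` T \<subseteq> edge_slots C' f"
proof -
  have "map_prod (map_endpoint h) (map_endpoint h) (x, y) \<in> edge_slots C' f"
    if "(x, y) \<in> edge_slots C f" for x y
    using that assms(2) unfolding edge_slots_def by (cases x; cases y) (auto simp: image_iff)
  then show ?thesis using assms(1) by auto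
qed

definition bis_edge_list :: "nat \<Rightarrow> nat \<Rightarrow> (nat \<times> nat) list \<Rightarrow> bool" where
  "bis_edge_list l n es \<longleftrightarrow> l \<le> n \<and> distinct es \<and> (\<forall>(u, w) \<in> set es. u < l \<and> l \<le> w \<and> w < n)"

text \<open>The constants of the query are the classes of \<open>r\<close>, and maps on the classes
  correspond to maps on \<open>K\<close> that are constant on each class. The quotient must have no
  loops, since otherwise the query would code no graph.\<close>

lemma quotient_blueprint:
  fixes K :: "'a pair_pre_digraph"
  assumes K: "pair_graph K"
    and r: "\<And>x. x \<in> pverts K \<Longrightarrow> r x \<in> pverts K" "\<And>x. x \<in> pverts K \<Longrightarrow> r (r x) = r x"
    and loopless: "\<And>x y. (x, y) \<in> parcs K \<Longrightarrow> r x \<noteq> r y"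
    and T: "finite TL" "finite TR" "finite TE" "TL \<subseteq> vertex_slots (pverts K) f"
      "TR \<subseteq> vertex_slots (pverts K) f" "TE \<subseteq> edge_slots (pverts K) g"
  obtains D where "valid_blueprint D"
    and "\<forall>l n es. bis_edge_list l n es \<longrightarrow>
      card (homs (query_graph D (sides l n) es) K) =
      (\<Sum>\<kappa> \<in> {\<kappa> \<in> pverts K \<rightarrow>\<^sub>E pverts K. \<forall>x \<in> pverts K. \<kappa> (r x) = \<kappa> x}.
        of_bool (edges_ok (parcs K) \<kappa> (parcs K)) *
        bis_weight (pverts K) (parcs K) TL TR f TE g l n (set es) \<kappa>)"
proof -
  interpret K: pair_graph K by fact
  let ?V = "pverts K"
  let ?E = "parcs K"
  have V: "finite ?V" by (rule K.pair_finite_verts)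
  define m where "m = card (r ` ?V)"
  obtain idx where idx: "bij_betw idx (r ` ?V) {..<m}"
    using ex_bij_betw_finite_nat[of "r ` ?V"] V unfolding m_def atLeast0LessThan by blast
  define h where "h = idx \<circ> r"
  have h: "h ` ?V \<subseteq> {..<m}" using idx by (auto simp: h_def bij_betw_def)
  have h_eq: "h x = h y \<longleftrightarrow> r x = r y" if "x \<in> ?V" "y \<in> ?V" for x y
    using idx that by (auto simp: h_def bij_betw_def inj_on_def)
  \<comment> \<open>Several edges of \<open>K\<close> may become equal in the quotient, and each
    occurs in both directions. The set of increasing pairs keeps one copy of each.\<close>
  define F where "F = {(x, y) \<in> map_prod h h ` ?E. x < y}"
  have "finite F" unfolding F_def
    by (rule finite_subset[of _ "map_prod h h ` ?E"]) (auto simp: K.pair_finite_arcs)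
  then obtain FL where FL: "set FL = F" "distinct FL" using finite_distinct_list by blast
  define mp where "mp = (map_prod (map_endpoint h) (map_endpoint h) :: 'a endpoint \<times> 'a endpoint \<Rightarrow> _)"
  obtain LL where LL: "set LL = mp ` TL" "distinct LL" using finite_distinct_list[OF finite_imageI[OF T(1)], of mp] by blast
  obtain LR where LR: "set LR = mp ` TR" "distinct LR" using finite_distinct_list[OF finite_imageI[OF T(2)], of mp] by blast
  obtain LE where LE: "set LE = mp ` TE" "distinct LE" using finite_distinct_list[OF finite_imageI[OF T(3)], of mp] by blast
  define D where "D = \<lparr>cnum = m, const_edges = FL, vertex_fresh = f, left_edges = LL,
    right_edges = LR, edge_fresh = g, bis_edges = LE\<rparr>"
  have F_less: "x < y \<and> y < m" if "(x, y) \<in> F" for x y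
    using that h K.in_arcsD2 unfolding F_def by blast
  have D: "valid_blueprint D"
    unfolding valid_blueprint_def D_def
    using FL LL LR LE F_less map_endpoint_vertex_slots[OF T(4) h] map_endpoint_vertex_slots[OF T(5) h]
      map_endpoint_edge_slots[OF T(6) h] by (auto simp: mp_def)
  have const: "edges_ok ?E \<kappa> F \<longleftrightarrow> edges_ok ?E (\<kappa> \<circ> h) ?E" for \<kappa> :: "nat \<Rightarrow> 'a"
  proof
    assume *: "edges_ok ?E \<kappa> F"
    show "edges_ok ?E (\<kappa> \<circ> h) ?E"
      unfolding edges_ok_def
    proof clarify
      fix x y assume xy: "(x, y) \<in> ?E"
      have "h x \<noteq> h y"
        using h_eq[OF K.in_arcsD1[OF xy] K.in_arcsD2[OF xy]] loopless[OF xy] by simp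
      moreover have "(h x, h y) \<in> map_prod h h ` ?E" "(h y, h x) \<in> map_prod h h ` ?E"
        using imageI[OF xy, of "map_prod h h"] imageI[OF K.arcs_symmetric[OF xy], of "map_prod h h"]
        by simp_all
      ultimately have "(h x, h y) \<in> F \<or> (h y, h x) \<in> F" by (auto simp: F_def)
      then have "(\<kappa> (h x), \<kappa> (h y)) \<in> ?E \<or> (\<kappa> (h y), \<kappa> (h x)) \<in> ?E"
        using * by (auto simp: edges_ok_def)
      then show "((\<kappa> \<circ> h) x, (\<kappa> \<circ> h) y) \<in> ?E" using K.arcs_symmetric by auto
    qed
  next
    assume "edges_ok ?E (\<kappa> \<circ> h) ?E"
    then show "edges_ok ?E \<kappa> F" by (auto simp: edges_ok_def F_def)
  qed
  have inv: "the_inv_into (r ` ?V) idx i \<in> r ` ?V" "idx (the_inv_into (r ` ?V) idx i) = i"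
    if "i < m" for i
    using that idx unfolding bij_betw_def
    by (auto intro: the_inv_into_into f_the_inv_into_f)
  have inv': "the_inv_into (r ` ?V) idx (h x) = r x" if "x \<in> ?V" for x
    using that idx unfolding bij_betw_def h_def by (simp add: the_inv_into_f_f)
  have hm: "h x < m" if "x \<in> ?V" for x using h that by auto
  let ?ext = "\<lambda>\<kappa>. restrict (\<kappa> \<circ> h) ?V"
  have count: "card (homs (query_graph D (sides l n) es) K) =
      (\<Sum>\<kappa> \<in> {\<kappa> \<in> ?V \<rightarrow>\<^sub>E ?V. \<forall>x \<in> ?V. \<kappa> (r x) = \<kappa> x}.
        of_bool (edges_ok ?E \<kappa> ?E) * bis_weight ?V ?E TL TR f TE g l n (set es) \<kappa>)"
    if es: "bis_edge_list l n es" for l n es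
  proof -
    have "l \<le> n" "distinct es" "\<And>u w. (u, w) \<in> set es \<Longrightarrow> u < w \<and> w < n"
      using es by (fastforce simp: bis_edge_list_def)+
    from card_homs_query[OF K D this(2,1,3)]
    have "card (homs (query_graph D (sides l n) es) K) =
      (\<Sum>\<kappa> \<in> {..<m} \<rightarrow>\<^sub>E ?V. of_bool (edges_ok ?E (\<kappa> \<circ> h) ?E) *
        bis_weight ?V ?E TL TR f TE g l n (set es) (\<kappa> \<circ> h))"
      by (simp add: D_def FL LL LR LE const mp_def bis_weight_map)
    also have "\<dots> = (\<Sum>\<kappa> \<in> {..<m} \<rightarrow>\<^sub>E ?V. of_bool (edges_ok ?E (?ext \<kappa>) ?E) *
        bis_weight ?V ?E TL TR f TE g l n (set es) (?ext \<kappa>))"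
    proof (intro sum.cong[OF refl] arg_cong2[where f = "(*)"])
      fix \<kappa> :: "nat \<Rightarrow> 'a"
      show "of_bool (edges_ok ?E (\<kappa> \<circ> h) ?E) = (of_bool (edges_ok ?E (?ext \<kappa>) ?E) :: nat)"
        using K.in_arcsD1 K.in_arcsD2
        by (intro arg_cong[where f = of_bool] edges_ok_cong) auto
      show "bis_weight ?V ?E TL TR f TE g l n (set es) (\<kappa> \<circ> h) =
        bis_weight ?V ?E TL TR f TE g l n (set es) (?ext \<kappa>)"
        by (rule bis_weight_cong[OF T(4-6)]) simp
    qed
    also have "\<dots> = (\<Sum>\<kappa> \<in> {\<kappa> \<in> ?V \<rightarrow>\<^sub>E ?V. \<forall>x \<in> ?V. \<kappa> (r x) = \<kappa> x}.
        of_bool (edges_ok ?E \<kappa> ?E) * bis_weight ?V ?E TL TR f TE g l n (set es) \<kappa>)"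
    proof (rule sum.reindex_bij_witness[where i = "\<lambda>\<kappa>. restrict (\<kappa> \<circ> the_inv_into (r ` ?V) idx) {..<m}"
          and j = ?ext])
      fix \<kappa> :: "nat \<Rightarrow> 'a"
      assume \<kappa>: "\<kappa> \<in> {..<m} \<rightarrow>\<^sub>E ?V"
      show "restrict (?ext \<kappa> \<circ> the_inv_into (r ` ?V) idx) {..<m} = \<kappa>"
      proof
        fix i
        show "restrict (?ext \<kappa> \<circ> the_inv_into (r ` ?V) idx) {..<m} i = \<kappa> i"
        proof (cases "i < m")
          case True
          obtain x where x: "x \<in> ?V" "the_inv_into (r ` ?V) idx i = r x" using inv(1)[OF True] by auto
          then have "h (r x) = i" using inv(2)[OF True] r(2)[OF x(1)] by (simp add: h_def)
          then show ?thesis using True x r(1) by simp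
        qed (use \<kappa> in \<open>auto simp: PiE_iff extensional_def\<close>)
      qed
      show "?ext \<kappa> \<in> {\<kappa> \<in> ?V \<rightarrow>\<^sub>E ?V. \<forall>x \<in> ?V. \<kappa> (r x) = \<kappa> x}"
        using \<kappa> hm r by (auto simp: h_def)
    next
      fix \<kappa> :: "'a \<Rightarrow> 'a"
      assume \<kappa>: "\<kappa> \<in> {\<kappa> \<in> ?V \<rightarrow>\<^sub>E ?V. \<forall>x \<in> ?V. \<kappa> (r x) = \<kappa> x}"
      show "?ext (restrict (\<kappa> \<circ> the_inv_into (r ` ?V) idx) {..<m}) = \<kappa>"
      proof
        fix x
        show "?ext (restrict (\<kappa> \<circ> the_inv_into (r ` ?V) idx) {..<m}) x = \<kappa> x"
          by (cases "x \<in> ?V") (use \<kappa> hm inv' in \<open>auto simp: PiE_iff extensional_def\<close>)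
      qed
      show "restrict (\<kappa> \<circ> the_inv_into (r ` ?V) idx) {..<m} \<in> {..<m} \<rightarrow>\<^sub>E ?V"
      proof (rule restrict_PiE_iff[THEN iffD2], rule ballI)
        fix i assume "i \<in> {..<m}"
        then have "the_inv_into (r ` ?V) idx i \<in> ?V" using inv(1)[of i] r(1) by auto
        then show "(\<kappa> \<circ> the_inv_into (r ` ?V) idx) i \<in> ?V" using \<kappa> by auto
      qed
    qed simp
    finally show ?thesis .
  qed
  show thesis
    using that[OF D] count by blast
qed

text \<open>Inclusion and exclusion produces sets \<open>P\<close> of identified pairs, whereas a
  blueprint is built from a retraction onto representatives. The latter are chosen in the classes of
  the equivalence relation generated by \<open>P\<close>.\<close>

lemma class_representatives:
  fixes V :: "'a set"
  assumes P: "P \<subseteq> V \<times> V"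
  obtains r where "\<And>x. x \<in> V \<Longrightarrow> r x \<in> V" "\<And>x. x \<in> V \<Longrightarrow> r (r x) = r x"
    and "\<And>\<kappa> :: 'a \<Rightarrow> 'b. (\<forall>x \<in> V. \<kappa> (r x) = \<kappa> x) \<longleftrightarrow> (\<forall>(x, y) \<in> P. \<kappa> x = \<kappa> y)"
proof -
  define R where "R = (P \<union> P\<inverse>)\<^sup>*"
  define r where "r x = (SOME y. (x, y) \<in> R)" for x
  have "sym R" unfolding R_def by (intro sym_rtrancl sym_Un_converse)
  have "trans R" unfolding R_def by (rule trans_rtrancl)
  have xr: "(x, r x) \<in> R" for x unfolding r_def by (rule someI[of _ x]) (simp add: R_def)
  have req: "r x = r y" if "(x, y) \<in> R" for x y
  proof -
    have "(x, z) \<in> R \<longleftrightarrow> (y, z) \<in> R" for z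
      using that \<open>sym R\<close> \<open>trans R\<close> by (meson symD transD)
    then show ?thesis by (simp add: r_def)
  qed
  have RV: "y \<in> V" if "(x, y) \<in> R" "x \<in> V" for x y
    using that unfolding R_def by (induction rule: rtrancl_induct) (use P in auto)
  have R_eq: "\<kappa> x = \<kappa> y" if "(x, y) \<in> R" "\<forall>(x, y) \<in> P. \<kappa> x = \<kappa> y" for \<kappa> :: "'a \<Rightarrow> 'b" and x y
    using that(1) unfolding R_def by (induction rule: rtrancl_induct) (use that(2) in auto)
  show thesis
  proof (rule that)
    show "r x \<in> V" if "x \<in> V" for x using RV[OF xr that] .
    show "r (r x) = r x" for x using req[OF xr] by simp
    fix \<kappa> :: "'a \<Rightarrow> 'b"
    show "(\<forall>x \<in> V. \<kappa> (r x) = \<kappa> x) \<longleftrightarrow> (\<forall>(x, y) \<in> P. \<kappa> x = \<kappa> y)"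
    proof
      assume l: "\<forall>x \<in> V. \<kappa> (r x) = \<kappa> x"
      show "\<forall>(x, y) \<in> P. \<kappa> x = \<kappa> y"
      proof clarify
        fix x y assume xy: "(x, y) \<in> P"
        then have "(x, y) \<in> R" by (auto simp: R_def)
        from req[OF this] show "\<kappa> x = \<kappa> y" using l P xy by (metis SigmaE2 subsetD)
      qed
    next
      assume "\<forall>(x, y) \<in> P. \<kappa> x = \<kappa> y"
      from R_eq[OF xr this] show "\<forall>x \<in> V. \<kappa> (r x) = \<kappa> x" by metis
    qed
  qed
qed

text \<open>For a fixed map the signs are summed over all subsets of the set of pairs that it
  identifies. This alternating sum vanishes unless that set is empty, that is, unless the map is
  injective. Pairs are ordered, so a collision occurs twice, but only emptiness matters.\<close>

lemma sum_injective_maps: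
  fixes \<Psi> :: "('a \<Rightarrow> 'b) \<Rightarrow> int"
  assumes "finite V" and "finite X"
  shows "(\<Sum>\<kappa> \<in> {\<kappa> \<in> X. inj_on \<kappa> V}. \<Psi> \<kappa>) =
    (\<Sum>P \<in> Pow (V \<times> V - Id). (- 1) ^ card P * (\<Sum>\<kappa> \<in> {\<kappa> \<in> X. \<forall>(x, y) \<in> P. \<kappa> x = \<kappa> y}. \<Psi> \<kappa>))"
proof -
  let ?Q = "V \<times> V - Id"
  have Q: "finite ?Q" using assms by simp
  have sum_sign: "(\<Sum>P \<in> Pow S. (- 1) ^ card P) = (of_bool (S = {}) :: int)" if "finite S" for S :: "('a \<times> 'a) set"
  proof -
    \<comment> \<open>The sum over the subsets is the expansion of (1 - 1)^|S|.\<close>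
    have "(\<Sum>P \<in> Pow S. (- 1) ^ card P) = (0 :: int) ^ card S"
      using prod_add[OF that, of "\<lambda>_. - 1 :: int" "\<lambda>_. 1"] by simp
    then show ?thesis using that by (simp add: power_0_left)
  qed
  have "(\<Sum>P \<in> Pow ?Q. (- 1) ^ card P * (\<Sum>\<kappa> \<in> {\<kappa> \<in> X. \<forall>(x, y) \<in> P. \<kappa> x = \<kappa> y}. \<Psi> \<kappa>)) =
    (\<Sum>P \<in> Pow ?Q. \<Sum>\<kappa> \<in> X. of_bool (\<forall>(x, y) \<in> P. \<kappa> x = \<kappa> y) * (- 1) ^ card P * \<Psi> \<kappa>)"
    using assms(2) by (intro sum.cong[OF refl])
      (simp add: sum_distrib_left sum.inter_filter of_bool_def if_distrib if_distribR cong: if_cong)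
  also have "\<dots> = (\<Sum>\<kappa> \<in> X. (\<Sum>P \<in> Pow ?Q. of_bool (\<forall>(x, y) \<in> P. \<kappa> x = \<kappa> y) * (- 1) ^ card P) * \<Psi> \<kappa>)"
    by (subst sum.swap) (simp add: sum_distrib_right)
  also have "\<dots> = (\<Sum>\<kappa> \<in> X. of_bool (inj_on \<kappa> V) * \<Psi> \<kappa>)"
  proof (intro sum.cong[OF refl] arg_cong2[where f = "(*)"])
    fix \<kappa> :: "'a \<Rightarrow> 'b"
    let ?S = "{(x, y) \<in> ?Q. \<kappa> x = \<kappa> y}"
    have S: "finite ?S" using Q by (rule rev_finite_subset) auto
    have "(\<Sum>P \<in> Pow ?Q. of_bool (\<forall>(x, y) \<in> P. \<kappa> x = \<kappa> y) * (- 1) ^ card P) =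
      (\<Sum>P \<in> Pow ?S. (- 1) ^ card P :: int)"
      using Q by (intro sum.mono_neutral_cong_right) auto
    also have "\<dots> = of_bool (inj_on \<kappa> V)"
      unfolding sum_sign[OF S] by (auto simp: inj_on_def)
    finally show "(\<Sum>P \<in> Pow ?Q. of_bool (\<forall>(x, y) \<in> P. \<kappa> x = \<kappa> y) * (- 1) ^ card P) =
      (of_bool (inj_on \<kappa> V) :: int)" .
  qed (rule refl)
  also have "\<dots> = (\<Sum>\<kappa> \<in> {\<kappa> \<in> X. inj_on \<kappa> V}. \<Psi> \<kappa>)"
    using assms(2) by (simp add: sum.inter_filter of_bool_def if_distrib if_distribR cong: if_cong)
  finally show ?thesis by simp
qed

definition injective_homs :: "'a pair_pre_digraph \<Rightarrow> ('a \<Rightarrow> 'a) set" where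
  "injective_homs K = {\<kappa> \<in> pverts K \<rightarrow>\<^sub>E pverts K. edges_ok (parcs K) \<kappa> (parcs K) \<and> inj_on \<kappa> (pverts K)}"

text \<open>If the weight is congruent to \<open>Z\<close> at every injective \<kappa>, the signed
  sum is \<open>Z\<close> times the number of such maps. Multiplication by the inverse of this
  number modulo \<open>p\<close> isolates \<open>Z\<close>.\<close>

lemma pinning:
  fixes K :: "'a pair_pre_digraph" and Z :: "nat \<Rightarrow> nat \<Rightarrow> (nat \<times> nat) set \<Rightarrow> int"
  assumes p: "prime p" and K: "pair_graph K"
    and T: "finite TL" "finite TR" "finite TE" "TL \<subseteq> vertex_slots (pverts K) f"
      "TR \<subseteq> vertex_slots (pverts K) f" "TE \<subseteq> edge_slots (pverts K) g"
    and A: "\<not> p dvd card (injective_homs K)"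
    and Z: "\<And>l n es \<kappa>. bis_edge_list l n es \<Longrightarrow> \<kappa> \<in> injective_homs K \<Longrightarrow>
      [int (bis_weight (pverts K) (parcs K) TL TR f TE g l n (set es) \<kappa>) = Z l n (set es)] (mod int p)"
  obtains qs where "\<forall>(D, k) \<in> set qs. valid_blueprint D"
    and "\<forall>l n es. bis_edge_list l n es \<longrightarrow>
      nat (Z l n (set es) mod int p) = (\<Sum>(D, k) \<leftarrow> qs.
        k * (card (homs (query_graph D (sides l n) es) K) mod p)) mod p"
proof -
  interpret K: pair_graph K by fact
  let ?V = "pverts K"
  let ?E = "parcs K"
  let ?Q = "?V \<times> ?V - Id"
  let ?X = "{\<kappa> \<in> ?V \<rightarrow>\<^sub>E ?V. edges_ok ?E \<kappa> ?E}"
  let ?w = "bis_weight ?V ?E TL TR f TE g"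
  define S where "S P l n A = (\<Sum>\<kappa> \<in> {\<kappa> \<in> ?X. \<forall>(x, y) \<in> P. \<kappa> x = \<kappa> y}. ?w l n A \<kappa>)" for P l n A
  have V: "finite ?V" by (rule K.pair_finite_verts)
  have X: "finite ?X" using V by (simp add: finite_PiE)
  define good where "good = {P \<in> Pow ?Q. \<exists>D. valid_blueprint D \<and>
    (\<forall>l n es. bis_edge_list l n es \<longrightarrow>
      card (homs (query_graph D (sides l n) es) K) = S P l n (set es))}"
  \<comment> \<open>If \<open>P\<close> admits no query, merging along \<open>P\<close> creates a
    loop. A homomorphism constant on the classes would map it to a loop of \<open>K\<close>, so the
    sum for \<open>P\<close> is empty.\<close>
  have bad: "S P l n A = 0" if P: "P \<in> Pow ?Q" "P \<notin> good" for P l n A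
  proof -
    have "P \<subseteq> ?V \<times> ?V" using P by auto
    then obtain r where r: "\<And>x. x \<in> ?V \<Longrightarrow> r x \<in> ?V" "\<And>x. x \<in> ?V \<Longrightarrow> r (r x) = r x"
      "\<And>\<kappa> :: 'a \<Rightarrow> 'a. (\<forall>x \<in> ?V. \<kappa> (r x) = \<kappa> x) \<longleftrightarrow> (\<forall>(x, y) \<in> P. \<kappa> x = \<kappa> y)"
      by (rule class_representatives[where 'b = 'a]) blast
    have "\<exists>x y. (x, y) \<in> ?E \<and> r x = r y"
    proof (rule ccontr)
      assume "\<not> ?thesis"
      then have loopless: "\<And>x y. (x, y) \<in> ?E \<Longrightarrow> r x \<noteq> r y" by blast
      obtain D where D: "valid_blueprint D"
        "\<forall>l n es. bis_edge_list l n es \<longrightarrow>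
          card (homs (query_graph D (sides l n) es) K) =
          (\<Sum>\<kappa> \<in> {\<kappa> \<in> ?V \<rightarrow>\<^sub>E ?V. \<forall>x \<in> ?V. \<kappa> (r x) = \<kappa> x}.
            of_bool (edges_ok ?E \<kappa> ?E) * ?w l n (set es) \<kappa>)"
        by (rule quotient_blueprint[where r = r, OF K r(1,2) loopless T])
      have "(\<Sum>\<kappa> \<in> {\<kappa> \<in> ?V \<rightarrow>\<^sub>E ?V. \<forall>x \<in> ?V. \<kappa> (r x) = \<kappa> x}. of_bool (edges_ok ?E \<kappa> ?E) * ?w l n A \<kappa>)
        = S P l n A" for l n A
        unfolding S_def r(3) using V by (intro sum.mono_neutral_cong_right) (auto simp: finite_PiE)
      with D have "P \<in> good" using P(1) unfolding good_def by auto
      then show False using P(2) by blast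
    qed
    then obtain x y where xy: "(x, y) \<in> ?E" "r x = r y" by blast
    have "{\<kappa> \<in> ?X. \<forall>(x, y) \<in> P. \<kappa> x = \<kappa> y} = {}"
    proof (rule ccontr)
      assume "{\<kappa> \<in> ?X. \<forall>(x, y) \<in> P. \<kappa> x = \<kappa> y} \<noteq> {}"
      then obtain \<kappa> where \<kappa>: "edges_ok ?E \<kappa> ?E" "\<forall>x \<in> ?V. \<kappa> (r x) = \<kappa> x"
        using r(3) by blast
      have "\<kappa> x = \<kappa> y" using \<kappa>(2) xy(2) K.in_arcsD1[OF xy(1)] K.in_arcsD2[OF xy(1)] by metis
      moreover have "(\<kappa> x, \<kappa> y) \<in> ?E" using \<kappa>(1) xy(1) by (auto simp: edges_ok_def)
      ultimately show False using K.no_loops' by metis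
    qed
    then show ?thesis unfolding S_def by (metis (no_types, lifting) sum.empty)
  qed
  have "\<forall>P \<in> good. \<exists>D. valid_blueprint D \<and>
    (\<forall>l n es. bis_edge_list l n es \<longrightarrow>
      card (homs (query_graph D (sides l n) es) K) = S P l n (set es))"
    by (simp add: good_def)
  then obtain D where D: "\<And>P. P \<in> good \<Longrightarrow> valid_blueprint (D P)"
    "\<And>P l n es. P \<in> good \<Longrightarrow> bis_edge_list l n es \<Longrightarrow>
      card (homs (query_graph (D P) (sides l n) es) K) = S P l n (set es)"
    by metis
  have "finite good" unfolding good_def using V by simp
  then obtain Ps where Ps: "set Ps = good" "distinct Ps" using finite_distinct_list by blast
  let ?A = "int (card (injective_homs K))"
  have "coprime (card (injective_homs K)) p"
    using p A by (metis coprime_commute prime_imp_coprime)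
  then have "coprime ?A (int p)" by simp
  then obtain B where B: "[?A * B = 1] (mod int p)" using cong_solve_coprime_int by blast
  have p0: "int p > 0" using p by (simp add: prime_gt_0_nat)
  \<comment> \<open>The program can only add, so the coefficient, which is the inverse
    \<open>B\<close> with the sign of inclusion and exclusion, is replaced by its nonnegative
    residue.\<close>
  define k where "k P = nat (B * (- 1) ^ card P mod int p)" for P :: "('a \<times> 'a) set"
  have k: "[int (k P) = B * (- 1) ^ card P] (mod int p)" for P
    unfolding k_def using p0 by (simp add: cong_def)
  define qs where "qs = map (\<lambda>P. (D P, k P)) Ps"
  have "nat (Z l n (set es) mod int p) = (\<Sum>(D, k) \<leftarrow> qs.
      k * (card (homs (query_graph D (sides l n) es) K) mod p)) mod p"
    if es: "bis_edge_list l n es" for l n es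
  proof -
    let ?A' = "set es"
    let ?N = "\<Sum>(D, k) \<leftarrow> qs.
      k * (card (homs (query_graph D (sides l n) es) K) mod p)"
    have "?N = (\<Sum>P \<in> good. k P * (S P l n ?A' mod p))"
      unfolding qs_def using Ps D(2)[OF _ es]
      by (simp add: comp_def sum_list_distinct_conv_sum_set)
    then have "int ?N = (\<Sum>P \<in> good. int (k P) * (int (S P l n ?A') mod int p))"
      by (simp add: zmod_int)
    also have "[\<dots> = (\<Sum>P \<in> good. (B * (- 1) ^ card P) * int (S P l n ?A'))] (mod int p)"
      by (intro cong_sum cong_mult k) simp
    also have "(\<Sum>P \<in> good. (B * (- 1) ^ card P) * int (S P l n ?A')) =
      (\<Sum>P \<in> Pow ?Q. (B * (- 1) ^ card P) * int (S P l n ?A'))"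
    proof (rule sum.mono_neutral_left)
      show "finite (Pow ?Q)" "good \<subseteq> Pow ?Q" using V by (auto simp: good_def)
      show "\<forall>P \<in> Pow ?Q - good. (B * (- 1) ^ card P) * int (S P l n ?A') = 0"
        using bad[of _ l n ?A'] by (metis DiffE mult_zero_right of_nat_0)
    qed
    also have "\<dots> = B * (\<Sum>P \<in> Pow ?Q. (- 1) ^ card P * int (S P l n ?A'))"
      by (simp add: sum_distrib_left mult.assoc)
    also have "(\<Sum>P \<in> Pow ?Q. (- 1) ^ card P * int (S P l n ?A')) =
      (\<Sum>\<kappa> \<in> {\<kappa> \<in> ?X. inj_on \<kappa> ?V}. int (?w l n ?A' \<kappa>))"
      unfolding sum_injective_maps[OF V X] S_def by simp
    also have "{\<kappa> \<in> ?X. inj_on \<kappa> ?V} = injective_homs K"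
      by (auto simp: injective_homs_def)
    also have "[B * (\<Sum>\<kappa> \<in> injective_homs K. int (?w l n ?A' \<kappa>)) =
      B * (\<Sum>\<kappa> \<in> injective_homs K. Z l n ?A')] (mod int p)"
      by (intro cong_mult cong_refl cong_sum Z es)
    also have "B * (\<Sum>\<kappa> \<in> injective_homs K. Z l n ?A') = (?A * B) * Z l n ?A'" by simp
    also have "[(?A * B) * Z l n ?A' = 1 * Z l n ?A'] (mod int p)"
      by (intro cong_mult cong_refl B)
    finally have "int (?N mod p) = Z l n ?A' mod int p"
      by (simp add: cong_def zmod_int)
    then show ?thesis by (metis nat_int)
  qed
  moreover have "\<forall>(D, k) \<in> set qs. valid_blueprint D"
    using D(1) Ps by (auto simp: qs_def)
  ultimately show thesis using that by blast
qed

section \<open>Chains along a walk and their counts\<close>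

section \<open>Walk gadgets\<close>

text \<open>\<open>link V E x j u v\<close> counts the walks \<open>u, z\<^sub>1, \<dots>, z\<^sub>j, v\<close> such that each \<open>z\<^sub>i\<close> is adjacent to \<open>x i\<close>.\<close>

primrec link :: "'b set \<Rightarrow> ('b \<times> 'b) set \<Rightarrow> (nat \<Rightarrow> 'b) \<Rightarrow> nat \<Rightarrow> 'b \<Rightarrow> 'b \<Rightarrow> nat" where
  "link V E x 0 u v = of_bool ((u, v) \<in> E)"
| "link V E x (Suc j) u v =
    (\<Sum>z \<in> V. of_bool ((x (Suc j), z) \<in> E) * of_bool ((v, z) \<in> E) * link V E x j u z)"

text \<open>
  The fresh vertices are numbered from the far end, so that every edge points to the larger one.
\<close>

primrec chain :: "(nat \<Rightarrow> 'c) \<Rightarrow> nat \<Rightarrow> nat \<Rightarrow> 'c endpoint \<Rightarrow> 'c endpoint \<Rightarrow>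
    ('c endpoint \<times> 'c endpoint) set" where
  "chain x 0 s X Y = {(X, Y)}"
| "chain x (Suc j) s X Y = {(Const (x (Suc j)), Fresh s), (Y, Fresh s)} \<union> chain x j (Suc s) X (Fresh s)"

lemma chain_endpoints:
  "(a, b) \<in> chain x j s X Y \<Longrightarrow>
    {a, b} \<subseteq> {X, Y} \<union> range Const \<union> Fresh ` {s..<s + j}"
proof (induction j arbitrary: s Y)
  case (Suc j)
  from Suc.prems consider "(a, b) = (Const (x (Suc j)), Fresh s)" | "(a, b) = (Y, Fresh s)"
    | "(a, b) \<in> chain x j (Suc s) X (Fresh s)" by auto
  then show ?case
  proof cases
    case 3
    from Suc.IH[OF this] show ?thesis by fastforce
  qed auto
qed auto

lemma finite_chain: "finite (chain x j s X Y)"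
  by (induction j arbitrary: s Y) auto

lemma chain_inner_slots:
  assumes "range x \<subseteq> C" and "X \<in> insert U (Fresh ` {..<s})"
  shows "chain x j (Suc s) X (Fresh s) \<subseteq>
    {(y, Fresh i) | y i. i < Suc s + j \<and> y \<in> insert U (Const ` C \<union> Fresh ` {..<i})}"
  using assms(2)
proof (induction j arbitrary: s)
  case 0
  then show ?case by auto
next
  case (Suc j)
  have "X \<in> insert U (Fresh ` {..<Suc s})" using Suc.prems by auto
  from Suc.IH[OF this] have "chain x j (Suc (Suc s)) X (Fresh (Suc s)) \<subseteq>
    {(y, Fresh i) | y i. i < Suc s + Suc j \<and> y \<in> insert U (Const ` C \<union> Fresh ` {..<i})}"
    by simp
  moreover have "{(Const (x (Suc j)), Fresh (Suc s)), (Fresh s, Fresh (Suc s))} \<subseteq>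
    {(y, Fresh i) | y i. i < Suc s + Suc j \<and> y \<in> insert U (Const ` C \<union> Fresh ` {..<i})}"
    using assms(1) by auto
  ultimately show ?case by simp
qed

text \<open>Used to fix the fresh vertices one at a time: those below \<open>s\<close> already have
  values in \<rho>, the remaining ones are read from \<psi>, shifted to start at 0.\<close>

definition override :: "('c endpoint \<Rightarrow> 'b) \<Rightarrow> nat \<Rightarrow> (nat \<Rightarrow> 'b) \<Rightarrow> 'c endpoint \<Rightarrow> 'b" where
  "override \<rho> s \<psi> x = (case x of Fresh i \<Rightarrow> if s \<le> i then \<psi> (i - s) else \<rho> x | _ \<Rightarrow> \<rho> x)"

lemma sum_PiE_one: "(\<Sum>\<phi> \<in> {..<Suc 0} \<rightarrow>\<^sub>E V. g (\<phi> 0)) = (\<Sum>z \<in> V. g z)"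
  by (rule sum.reindex_bij_witness[where i = "\<lambda>z. \<lambda>i \<in> {..<Suc 0}. z" and j = "\<lambda>\<phi>. \<phi> 0"])
    (auto simp: PiE_iff extensional_def fun_eq_iff)

lemma sum_PiE_Suc:
  fixes g :: "(nat \<Rightarrow> 'b) \<Rightarrow> nat"
  shows "(\<Sum>\<phi> \<in> {..<Suc f} \<rightarrow>\<^sub>E V. g \<phi>) = (\<Sum>z \<in> V. \<Sum>\<psi> \<in> {..<f} \<rightarrow>\<^sub>E V. g (case_nat z \<psi>))"
proof -
  have "(\<Sum>\<phi> \<in> {..<Suc 0 + f} \<rightarrow>\<^sub>E V. g \<phi>) =
    (\<Sum>\<phi> \<in> {..<Suc 0} \<rightarrow>\<^sub>E V. \<Sum>\<psi> \<in> {..<f} \<rightarrow>\<^sub>E V. g (case_nat (\<phi> 0) \<psi>))"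
    unfolding sum_PiE_append
  proof (intro sum.cong[OF refl] arg_cong[where f = g] ext)
    fix \<phi> \<psi> :: "nat \<Rightarrow> 'b" and x
    assume "\<psi> \<in> {..<f} \<rightarrow>\<^sub>E V"
    then show "(if x < Suc 0 then \<phi> x else if x < Suc 0 + f then \<psi> (x - Suc 0) else undefined) = case_nat (\<phi> 0) \<psi> x"
      by (cases x) (auto simp: PiE_iff extensional_def)
  qed
  also have "\<dots> = (\<Sum>z \<in> V. \<Sum>\<psi> \<in> {..<f} \<rightarrow>\<^sub>E V. g (case_nat z \<psi>))"
    by (rule sum_PiE_one)
  finally show ?thesis by simp
qed

text \<open>The induction fixes the fresh vertex next to \<open>Y\<close>, which then becomes the
  end of the shorter chain. This matches the recursion of \<open>link\<close> at the last vertex of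
  the walk.\<close>

lemma sum_chain:
  assumes "\<And>i. X = Fresh i \<Longrightarrow> i < s" "\<And>i. Y = Fresh i \<Longrightarrow> i < s"
  shows "(\<Sum>\<psi> \<in> {..<j} \<rightarrow>\<^sub>E V. of_bool (edges_ok E (override \<rho> s \<psi>) (chain x j s X Y))) =
    link V E (\<lambda>i. \<rho> (Const (x i))) j (\<rho> X) (\<rho> Y)"
  using assms
proof (induction j arbitrary: s Y \<rho>)
  case 0
  have "override \<rho> s \<psi> X = \<rho> X" "override \<rho> s \<psi> Y = \<rho> Y" for \<psi>
    using "0.prems" by (auto simp: override_def split: endpoint.splits)
  then show ?case by (simp add: edges_ok_def)
next
  case (Suc j)
  have val: "override \<rho> s (case_nat z \<psi>) = override (\<rho>(Fresh s := z)) (Suc s) \<psi>" for z and \<psi> :: "nat \<Rightarrow> 'b"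
  proof
    fix x show "override \<rho> s (case_nat z \<psi>) x = override (\<rho>(Fresh s := z)) (Suc s) \<psi> x"
      by (cases x) (auto simp: override_def split: nat.splits intro!: arg_cong[where f = \<psi>])
  qed
  have ends: "override (\<rho>(Fresh s := z)) (Suc s) \<psi> (Fresh s) = z"
    "override (\<rho>(Fresh s := z)) (Suc s) \<psi> Y = \<rho> Y"
    "override (\<rho>(Fresh s := z)) (Suc s) \<psi> (Const c) = \<rho> (Const c)" for z c and \<psi> :: "nat \<Rightarrow> 'b"
    using Suc.prems(2) by (auto simp: override_def split: endpoint.splits)
  have IH: "(\<Sum>\<psi> \<in> {..<j} \<rightarrow>\<^sub>E V. of_bool (edges_ok E (override (\<rho>(Fresh s := z)) (Suc s) \<psi>)
      (chain x j (Suc s) X (Fresh s)))) = link V E (\<lambda>i. \<rho> (Const (x i))) j (\<rho> X) z" for z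
  proof -
    have "X \<noteq> Fresh s" using Suc.prems(1) by blast
    moreover have "X = Fresh i \<Longrightarrow> i < Suc s" for i using Suc.prems(1) less_Suc_eq by blast
    ultimately show ?thesis using Suc.IH[of "Suc s" "Fresh s" "\<rho>(Fresh s := z)"]
      by (simp add: fun_upd_same fun_upd_other del: fun_upd_apply)
  qed
  have "(\<Sum>\<psi> \<in> {..<Suc j} \<rightarrow>\<^sub>E V. of_bool (edges_ok E (override \<rho> s \<psi>) (chain x (Suc j) s X Y))) =
    (\<Sum>z \<in> V. \<Sum>\<psi> \<in> {..<j} \<rightarrow>\<^sub>E V. of_bool (edges_ok E (override (\<rho>(Fresh s := z)) (Suc s) \<psi>)
      (chain x (Suc j) s X Y)) :: nat)"
    unfolding sum_PiE_Suc val ..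
  also have "\<dots> = (\<Sum>z \<in> V. \<Sum>\<psi> \<in> {..<j} \<rightarrow>\<^sub>E V.
      (of_bool ((\<rho> (Const (x (Suc j))), z) \<in> E) * of_bool ((\<rho> Y, z) \<in> E)) *
      of_bool (edges_ok E (override (\<rho>(Fresh s := z)) (Suc s) \<psi>) (chain x j (Suc s) X (Fresh s))))"
    by (intro sum.cong[OF refl]) (simp add: edges_ok_def ends)
  also have "\<dots> = link V E (\<lambda>i. \<rho> (Const (x i))) (Suc j) (\<rho> X) (\<rho> Y)"
    unfolding sum_distrib_left[symmetric] IH by simp
  finally show ?case .
qed

lemma gadget_count_sum:
  assumes "finite V"
  shows "gadget_count V E T f \<kappa> a b = (\<Sum>\<psi> \<in> {..<f} \<rightarrow>\<^sub>E V. of_bool (edges_ok E (value_at \<kappa> a b \<psi>) T))"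
  using assms by (simp add: gadget_count_def finite_PiE Int_def)

lemma value_at_override: "value_at \<kappa> a b \<psi> = override (value_at \<kappa> a b \<psi>') 0 \<psi>"
proof
  fix x show "value_at \<kappa> a b \<psi> x = override (value_at \<kappa> a b \<psi>') 0 \<psi> x"
    by (cases x) (auto simp: override_def)
qed

lemma gadget_count_chain:
  assumes "finite V"
  shows "gadget_count V E (chain x j 0 U W) j \<kappa> a b = link V E (\<kappa> \<circ> x) j a b"
proof -
  have "gadget_count V E (chain x j 0 U W) j \<kappa> a b = (\<Sum>\<psi> \<in> {..<j} \<rightarrow>\<^sub>E V.
    of_bool (edges_ok E (override (value_at \<kappa> a b undefined) 0 \<psi>) (chain x j 0 U W)))"
    unfolding gadget_count_sum[OF assms]
    by (simp only: value_at_override[of \<kappa> a b _ undefined, symmetric])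
  also have "\<dots> = link V E (\<lambda>i. value_at \<kappa> a b undefined (Const (x i))) j
    (value_at \<kappa> a b undefined U) (value_at \<kappa> a b undefined W)"
    by (rule sum_chain) simp_all
  finally show ?thesis by (simp add: comp_def)
qed

text \<open>\<open>Fresh 0\<close> is a rival of \<open>U\<close>: both are adjacent to the base
  point \<open>x 0\<close>. One chain leads from \<open>U\<close> to it and the other one from it to
  \<open>U\<close>.\<close>

definition selector :: "(nat \<Rightarrow> 'c) \<Rightarrow> nat \<Rightarrow> ('c endpoint \<times> 'c endpoint) set" where
  "selector x j = {(Const (x 0), U), (Const (x 0), Fresh 0)} \<union>
    chain x j 1 U (Fresh 0) \<union> chain x j (1 + j) (Fresh 0) U"

lemma gadget_count_selector:
  assumes V: "finite V"
  shows "gadget_count V E (selector x j) (Suc (j + j)) \<kappa> a b = (\<Sum>z \<in> V.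
    of_bool ((\<kappa> (x 0), a) \<in> E) * of_bool ((\<kappa> (x 0), z) \<in> E) *
    (link V E (\<kappa> \<circ> x) j a z * link V E (\<kappa> \<circ> x) j z a))"
proof -
  let ?\<rho> = "\<lambda>z. (value_at \<kappa> a b undefined)(Fresh 0 := z)"
  have val: "value_at \<kappa> a b (case_nat z \<psi>) = override (?\<rho> z) 1 \<psi>" for z \<psi>
  proof
    fix y show "value_at \<kappa> a b (case_nat z \<psi>) y = override (?\<rho> z) 1 \<psi> y"
      by (cases y) (auto simp: override_def split: nat.splits)
  qed
  let ?j = "\<lambda>\<psi>1 \<psi>2 i. if i < j then \<psi>1 i else if i < j + j then \<psi>2 (i - j) else undefined"
  have split: "edges_ok E (override (?\<rho> z) 1 (?j \<psi>1 \<psi>2)) (selector x j) \<longleftrightarrow>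
      (\<kappa> (x 0), a) \<in> E \<and> (\<kappa> (x 0), z) \<in> E \<and>
      edges_ok E (override (?\<rho> z) 1 \<psi>1) (chain x j 1 U (Fresh 0)) \<and>
      edges_ok E (override (?\<rho> z) (1 + j) \<psi>2) (chain x j (1 + j) (Fresh 0) U)" for z \<psi>1 \<psi>2
  proof -
    have "override (?\<rho> z) 1 (?j \<psi>1 \<psi>2) y = override (?\<rho> z) 1 \<psi>1 y"
      if "y \<in> {U, Fresh 0} \<union> range Const \<union> Fresh ` {1..<1 + j}" for y
      using that by (auto simp: override_def)
    then have 1: "edges_ok E (override (?\<rho> z) 1 (?j \<psi>1 \<psi>2)) (chain x j 1 U (Fresh 0)) \<longleftrightarrow>
      edges_ok E (override (?\<rho> z) 1 \<psi>1) (chain x j 1 U (Fresh 0))"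
      using chain_endpoints[of _ _ x j 1 U "Fresh 0"] by (intro edges_ok_cong) blast
    have "override (?\<rho> z) 1 (?j \<psi>1 \<psi>2) y = override (?\<rho> z) (1 + j) \<psi>2 y"
      if "y \<in> {Fresh 0, U} \<union> range Const \<union> Fresh ` {1 + j..<1 + j + j}" for y
      using that by (auto simp: override_def)
    then have 2: "edges_ok E (override (?\<rho> z) 1 (?j \<psi>1 \<psi>2)) (chain x j (1 + j) (Fresh 0) U) \<longleftrightarrow>
      edges_ok E (override (?\<rho> z) (1 + j) \<psi>2) (chain x j (1 + j) (Fresh 0) U)"
      using chain_endpoints[of _ _ x j "1 + j" "Fresh 0" U] by (intro edges_ok_cong) blast
    have "edges_ok E (override (?\<rho> z) 1 (?j \<psi>1 \<psi>2)) {(Const (x 0), U), (Const (x 0), Fresh 0)} \<longleftrightarrow>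
      (\<kappa> (x 0), a) \<in> E \<and> (\<kappa> (x 0), z) \<in> E"
      by (simp add: edges_ok_def override_def)
    then show ?thesis unfolding selector_def edges_ok_Un 1 2 by blast
  qed
  have "gadget_count V E (selector x j) (Suc (j + j)) \<kappa> a b =
    (\<Sum>z \<in> V. \<Sum>\<psi>1 \<in> {..<j} \<rightarrow>\<^sub>E V. \<Sum>\<psi>2 \<in> {..<j} \<rightarrow>\<^sub>E V.
      of_bool ((\<kappa> (x 0), a) \<in> E) * of_bool ((\<kappa> (x 0), z) \<in> E) *
      (of_bool (edges_ok E (override (?\<rho> z) 1 \<psi>1) (chain x j 1 U (Fresh 0))) *
      of_bool (edges_ok E (override (?\<rho> z) (1 + j) \<psi>2) (chain x j (1 + j) (Fresh 0) U))))"
    unfolding gadget_count_sum[OF V] sum_PiE_Suc val sum_PiE_append split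
    by (simp add: of_bool_conj mult.assoc)
  also have "\<dots> = (\<Sum>z \<in> V. of_bool ((\<kappa> (x 0), a) \<in> E) * of_bool ((\<kappa> (x 0), z) \<in> E) *
      ((\<Sum>\<psi>1 \<in> {..<j} \<rightarrow>\<^sub>E V. of_bool (edges_ok E (override (?\<rho> z) 1 \<psi>1) (chain x j 1 U (Fresh 0)))) *
      (\<Sum>\<psi>2 \<in> {..<j} \<rightarrow>\<^sub>E V. of_bool (edges_ok E (override (?\<rho> z) (1 + j) \<psi>2) (chain x j (1 + j) (Fresh 0) U)))))"
    by (simp only: sum_distrib_left[symmetric] sum_distrib_right[symmetric])
  also have "\<dots> = (\<Sum>z \<in> V. of_bool ((\<kappa> (x 0), a) \<in> E) * of_bool ((\<kappa> (x 0), z) \<in> E) *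
    (link V E (\<kappa> \<circ> x) j a z * link V E (\<kappa> \<circ> x) j z a))"
  proof -
    have 1: "(\<Sum>\<psi>1 \<in> {..<j} \<rightarrow>\<^sub>E V. of_bool (edges_ok E (override (?\<rho> z) 1 \<psi>1) (chain x j 1 U (Fresh 0)))) =
      link V E (\<lambda>i. ?\<rho> z (Const (x i))) j (?\<rho> z U) (?\<rho> z (Fresh 0))" for z
      by (rule sum_chain) simp_all
    have 2: "(\<Sum>\<psi>2 \<in> {..<j} \<rightarrow>\<^sub>E V. of_bool (edges_ok E (override (?\<rho> z) (1 + j) \<psi>2) (chain x j (1 + j) (Fresh 0) U))) =
      link V E (\<lambda>i. ?\<rho> z (Const (x i))) j (?\<rho> z (Fresh 0)) (?\<rho> z U)" for z
      by (rule sum_chain) simp_all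
    show ?thesis unfolding 1 2 by (simp add: comp_def)
  qed
  finally show ?thesis .
qed

section \<open>Walk counts modulo p in the absence of 4-cycles\<close>

section \<open>Square-free graphs\<close>

locale sqfree_graph =
  fixes V :: "'a set" and E :: "('a \<times> 'a) set"
  assumes finite_V: "finite V"
    and E_V: "(x, y) \<in> E \<Longrightarrow> x \<in> V \<and> y \<in> V"
    and sym_E: "(x, y) \<in> E \<Longrightarrow> (y, x) \<in> E"
    and irrefl_E: "(x, x) \<notin> E"
    and no_square: "(a, u) \<in> E \<Longrightarrow> (a, v) \<in> E \<Longrightarrow> (b, u) \<in> E \<Longrightarrow> (b, v) \<in> E \<Longrightarrow> u \<noteq> v \<Longrightarrow> a = b"
begin

definition nb :: "'a \<Rightarrow> 'a set" where
  "nb x = {y. (x, y) \<in> E}"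

lemma nb_iff [simp]: "y \<in> nb x \<longleftrightarrow> (x, y) \<in> E"
  by (simp add: nb_def)

lemma nb_subset: "nb x \<subseteq> V"
  using E_V by auto

lemma finite_nb: "finite (nb x)"
  using finite_subset[OF nb_subset finite_V] .

definition nb_walk :: "nat \<Rightarrow> (nat \<Rightarrow> 'a) \<Rightarrow> nat \<Rightarrow> bool" where
  "nb_walk p x k \<longleftrightarrow> 0 < k \<and> (\<forall>i<k. (x i, x (Suc i)) \<in> E) \<and>
    (\<forall>i. Suc (Suc i) \<le> k \<longrightarrow> x i \<noteq> x (Suc (Suc i))) \<and>
    (\<forall>i. 0 < i \<and> i < k \<longrightarrow> [card (nb (x i)) = 1] (mod p))"

text \<open>In the induction step the last vertex z ranges over the common neighbours of
  \<open>x (Suc j)\<close> and \<open>v\<close>. If these two differ, the only one is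
  \<open>x (Suc (Suc j))\<close>, which is not \<open>x j\<close>, so only the test
  \<open>u = x 1\<close> survives. If they are equal, z runs through all neighbours of
  \<open>x (Suc j)\<close>: for \<open>u = x 1\<close> their number is 1 modulo \<open>p\<close>,
  and otherwise \<open>z = x j\<close> alone contributes. In the base case an edge avoiding both
  \<open>x 1\<close> and \<open>x 0\<close> would close a square.\<close>

lemma link_cong:
  assumes x: "nb_walk p x k" and "j < k" and "u \<in> nb (x 0)" and "v \<in> nb (x (Suc j))"
  shows "[link V E x j u v = of_bool (u = x 1 \<or> v = x j)] (mod p)"
  using assms(2,4)
proof (induction j arbitrary: v)
  case 0
  have e: "(x 0, x 1) \<in> E" using x by (simp add: nb_walk_def)
  have "(u, v) \<in> E \<longleftrightarrow> u = x 1 \<or> v = x 0"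
  proof
    assume uv: "(u, v) \<in> E"
    show "u = x 1 \<or> v = x 0"
    proof (rule ccontr)
      assume n: "\<not> ?thesis"
      have "v = x 0"
        using no_square[of v u "x 1" "x 0"] uv e assms(3) "0.prems"(2) n sym_E by auto
      then show False using n by simp
    qed
  qed (use "0.prems" assms(3) e sym_E in auto)
  then show ?case by simp
next
  case (Suc j)
  have adj: "(x j, x (Suc j)) \<in> E" "(x (Suc j), x (Suc (Suc j))) \<in> E" and ne: "x j \<noteq> x (Suc (Suc j))"
    and deg: "[card (nb (x (Suc j))) = 1] (mod p)"
    using x Suc.prems(1) by (auto simp: nb_walk_def)
  have IH: "[link V E x j u z = of_bool (u = x 1 \<or> z = x j)] (mod p)" if "(x (Suc j), z) \<in> E" for z
    using Suc.IH[of z] Suc.prems(1) that by simp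
  let ?S = "{z \<in> nb (x (Suc j)). (v, z) \<in> E}"
  have "link V E x (Suc j) u v = (\<Sum>z \<in> ?S. link V E x j u z)"
    using finite_V E_V by (auto simp: of_bool_conj[symmetric] intro!: sum.mono_neutral_cong_right)
  also have "[\<dots> = (\<Sum>z \<in> ?S. of_bool (u = x 1 \<or> z = x j))] (mod p)"
    by (intro cong_sum IH) auto
  also have "[(\<Sum>z \<in> ?S. of_bool (u = x 1 \<or> z = x j)) = (of_bool (u = x 1 \<or> v = x (Suc j)) :: nat)] (mod p)"
  proof (cases "v = x (Suc j)")
    case False
    have "?S = {x (Suc (Suc j))}"
      using no_square[of v _ "x (Suc (Suc j))" "x (Suc j)"] False Suc.prems(2) adj sym_E by auto
    then show ?thesis using False ne by auto
  next
    case True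
    then have S: "?S = nb (x (Suc j))" by auto
    have "x j \<in> nb (x (Suc j))" using adj sym_E by simp
    show ?thesis
    proof (cases "u = x 1")
      case u: True
      show ?thesis unfolding S using True u deg by simp
    next
      case u: False
      have "(\<Sum>z \<in> nb (x (Suc j)). of_bool (z = x j) :: nat) = 1"
        using \<open>x j \<in> nb (x (Suc j))\<close> finite_nb[of "x (Suc j)"] by (simp add: of_bool_def sum.delta)
      then show ?thesis unfolding S using True u by simp
    qed
  qed
  finally show ?case .
qed

end

section \<open>From spin sums to weighted independent sets\<close>

section \<open>The partition function of the independent sets\<close>

definition bis_sum :: "int \<Rightarrow> int \<Rightarrow> nat \<Rightarrow> nat \<Rightarrow> (nat \<times> nat) set \<Rightarrow> int" where
  "bis_sum lam1 lam2 l n A = (\<Sum>I \<in> {I \<in> Pow {..<n}. \<forall>(u, w) \<in> A. \<not> (u \<in> I \<and> w \<in> I)}.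
    lam1 ^ card ({..<l} \<inter> I) * lam2 ^ card ({l..<n} \<inter> I))"

lemma prod_of_bool: "finite A \<Longrightarrow> (\<Prod>i \<in> A. of_bool (P i)) = (of_bool (\<forall>i \<in> A. P i) :: nat)"
  by (induction A rule: finite_induct) auto

lemma card_choices_outside:
  fixes S :: "nat \<Rightarrow> 'b set"
  assumes "I \<subseteq> {..<n}" and "\<And>i. i < n \<Longrightarrow> finite (S i) \<and> c i \<in> S i"
  shows "card {a \<in> PiE {..<n} S. {i \<in> {..<n}. a i \<noteq> c i} = I} = (\<Prod>i \<in> I. card (S i) - 1)"
proof -
  have "{a \<in> PiE {..<n} S. {i \<in> {..<n}. a i \<noteq> c i} = I} = PiE {..<n} (\<lambda>i. if i \<in> I then S i - {c i} else {c i})"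
    (is "?L = ?R")
  proof (intro set_eqI iffI)
    fix a assume "a \<in> ?L"
    then have "a \<in> extensional {..<n}" "\<And>i. i < n \<Longrightarrow> a i \<in> S i" "I = {i \<in> {..<n}. a i \<noteq> c i}"
      by (auto simp: PiE_iff)
    then show "a \<in> ?R" by (simp add: PiE_iff)
  next
    fix a assume "a \<in> ?R"
    then have a: "a \<in> extensional {..<n}" "\<And>i. i < n \<Longrightarrow> a i \<in> (if i \<in> I then S i - {c i} else {c i})"
      by (auto simp: PiE_iff)
    have "a i \<in> S i \<and> (a i \<noteq> c i \<longleftrightarrow> i \<in> I)" if "i < n" for i
      using a(2)[OF that] assms(2)[OF that] by (cases "i \<in> I") auto
    then show "a \<in> ?L" using a(1) assms(1) by (auto simp: PiE_iff)
  qed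
  then have "card {a \<in> PiE {..<n} S. {i \<in> {..<n}. a i \<noteq> c i} = I} =
    (\<Prod>i<n. card (if i \<in> I then S i - {c i} else {c i}))"
    by (simp add: card_PiE)
  also have "\<dots> = (\<Prod>i<n. if i \<in> I then card (S i) - 1 else 1)"
    using assms(2) by (intro prod.cong) (auto simp: card_Diff_singleton)
  also have "\<dots> = (\<Prod>i \<in> {..<n} \<inter> I. card (S i) - 1)"
    by (rule prod.inter_restrict[symmetric]) simp
  finally show ?thesis using assms(1) by (simp add: Int_absorb1)
qed

text \<open>Modulo \<open>p\<close> only maps into \<open>SL\<close> on the left and
  \<open>SR\<close> on the right survive. They are grouped by the set of vertices where they differ
  from \<open>cL\<close> or \<open>cR\<close>. The edge gadgets require this set to be independent,
  and each of its members can take \<open>card SL - 1\<close> or \<open>card SR - 1\<close> values,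
  which explains the two weights.\<close>

lemma bis_weight_cong_bis_sum:
  fixes p :: nat
  assumes V: "finite V" and SL: "SL \<subseteq> V" "cL \<in> SL" and SR: "SR \<subseteq> V" "cR \<in> SR"
    and es: "bis_edge_list l n es"
    and TL: "\<And>a. a \<in> V \<Longrightarrow> [gadget_count V E TL f \<kappa> a a = of_bool (a \<in> SL)] (mod p)"
    and TR: "\<And>a. a \<in> V \<Longrightarrow> [gadget_count V E TR f \<kappa> a a = of_bool (a \<in> SR)] (mod p)"
    and TE: "\<And>a b. a \<in> SL \<Longrightarrow> b \<in> SR \<Longrightarrow>
      [gadget_count V E TE g \<kappa> a b = of_bool (a = cL \<or> b = cR)] (mod p)"
  shows "[int (bis_weight V E TL TR f TE g l n (set es) \<kappa>) =
    bis_sum (int (card SL) - 1) (int (card SR) - 1) l n (set es)] (mod int p)"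
proof -
  let ?S = "\<lambda>i. if i < l then SL else SR"
  let ?c = "\<lambda>i. if i < l then cL else cR"
  let ?T = "\<lambda>i. if i < l then TL else TR"
  let ?A = "set es"
  let ?ind = "\<lambda>I. \<forall>(u, w) \<in> ?A. \<not> (u \<in> I \<and> w \<in> I)"
  let ?out = "\<lambda>a. {i \<in> {..<n}. a i \<noteq> ?c i}"
  have A: "u < l \<and> l \<le> w \<and> w < n \<and> l \<le> n" if "(u, w) \<in> ?A" for u w
    using es that by (auto simp: bis_edge_list_def)
  have "l \<le> n" using es by (simp add: bis_edge_list_def)
  have S: "finite (?S i) \<and> ?c i \<in> ?S i" for i
    using SL SR V finite_subset by auto
  have PS: "PiE {..<n} ?S \<subseteq> {..<n} \<rightarrow>\<^sub>E V" using SL(1) SR(1) by (intro PiE_mono) auto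
  have "[bis_weight V E TL TR f TE g l n ?A \<kappa> = (\<Sum>a \<in> {..<n} \<rightarrow>\<^sub>E V.
    of_bool (a \<in> PiE {..<n} ?S) * of_bool (?ind (?out a)))] (mod p)"
    unfolding bis_weight_def
  proof (rule cong_sum)
    fix a assume a: "a \<in> {..<n} \<rightarrow>\<^sub>E V"
    have "[(\<Prod>i<n. gadget_count V E (?T i) f \<kappa> (a i) (a i)) = (\<Prod>i<n. of_bool (a i \<in> ?S i))] (mod p)"
    proof (rule cong_prod)
      fix i assume "i \<in> {..<n}"
      then have "a i \<in> V" using a by auto
      then show "[gadget_count V E (?T i) f \<kappa> (a i) (a i) = of_bool (a i \<in> ?S i)] (mod p)"
        using TL TR by (cases "i < l") simp_all
    qed
    also have "(\<Prod>i<n. of_bool (a i \<in> ?S i)) = (of_bool (a \<in> PiE {..<n} ?S) :: nat)"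
      using a by (simp only: prod_of_bool PiE_iff finite_lessThan simp_thms)
    finally have 1: "[(\<Prod>i<n. gadget_count V E (?T i) f \<kappa> (a i) (a i)) = of_bool (a \<in> PiE {..<n} ?S)] (mod p)" .
    show "[(\<Prod>i<n. gadget_count V E (?T i) f \<kappa> (a i) (a i)) *
        (\<Prod>(u, w) \<in> ?A. gadget_count V E TE g \<kappa> (a u) (a w)) =
      of_bool (a \<in> PiE {..<n} ?S) * of_bool (?ind (?out a))] (mod p)"
    proof (cases "a \<in> PiE {..<n} ?S")
      case False
      then have "[(\<Prod>i<n. gadget_count V E (?T i) f \<kappa> (a i) (a i)) = 0] (mod p)" using 1 by simp
      from cong_mult[OF this cong_refl] show ?thesis using False by simp
    next
      case True
      have aS: "a i \<in> ?S i" if "i < n" for i using True that by (auto simp: PiE_iff)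
      have "[(\<Prod>(u, w) \<in> ?A. gadget_count V E TE g \<kappa> (a u) (a w)) =
        (\<Prod>(u, w) \<in> ?A. of_bool (a u = cL \<or> a w = cR))] (mod p)"
      proof (rule cong_prod, clarify)
        fix u w assume "(u, w) \<in> ?A"
        then have "u < l" "l \<le> w" "u < n" "w < n" using A by fastforce+
        then show "[gadget_count V E TE g \<kappa> (a u) (a w) = of_bool (a u = cL \<or> a w = cR)] (mod p)"
          using aS[of u] aS[of w] by (intro TE) auto
      qed
      also have "(\<Prod>(u, w) \<in> ?A. of_bool (a u = cL \<or> a w = cR)) = (of_bool (\<forall>(u, w) \<in> ?A. a u = cL \<or> a w = cR) :: nat)"
        by (subst prod_of_bool[OF finite_set, symmetric]) (auto intro!: prod.cong)
      also have "(\<forall>(u, w) \<in> ?A. a u = cL \<or> a w = cR) \<longleftrightarrow> ?ind (?out a)"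
      proof (intro ball_cong refl)
        fix e assume "e \<in> ?A"
        then show "(case e of (u, w) \<Rightarrow> a u = cL \<or> a w = cR) \<longleftrightarrow>
          (case e of (u, w) \<Rightarrow> \<not> (u \<in> ?out a \<and> w \<in> ?out a))"
          using A[of "fst e" "snd e"] by (auto split: prod.splits)
      qed
      finally show ?thesis using cong_mult[OF 1] True by blast
    qed
  qed
  also have "(\<Sum>a \<in> {..<n} \<rightarrow>\<^sub>E V. of_bool (a \<in> PiE {..<n} ?S) * of_bool (?ind (?out a))) =
    (\<Sum>a \<in> PiE {..<n} ?S. of_bool (?ind (?out a)) :: nat)"
    using V PS by (intro sum.mono_neutral_cong_right) (auto simp: finite_PiE)
  also have "\<dots> = (\<Sum>I \<in> Pow {..<n}. \<Sum>a \<in> {a \<in> PiE {..<n} ?S. ?out a = I}. of_bool (?ind (?out a)))"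
    using V S by (intro sum.group[symmetric]) (auto simp: finite_PiE)
  also have "\<dots> = (\<Sum>I \<in> Pow {..<n}. of_bool (?ind I) * card {a \<in> PiE {..<n} ?S. ?out a = I})"
    by (intro sum.cong[OF refl]) simp
  also have "\<dots> = (\<Sum>I \<in> Pow {..<n}. of_bool (?ind I) * (\<Prod>i \<in> I. card (?S i) - 1))"
  proof (intro sum.cong[OF refl] arg_cong2[where f = "(*)"])
    fix I assume "I \<in> Pow {..<n}"
    then show "card {a \<in> PiE {..<n} ?S. ?out a = I} = (\<Prod>i \<in> I. card (?S i) - 1)"
      using S by (intro card_choices_outside) auto
  qed (rule refl)
  also have "\<dots> = (\<Sum>I \<in> {I \<in> Pow {..<n}. ?ind I}. \<Prod>i \<in> I. card (?S i) - 1)"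
    by (intro sum.mono_neutral_cong_right) auto
  finally have 2: "[bis_weight V E TL TR f TE g l n ?A \<kappa> =
    (\<Sum>I \<in> {I \<in> Pow {..<n}. ?ind I}. \<Prod>i \<in> I. card (?S i) - 1)] (mod p)" .
  have "int (\<Prod>i \<in> I. card (?S i) - 1) = (int (card SL) - 1) ^ card ({..<l} \<inter> I) * (int (card SR) - 1) ^ card ({l..<n} \<inter> I)"
    if "I \<subseteq> {..<n}" for I
  proof -
    have fin: "finite I" using that finite_subset by blast
    \<comment> \<open>The distinguished elements make both sets nonempty, so truncated subtraction
      agrees with that of the integers.\<close>
    have pos: "card SL \<ge> 1" "card SR \<ge> 1" using S[of 0] SL SR V finite_subset
      by (metis One_nat_def Suc_leI card_gt_0_iff empty_iff)+
    have I: "I = ({..<l} \<inter> I) \<union> ({l..<n} \<inter> I)" using that by auto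
    have "(\<Prod>i \<in> I. card (?S i) - 1) = (\<Prod>i \<in> {..<l} \<inter> I. card (?S i) - 1) * (\<Prod>i \<in> {l..<n} \<inter> I. card (?S i) - 1)"
      by (subst I, subst prod.union_disjoint) (use fin in auto)
    also have "\<dots> = (card SL - 1) ^ card ({..<l} \<inter> I) * (card SR - 1) ^ card ({l..<n} \<inter> I)"
      by simp
    finally show ?thesis using pos by (simp add: of_nat_diff)
  qed
  then have "int (\<Sum>I \<in> {I \<in> Pow {..<n}. ?ind I}. \<Prod>i \<in> I. card (?S i) - 1) =
    bis_sum (int (card SL) - 1) (int (card SR) - 1) l n ?A"
    unfolding bis_sum_def of_nat_sum by (intro sum.cong[OF refl]) auto
  then show ?thesis using 2 by (simp add: cong_int_iff[symmetric])
qed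

section \<open>Orbit counting modulo a prime and Cauchy's theorem\<close>

section \<open>Actions of order \<open>p\<close>\<close>

lemma funpow_mult_fixed: "(f ^^ n) x = x \<Longrightarrow> (f ^^ (n * k)) x = x"
  by (induction k) (auto simp: funpow_add)

lemma funpow_coprime_fixed:
  fixes d p :: nat
  assumes "(f ^^ p) x = x" "(f ^^ d) x = x" "coprime d p" "0 < d"
  shows "f x = x"
proof -
  obtain a b where "d * a = p * b + gcd d p" using bezout_nat[of d p] assms(4) by auto
  then have "d * a = p * b + 1" using assms(3) by simp
  then have "(f ^^ (d * a)) x = f ((f ^^ (p * b)) x)" by simp
  then show ?thesis using funpow_mult_fixed[OF assms(1), of b] funpow_mult_fixed[OF assms(2), of a] by simp
qed

text \<open>The induction removes the orbit of a point that is not fixed. Its first \<open>p\<close>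
  iterates are distinct: a coincidence gives an exponent below \<open>p\<close>, hence coprime to
  \<open>p\<close>, that fixes some iterate. Then \<open>g\<close> itself fixes this iterate, and
  following the cycle back to the start, it fixes the point.\<close>

lemma card_cong_fixed_points:
  assumes p: "prime p" and "finite X" and "\<And>x. x \<in> X \<Longrightarrow> g x \<in> X \<and> (g ^^ p) x = x"
  shows "[card X = card {x \<in> X. g x = x}] (mod p)"
  using assms(2,3)
proof (induction "card X" arbitrary: X rule: less_induct)
  case less
  show ?case
  proof (cases "\<forall>x \<in> X. g x = x")
    case True
    then have "{x \<in> X. g x = x} = X" by auto
    then show ?thesis by simp
  next
    case False
    then obtain x where x: "x \<in> X" "g x \<noteq> x" by blast
    have p0: "0 < p" using p by (rule prime_gt_0_nat)
    let ?O = "(\<lambda>i. (g ^^ i) x) ` {..<p}"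
    have step: "(g ^^ (i mod p)) x = (g ^^ i) x" for i
    proof -
      have "(g ^^ i) x = (g ^^ (i mod p + p * (i div p))) x" by simp
      also have "\<dots> = (g ^^ (i mod p)) ((g ^^ (p * (i div p))) x)" by (simp only: funpow_add comp_apply)
      also have "(g ^^ (p * (i div p))) x = x"
        using less.prems(2)[OF x(1)] by (intro funpow_mult_fixed) simp
      finally show ?thesis by simp
    qed
    have all: "(g ^^ i) x \<in> ?O" for i
      using step[of i] p0 by (metis imageI lessThan_iff mod_less_divisor)
    have iter: "(g ^^ i) y \<in> X" if "y \<in> X" for i y
      using that less.prems(2) by (induction i) auto
    have not_fixed: "g y \<noteq> y" if y: "y \<in> ?O" for y
    proof
      assume gy: "g y = y"
      obtain i where i: "y = (g ^^ i) x" "i < p" using y by auto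
      have "(g ^^ j) y = y" for j using gy by (induction j) auto
      from this[of "p - i"] have "y = (g ^^ (p - i + i)) x" by (simp only: i(1) funpow_add comp_apply)
      then have "y = x" using i less.prems(2)[OF x(1)] by simp
      then show False using gy x by simp
    qed
    have inj: "inj_on (\<lambda>i. (g ^^ i) x) {..<p}"
    proof (rule linorder_inj_onI)
      fix i j :: nat assume ij: "i < j" "j \<in> {..<p}"
      show "(g ^^ i) x \<noteq> (g ^^ j) x"
      proof
        assume eq: "(g ^^ i) x = (g ^^ j) x"
        let ?y = "(g ^^ i) x"
        have "(g ^^ (j - i)) ?y = (g ^^ (j - i + i)) x" by (simp only: funpow_add comp_apply)
        then have 1: "(g ^^ (j - i)) ?y = ?y" using ij eq by simp
        have 2: "(g ^^ p) ?y = ?y" using less.prems(2) iter[OF x(1)] by simp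
        have "\<not> p dvd j - i" using ij by (auto dest: dvd_imp_le)
        then have "coprime (j - i) p" using p by (metis coprime_commute prime_imp_coprime)
        from funpow_coprime_fixed[OF 2 1 this] have "g ?y = ?y" using ij by simp
        moreover have "?y \<in> ?O" by (rule all)
        ultimately show False using not_fixed by blast
      qed
    qed auto
    have cO: "card ?O = p" using card_image[OF inj] by simp
    have OX: "?O \<subseteq> X" using iter[OF x(1)] by auto
    have card: "card X = p + card (X - ?O)"
      using less.prems(1) OX cO card_mono[OF less.prems(1) OX] finite_subset[OF OX less.prems(1)]
      by (simp add: card_Diff_subset)
    have closed: "g y \<in> X - ?O \<and> (g ^^ p) y = y" if y: "y \<in> X - ?O" for y
    proof -
      \<comment> \<open>On \<open>X\<close> the map \<open>g\<close> is undone by its power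
        \<open>p - 1\<close>, so an image in the orbit would put \<open>y\<close> itself into the
        orbit.\<close>
      have "g y \<notin> ?O"
      proof
        assume "g y \<in> ?O"
        then obtain i where "g y = (g ^^ i) x" by auto
        then have "(g ^^ (p - 1)) (g y) = (g ^^ (p - 1 + i)) x" by (simp only: funpow_add comp_apply)
        moreover have "(g ^^ (p - 1)) (g y) = (g ^^ Suc (p - 1)) y" by (simp only: funpow_Suc_right comp_apply)
        ultimately have "y = (g ^^ (p - 1 + i)) x" using less.prems(2)[of y] y p0 by simp
        then show False using all y by blast
      qed
      then show ?thesis using less.prems(2) y by auto
    qed
    have "[card (X - ?O) = card {y \<in> X - ?O. g y = y}] (mod p)"
      using less.prems(1) closed card p0 by (intro less.hyps) auto
    moreover have "{y \<in> X - ?O. g y = y} = {y \<in> X. g y = y}" using not_fixed by auto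
    ultimately show ?thesis unfolding card by (simp add: cong_def)
  qed
qed

text \<open>McKay's proof of Cauchy's theorem.\<close>

lemma cauchy_functions:
  fixes A :: "('a \<Rightarrow> 'a) set"
  assumes p: "prime p" and A: "finite A" "id \<in> A" "\<And>f g. f \<in> A \<Longrightarrow> g \<in> A \<Longrightarrow> f \<circ> g \<in> A"
    "\<And>f. f \<in> A \<Longrightarrow> bij f \<and> inv f \<in> A" and dvd: "p dvd card A"
  shows "\<exists>f \<in> A. f \<noteq> id \<and> f ^^ p = id"
proof -
  let ?c = "\<lambda>xs. foldr (\<circ>) xs id"
  let ?X = "{xs. length xs = p \<and> set xs \<subseteq> A \<and> ?c xs = id}"
  have p0: "0 < p" using p by (rule prime_gt_0_nat)
  have cA: "?c xs \<in> A" if "set xs \<subseteq> A" for xs using that A by (induction xs) auto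
  have c_append: "?c (xs @ [x]) = ?c xs \<circ> x" for xs x by (induction xs) (auto simp: comp_assoc)
  have rot: "rotate1 xs \<in> ?X \<and> (rotate1 ^^ p) xs = xs" if xs: "xs \<in> ?X" for xs
  proof -
    obtain x ys where x: "xs = x # ys" using xs p0 by (cases xs) auto
    have xA: "bij x" using xs x A by auto
    have "x \<circ> ?c ys = id" using xs x by auto
    then have "inv x \<circ> (x \<circ> ?c ys) = inv x" by simp
    then have "?c ys = inv x" using xA by (simp add: comp_assoc[symmetric] bij_is_inj)
    then have "?c (rotate1 xs) = id"
      using xA c_append[of ys x] unfolding x rotate1.simps by (simp only: inv_o_cancel bij_is_inj)
    moreover have "(rotate1 ^^ p) xs = xs" using xs rotate_id[of p xs] by (auto simp: rotate_def)
    ultimately show ?thesis using xs by auto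
  qed
  \<comment> \<open>All entries but the first are free, and they determine the first as the inverse
    of their product.\<close>
  have "bij_betw tl ?X {ys. set ys \<subseteq> A \<and> length ys = p - 1}"
  proof (rule bij_betwI[where g = "\<lambda>ys. inv (?c ys) # ys"])
    show "tl \<in> ?X \<rightarrow> {ys. set ys \<subseteq> A \<and> length ys = p - 1}" 
      by (auto split: list.splits) (metis list.sel(2) list.set_sel(2) subsetD)
    show "(\<lambda>ys. inv (?c ys) # ys) \<in> {ys. set ys \<subseteq> A \<and> length ys = p - 1} \<rightarrow> ?X"
      using cA A p0 by (auto simp: bij_is_inj)
    show "inv (?c (tl xs)) # tl xs = xs" if xs: "xs \<in> ?X" for xs
    proof -
      obtain x ys where x: "xs = x # ys" using xs p0 by (cases xs) auto
      have "bij (?c ys)" using cA[of ys] A xs x by auto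
      moreover have "x \<circ> ?c ys = id" using xs x by auto
      ultimately have "x = inv (?c ys)"
        by (metis bij_is_surj comp_assoc comp_id id_comp surj_iff)
      then show ?thesis by (simp add: x)
    qed
  qed simp
  then have "card ?X = card A ^ (p - 1)"
    using card_lists_length_eq[OF A(1)] bij_betw_same_card by fastforce
  moreover have "0 < p - 1" using prime_gt_1_nat[OF p] by simp
  ultimately have "p dvd card ?X" using dvd by (simp add: dvd_power_iff dvd_trans[OF dvd dvd_power])
  moreover have fin: "finite ?X" by (rule finite_subset[OF _ finite_lists_length_eq[OF A(1), of p]]) auto
  ultimately have "p dvd card {xs \<in> ?X. rotate1 xs = xs}"
    using card_cong_fixed_points[OF p fin rot] by (metis (no_types, lifting) cong_dvd_iff)
  moreover have idX: "replicate p id \<in> {xs \<in> ?X. rotate1 xs = xs}"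
  proof -
    have "?c (replicate n id) = id" for n by (induction n) auto
    moreover have "rotate1 (replicate p (id :: 'a \<Rightarrow> 'a)) = replicate p id"
      by (cases p) (auto simp: replicate_append_same)
    ultimately show ?thesis using A(2) by auto
  qed
  moreover have fin': "finite {xs \<in> ?X. rotate1 xs = xs}" by (rule finite_subset[OF _ fin]) blast
  ultimately have "card {xs \<in> ?X. rotate1 xs = xs} \<ge> p"
    by (metis (no_types, lifting) card_gt_0_iff dvd_imp_le empty_iff)
  then have "card {xs \<in> ?X. rotate1 xs = xs} > 1" using prime_gt_1_nat[OF p] by linarith
  then have "\<not> {xs \<in> ?X. rotate1 xs = xs} \<subseteq> {replicate p id}"
    using card_mono[of "{replicate p id}" "{xs \<in> ?X. rotate1 xs = xs}"] by auto
  then obtain xs where xs: "xs \<in> ?X" "rotate1 xs = xs" "xs \<noteq> replicate p id" by blast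
  obtain x ys where x: "xs = x # ys" using xs p0 by (cases xs) auto
  have fix_replicate: "zs = replicate (length zs) z" if "zs @ [z] = z # zs" for zs :: "('a \<Rightarrow> 'a) list" and z
    using that by (induction zs) auto
  have "xs = replicate p x" using fix_replicate[of ys x] xs x by auto
  moreover have "?c (replicate n x) = x ^^ n" for n by (induction n) auto
  ultimately have "x ^^ p = id" using xs by auto
  moreover have "x \<noteq> id" using xs \<open>xs = replicate p x\<close> by auto
  moreover have "x \<in> A" using xs x by auto
  ultimately show ?thesis by blast
qed

section \<open>Invariance of the counts, and rigidity of the reduced form\<close>

section \<open>Reduction steps preserve the counts\<close>

definition sqfree :: "'a pair_pre_digraph \<Rightarrow> bool" where
  "sqfree H \<longleftrightarrow> pair_graph H \<and> sqfree_graph (pverts H) (parcs H)"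

text \<open>The target is a bare vertex set with a relation, so that the part induced by the fixed
  points, or a relabelled copy, can be used without being packed into a graph record.\<close>

definition homs_to :: "'b pair_pre_digraph \<Rightarrow> 'a set \<Rightarrow> ('a \<times> 'a) set \<Rightarrow> ('b \<Rightarrow> 'a) set" where
  "homs_to G V E = {f \<in> pverts G \<rightarrow>\<^sub>E V. edges_ok E f (parcs G)}"

lemma homs_eq: "homs G H = homs_to G (pverts H) (parcs H)"
  by (simp add: homs_def homs_to_def edges_ok_def)

lemma sqfreeI:
  assumes H: "pair_graph H" and sf: "square_free H"
  shows "sqfree H"
proof -
  interpret H: pair_graph H by fact
  have "sqfree_graph (pverts H) (parcs H)"
  proof
    show "finite (pverts H)" by (rule H.pair_finite_verts)
    show "x \<in> pverts H \<and> y \<in> pverts H" if "(x, y) \<in> parcs H" for x y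
      using that H.in_arcsD1 H.in_arcsD2 by blast
    show "(y, x) \<in> parcs H" if "(x, y) \<in> parcs H" for x y
      using that H.arcs_symmetric by blast
    show irr: "(x, x) \<notin> parcs H" for x using H.no_loops' by blast
    fix a b u v assume e: "(a, u) \<in> parcs H" "(a, v) \<in> parcs H" "(b, u) \<in> parcs H" "(b, v) \<in> parcs H"
      and "u \<noteq> v"
    show "a = b"
    proof (rule ccontr)
      assume "a \<noteq> b"
      have "pre_digraph.cycle (with_proj H) [(a, u), (u, b), (b, v), (v, a)]"
        unfolding pre_digraph.cycle_def pre_digraph.awalk_def cas_with_proj_eq awalk_verts_with_proj_eq
        using e \<open>u \<noteq> v\<close> \<open>a \<noteq> b\<close> irr H.arcs_symmetric H.in_arcsD1
        by (intro exI[of _ a]) auto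
      then show False using sf unfolding square_free_def by fastforce
    qed
  qed
  then show ?thesis using H by (simp add: sqfree_def)
qed

text \<open>An isomorphism of the library also carries a map of arcs. For arcs that are pairs with
  the projections as tail and head, that map is forced by the vertex map.\<close>

lemma digraph_iso_proj:
  fixes G :: "('a, 'a \<times> 'a) pre_digraph"
  assumes "digraph_iso G (with_proj H')" and "tail G = fst" "head G = snd"
  obtains \<phi> where "inj_on \<phi> (verts G)" "pverts H' = \<phi> ` verts G" "parcs H' = map_prod \<phi> \<phi> ` arcs G"
    "wf_digraph G"
proof -
  obtain h where h: "pre_digraph.digraph_isomorphism G h" "with_proj H' = app_iso h G"
    using assms(1) by (auto simp: digraph_iso_def)
  have tl: "iso_tail h = fst" "iso_head h = snd"
    using h(2) by (auto simp: with_proj_def app_iso_def)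
  have "iso_arcs h a = map_prod (iso_verts h) (iso_verts h) a" if "a \<in> arcs G" for a
    using h(1) that unfolding pre_digraph.digraph_isomorphism_def tl assms(2,3)
    by (intro prod_eqI) simp_all
  then have "parcs H' = map_prod (iso_verts h) (iso_verts h) ` arcs G"
    using h(2) by (auto simp: with_proj_def app_iso_def)
  moreover have "pverts H' = iso_verts h ` verts G"
    using h(2) by (auto simp: with_proj_def app_iso_def)
  ultimately show thesis
    using h(1) that unfolding pre_digraph.digraph_isomorphism_def by blast
qed

lemma card_homs_to_image:
  assumes "inj_on \<phi> V" and "E \<subseteq> V \<times> V" and G: "\<And>x y. (x, y) \<in> parcs G \<Longrightarrow> x \<in> pverts G \<and> y \<in> pverts G"
  shows "card (homs_to G (\<phi> ` V) (map_prod \<phi> \<phi> ` E)) = card (homs_to G V E)"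
proof -
  let ?\<psi> = "the_inv_into V \<phi>"
  have edge: "(\<phi> x, \<phi> y) \<in> map_prod \<phi> \<phi> ` E \<longleftrightarrow> (x, y) \<in> E" if "x \<in> V" "y \<in> V" for x y
  proof
    assume "(\<phi> x, \<phi> y) \<in> map_prod \<phi> \<phi> ` E"
    then obtain x' y' where "(x', y') \<in> E" "\<phi> x = \<phi> x'" "\<phi> y = \<phi> y'" by auto
    then show "(x, y) \<in> E" using assms(1,2) that unfolding inj_on_def by blast
  next
    assume "(x, y) \<in> E"
    from imageI[OF this, of "map_prod \<phi> \<phi>"] show "(\<phi> x, \<phi> y) \<in> map_prod \<phi> \<phi> ` E" by simp
  qed
  have "bij_betw (\<lambda>f. restrict (\<phi> \<circ> f) (pverts G)) (homs_to G V E) (homs_to G (\<phi> ` V) (map_prod \<phi> \<phi> ` E))"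
  proof (rule bij_betwI[where g = "\<lambda>f. restrict (?\<psi> \<circ> f) (pverts G)"])
    show "(\<lambda>f. restrict (\<phi> \<circ> f) (pverts G)) \<in> homs_to G V E \<rightarrow> homs_to G (\<phi> ` V) (map_prod \<phi> \<phi> ` E)"
    proof
      fix f assume f: "f \<in> homs_to G V E"
      then have "(\<phi> (f x), \<phi> (f y)) \<in> map_prod \<phi> \<phi> ` E" if "(x, y) \<in> parcs G" for x y
        using edge[of "f x" "f y"] G[OF that] that by (auto simp: homs_to_def edges_ok_def)
      then show "restrict (\<phi> \<circ> f) (pverts G) \<in> homs_to G (\<phi> ` V) (map_prod \<phi> \<phi> ` E)"
        using f G by (auto simp: homs_to_def edges_ok_def)
    qed
    show "(\<lambda>f. restrict (?\<psi> \<circ> f) (pverts G)) \<in> homs_to G (\<phi> ` V) (map_prod \<phi> \<phi> ` E) \<rightarrow> homs_to G V E"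
    proof
      fix f assume f: "f \<in> homs_to G (\<phi> ` V) (map_prod \<phi> \<phi> ` E)"
      have 1: "?\<psi> (f x) \<in> V" "\<phi> (?\<psi> (f x)) = f x" if "x \<in> pverts G" for x
        using f that assms(1) by (auto simp: homs_to_def PiE_iff intro: the_inv_into_into f_the_inv_into_f)
      have "(?\<psi> (f x), ?\<psi> (f y)) \<in> E" if xy: "(x, y) \<in> parcs G" for x y
        using edge[of "?\<psi> (f x)" "?\<psi> (f y)"] 1 G[OF xy] f xy by (auto simp: homs_to_def edges_ok_def)
      then show "restrict (?\<psi> \<circ> f) (pverts G) \<in> homs_to G V E"
        using 1 G by (auto simp: homs_to_def edges_ok_def)
    qed
    fix f assume f: "f \<in> homs_to G V E"
    show "restrict (?\<psi> \<circ> restrict (\<phi> \<circ> f) (pverts G)) (pverts G) = f"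
    proof
      fix x
      show "restrict (?\<psi> \<circ> restrict (\<phi> \<circ> f) (pverts G)) (pverts G) x = f x"
        using f assms(1) by (cases "x \<in> pverts G") (auto simp: homs_to_def PiE_iff extensional_def the_inv_into_f_f)
    qed
  next
    fix f assume f: "f \<in> homs_to G (\<phi> ` V) (map_prod \<phi> \<phi> ` E)"
    show "restrict (\<phi> \<circ> restrict (?\<psi> \<circ> f) (pverts G)) (pverts G) = f"
    proof
      fix x
      show "restrict (\<phi> \<circ> restrict (?\<psi> \<circ> f) (pverts G)) (pverts G) x = f x"
        using f assms(1) by (cases "x \<in> pverts G")
          (auto simp: homs_to_def PiE_iff extensional_def intro: f_the_inv_into_f)
    qed
  qed
  then show ?thesis using bij_betw_same_card by fastforce
qed

lemma sqfree_image:
  assumes H: "sqfree H" and \<phi>: "inj_on \<phi> S" "S \<subseteq> pverts H"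
    and H': "pverts H' = \<phi> ` S" "parcs H' = map_prod \<phi> \<phi> ` (parcs H \<inter> S \<times> S)"
  shows "sqfree H'"
proof -
  interpret H: pair_graph H using H by (simp add: sqfree_def)
  interpret sqfree_graph "pverts H" "parcs H" using H by (simp add: sqfree_def)
  have edge: "(\<phi> x, \<phi> y) \<in> parcs H' \<longleftrightarrow> (x, y) \<in> parcs H" if "x \<in> S" "y \<in> S" for x y
  proof
    assume "(\<phi> x, \<phi> y) \<in> parcs H'"
    then obtain x' y' where "(x', y') \<in> parcs H" "x' \<in> S" "y' \<in> S" "\<phi> x = \<phi> x'" "\<phi> y = \<phi> y'"
      by (auto simp: H')
    then show "(x, y) \<in> parcs H" using \<phi>(1) that unfolding inj_on_def by blast
  next
    assume "(x, y) \<in> parcs H"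
    then have "(x, y) \<in> parcs H \<inter> S \<times> S" using that by simp
    from imageI[OF this, of "map_prod \<phi> \<phi>"] show "(\<phi> x, \<phi> y) \<in> parcs H'" by (simp add: H')
  qed
  have ends: "\<exists>x y. a = \<phi> x \<and> b = \<phi> y \<and> x \<in> S \<and> y \<in> S \<and> (x, y) \<in> parcs H" if "(a, b) \<in> parcs H'" for a b
    using that by (auto simp: H')
  have 1: "finite (pverts H')" using H'(1) finite_subset[OF \<phi>(2) finite_V] by simp
  have 2: "(b, a) \<in> parcs H'" if "(a, b) \<in> parcs H'" for a b
    using ends[OF that] edge sym_E by blast
  have 3: "a \<in> pverts H' \<and> b \<in> pverts H'" if "(a, b) \<in> parcs H'" for a b
    using ends[OF that] H'(1) by blast
  have 4: "(a, a) \<notin> parcs H'" for a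
    using ends[of a a] \<phi>(1) irrefl_E unfolding inj_on_def by blast
  have "pair_graph H'"
  proof unfold_locales
    show "finite (pverts H')" by (rule 1)
    show "finite (parcs H')" by (rule finite_subset[of _ "pverts H' \<times> pverts H'"]) (use 1 3 in auto)
    show "symmetric (with_proj H')" using 2 by (auto simp: symmetric_def intro!: symI)
    fix e assume "e \<in> parcs H'"
    then show "fst e \<in> pverts H'" "snd e \<in> pverts H'" "fst e \<noteq> snd e"
      using 3[of "fst e" "snd e"] 4[of "fst e"] by (cases e; force)+
  qed
  moreover have "sqfree_graph (pverts H') (parcs H')"
  proof
    fix a b u v assume e: "(a, u) \<in> parcs H'" "(a, v) \<in> parcs H'" "(b, u) \<in> parcs H'" "(b, v) \<in> parcs H'"
      and "u \<noteq> v"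
    obtain a' u' where a: "a = \<phi> a'" "u = \<phi> u'" "a' \<in> S" "u' \<in> S" using ends[OF e(1)] by blast
    obtain b' v' where b: "b = \<phi> b'" "v = \<phi> v'" "b' \<in> S" "v' \<in> S" using ends[OF e(4)] by blast
    have "a' = b'"
      using e edge a b \<open>u \<noteq> v\<close> by (intro no_square[of a' u' v' b']) auto
    then show "a = b" using a b by simp
  qed (use 1 2 3 4 in auto)
  ultimately show ?thesis by (simp add: sqfree_def)
qed

text \<open>Composition with \<pi> acts on the homomorphisms, and a homomorphism is fixed exactly if
  all its values are fixed points of \<pi>.\<close>

lemma card_homs_fixed_points:
  assumes p: "prime p" and H: "pair_graph H" and \<pi>: "automorphism H \<pi>" "\<pi> ^^ p = id" and G: "pair_graph G"
  shows "[card (homs G H) = card (homs_to G {v \<in> pverts H. \<pi> v = v}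
    (parcs H \<inter> {v \<in> pverts H. \<pi> v = v} \<times> {v \<in> pverts H. \<pi> v = v}))] (mod p)"
proof -
  interpret H: pair_graph H by fact
  interpret G: pair_graph G by fact
  let ?g = "\<lambda>f. restrict (\<pi> \<circ> f) (pverts G)"
  let ?S = "{v \<in> pverts H. \<pi> v = v}"
  have fin: "finite (homs G H)"
    unfolding homs_eq homs_to_def using H.pair_finite_verts G.pair_finite_verts by (simp add: finite_PiE)
  have GV: "x \<in> pverts G \<and> y \<in> pverts G" if "(x, y) \<in> parcs G" for x y
    using that G.in_arcsD1 G.in_arcsD2 by blast
  have \<pi>V: "\<pi> v \<in> pverts H" if "v \<in> pverts H" for v
    using \<pi>(1) that permutes_in_image unfolding automorphism_def by metis
  have "?g f \<in> homs G H \<and> (?g ^^ p) f = f" if f: "f \<in> homs G H" for f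
  proof
    show "?g f \<in> homs G H"
      using f \<pi>(1) \<pi>V GV unfolding homs_eq homs_to_def edges_ok_def automorphism_def PiE_iff by fastforce
    have "(?g ^^ n) f = restrict ((\<pi> ^^ n) \<circ> f) (pverts G)" for n
    proof (induction n)
      case 0
      show ?case using f by (auto simp: homs_eq homs_to_def PiE_iff extensional_def fun_eq_iff)
    qed (auto simp: fun_eq_iff)
    then show "(?g ^^ p) f = f"
      using f \<pi>(2) by (auto simp: homs_eq homs_to_def PiE_iff extensional_def fun_eq_iff)
  qed
  from card_cong_fixed_points[OF p fin this]
  have "[card (homs G H) = card {f \<in> homs G H. ?g f = f}] (mod p)" .
  also have "{f \<in> homs G H. ?g f = f} = homs_to G ?S (parcs H \<inter> ?S \<times> ?S)"
  proof (intro set_eqI iffI)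
    fix f assume f: "f \<in> {f \<in> homs G H. ?g f = f}"
    have "\<pi> (f x) = f x" if "x \<in> pverts G" for x
      using f that by (auto simp: fun_eq_iff dest!: spec[of _ x])
    then show "f \<in> homs_to G ?S (parcs H \<inter> ?S \<times> ?S)"
      using f GV by (fastforce simp: homs_eq homs_to_def edges_ok_def PiE_iff)
  next
    fix f assume f: "f \<in> homs_to G ?S (parcs H \<inter> ?S \<times> ?S)"
    have "?g f = f"
      using f by (auto simp: homs_to_def PiE_iff extensional_def fun_eq_iff)
    then show "f \<in> {f \<in> homs G H. ?g f = f}"
      using f by (auto simp: homs_eq homs_to_def edges_ok_def PiE_iff)
  qed
  finally show ?thesis .
qed

lemma reduces_to_counts:
  assumes p: "prime p" and "reduces_to p H K" and "sqfree H"
  shows "sqfree K \<and> (\<forall>G :: 'b pair_pre_digraph. pair_graph G \<longrightarrow> [card (homs G H) = card (homs G K)] (mod p))"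
  using assms(2) unfolding reduces_to_def
proof (induction rule: rtranclp_induct)
  case base
  then show ?case using assms(3) by simp
next
  case (step K K')
  then have K: "sqfree K" "pair_graph K" by (auto simp: sqfree_def)
  interpret K: pair_graph K by (rule K(2))
  \<comment> \<open>Both kinds of step relabel an induced subgraph: the whole graph for an
    isomorphism, the fixed points for a reduction. Square-freeness passes to induced subgraphs and
    is carried along.\<close>
  have image: "sqfree K' \<and> (\<forall>G :: 'b pair_pre_digraph. pair_graph G \<longrightarrow>
      card (homs_to G S (parcs K \<inter> S \<times> S)) = card (homs G K'))"
    if iso: "digraph_iso (with_proj K \<restriction> S) (with_proj K')" and S: "S \<subseteq> pverts K" for S
  proof -
    have arcs: "arcs (with_proj K \<restriction> S) = parcs K \<inter> S \<times> S" by auto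
    obtain \<phi> where \<phi>: "inj_on \<phi> S" "pverts K' = \<phi> ` S" "parcs K' = map_prod \<phi> \<phi> ` (parcs K \<inter> S \<times> S)"
      by (rule digraph_iso_proj[OF iso, unfolded arcs]) (simp_all del: induce_subgraph_arcs)
    have "card (homs G K') = card (homs_to G S (parcs K \<inter> S \<times> S))" if "pair_graph G" for G :: "'b pair_pre_digraph"
    proof -
      interpret G: pair_graph G by fact
      show ?thesis unfolding homs_eq \<phi>(2,3)
        using G.in_arcsD1 G.in_arcsD2 by (intro card_homs_to_image \<phi>(1)) auto
    qed
    then show ?thesis using sqfree_image[OF K(1) \<phi>(1) S \<phi>(2,3)] by auto
  qed
  from step.hyps(2) show ?case
  proof
    assume iso: "digraph_iso (with_proj K) (with_proj K')"
    have V: "parcs K \<inter> pverts K \<times> pverts K = parcs K" using K.in_arcsD1 K.in_arcsD2 by auto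
    have "with_proj K \<restriction> pverts K = with_proj K"
      unfolding induce_subgraph_def with_proj_def
      using K.in_arcsD1 K.in_arcsD2 by (fastforce simp: set_eq_iff)
    with iso image[of "pverts K"] have "sqfree K'"
      "\<And>G :: 'b pair_pre_digraph. pair_graph G \<Longrightarrow> card (homs G K) = card (homs G K')"
      unfolding V homs_eq[symmetric] by auto
    then show ?thesis using step.IH by auto
  next
    assume "reduction_step p K K'"
    then obtain \<pi> where \<pi>: "automorphism K \<pi>" "has_order \<pi> p"
      "digraph_iso (with_proj K \<restriction> {v \<in> pverts K. \<pi> v = v}) (with_proj K')"
      by (auto simp: reduction_step_def)
    have pi_p: "\<pi> ^^ p = id" using \<pi>(2) by (simp add: has_order_def)
    from image[OF \<pi>(3)] have im: "sqfree K'" "\<And>G :: 'b pair_pre_digraph. pair_graph G \<Longrightarrow>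
      card (homs_to G {v \<in> pverts K. \<pi> v = v} (parcs K \<inter> {v \<in> pverts K. \<pi> v = v} \<times> {v \<in> pverts K. \<pi> v = v})) =
      card (homs G K')" by auto
    have "[card (homs G K) = card (homs G K')] (mod p)" if "pair_graph G" for G :: "'b pair_pre_digraph"
      using card_homs_fixed_points[OF p K(2) \<pi>(1) pi_p that] im(2)[OF that] by simp
    then show ?thesis using step.IH im(1) cong_trans by blast
  qed
qed

text \<open>As \<open>p\<close> is prime, a map \<pi> other than the identity with p-th power
  \<open>id\<close> has order exactly \<open>p\<close>, so its fixed points would give one more
  reduction step. Minimality of \<open>K\<close> then forces every vertex to be fixed.\<close>

lemma reduced_form_rigid:
  assumes p: "prime p" and red: "reduced_form p H K" and K: "pair_graph K"
    and \<pi>: "automorphism K \<pi>" "\<pi> ^^ p = id"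
  shows "\<pi> = id"
proof (rule ccontr)
  assume "\<pi> \<noteq> id"
  interpret K: pair_graph K by fact
  have order: "has_order \<pi> p"
    unfolding has_order_def
  proof (intro conjI allI impI)
    show "0 < p" using p by (rule prime_gt_0_nat)
    fix j assume j: "0 < j \<and> j < p"
    show "\<pi> ^^ j \<noteq> id"
    proof
      assume "\<pi> ^^ j = id"
      have "\<not> p dvd j" using j by (auto dest: dvd_imp_le)
      then have "coprime j p" using p by (metis coprime_commute prime_imp_coprime)
      then have "\<pi> x = x" for x
        using funpow_coprime_fixed[of p \<pi> x j] \<pi>(2) \<open>\<pi> ^^ j = id\<close> j by simp
      then show False using \<open>\<pi> \<noteq> id\<close> by auto
    qed
  qed (rule \<pi>(2))
  let ?S = "{v \<in> pverts K. \<pi> v = v}"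
  define K' where "K' = \<lparr>pverts = ?S, parcs = parcs K \<inter> ?S \<times> ?S\<rparr>"
  have eq: "with_proj K \<restriction> ?S = with_proj K'"
    by (auto simp: induce_subgraph_def with_proj_def K'_def)
  have "wf_digraph (with_proj K \<restriction> ?S)" by (rule K.wellformed_induce_subgraph)
  then have "digraph_iso (with_proj K \<restriction> ?S) (with_proj K')"
    unfolding eq digraph_iso_def pre_digraph.digraph_isomorphism_def
    by (intro exI[of _ "\<lparr>iso_verts = id, iso_arcs = id, iso_head = snd, iso_tail = fst\<rparr>"])
      (simp add: app_iso_def with_proj_def)
  then have "reduction_step p K K'" unfolding reduction_step_def using \<pi>(1) order by blast
  moreover have "reduces_to p H K" using red by (simp add: reduced_form_def)
  ultimately have "reduces_to p H K'" unfolding reduces_to_def by (metis (mono_tags, lifting) rtranclp.rtrancl_into_rtrancl)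
  then have "card (pverts K) \<le> card (pverts K')" using red unfolding reduced_form_def by blast
  then have "card (pverts K) \<le> card ?S" by (simp add: K'_def)
  then have "?S = pverts K"
    using K.pair_finite_verts by (intro card_seteq) auto
  moreover have "\<pi> x = x" if "x \<notin> pverts K" for x
    using \<pi>(1) that by (auto simp: automorphism_def permutes_def)
  ultimately have "\<pi> x = x" for x by blast
  then show False using \<open>\<pi> \<noteq> id\<close> by auto
qed

section \<open>Automorphism count, leaves and walks without backtracking\<close>

section \<open>Existence of the walks\<close>

definition rigid :: "nat \<Rightarrow> 'a pair_pre_digraph \<Rightarrow> bool" where
  "rigid p K \<longleftrightarrow> (\<forall>\<pi>. automorphism K \<pi> \<and> \<pi> ^^ p = id \<longrightarrow> \<pi> = id)"

text \<open>An injective endomorphism permutes the finite vertex set and, by counting, also the arc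
  set. So it is the restriction of an automorphism, and Cauchy's theorem applies to the group of
  automorphisms.\<close>

lemma card_injective_homs:
  assumes p: "prime p" and K: "pair_graph K" and rigid: "rigid p K"
  shows "\<not> p dvd card (injective_homs K)"
proof
  assume dvd: "p dvd card (injective_homs K)"
  interpret K: pair_graph K by fact
  let ?V = "pverts K"
  let ?A = "{\<pi>. automorphism K \<pi>}"
  have perm: "\<pi> permutes ?V" if "automorphism K \<pi>" for \<pi> using that by (simp add: automorphism_def)
  have "bij_betw (\<lambda>\<pi>. restrict \<pi> ?V) ?A (injective_homs K)"
  proof (rule bij_betwI[where g = "\<lambda>\<kappa> x. if x \<in> ?V then \<kappa> x else x"])
    show "(\<lambda>\<pi>. restrict \<pi> ?V) \<in> ?A \<rightarrow> injective_homs K"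
    proof
      fix \<pi> assume "\<pi> \<in> ?A"
      then have \<pi>: "automorphism K \<pi>" by simp
      have "\<pi> x \<in> ?V" if "x \<in> ?V" for x using permutes_in_image[OF perm[OF \<pi>]] that by simp
      moreover have "inj_on \<pi> ?V" using permutes_inj[OF perm[OF \<pi>]] inj_on_subset by blast
      moreover have "(\<pi> x, \<pi> y) \<in> parcs K" if "(x, y) \<in> parcs K" for x y
        using \<pi> that K.in_arcsD1[OF that] K.in_arcsD2[OF that] by (auto simp: automorphism_def)
      ultimately show "restrict \<pi> ?V \<in> injective_homs K"
        using K.in_arcsD1 K.in_arcsD2 by (auto simp: injective_homs_def edges_ok_def inj_on_def)
    qed
    show "(\<lambda>\<kappa> x. if x \<in> ?V then \<kappa> x else x) \<in> injective_homs K \<rightarrow> ?A"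
    proof
      fix \<kappa> assume \<kappa>: "\<kappa> \<in> injective_homs K"
      let ?\<pi> = "\<lambda>x. if x \<in> ?V then \<kappa> x else x"
      have img: "\<kappa> ` ?V = ?V"
        using \<kappa> K.pair_finite_verts by (intro endo_inj_surj) (auto simp: injective_homs_def)
      have inj: "inj_on \<kappa> ?V" using \<kappa> by (simp add: injective_homs_def)
      have "bij_betw ?\<pi> ?V ?V"
        using inj img by (simp add: bij_betw_def inj_on_def cong: image_cong)
      then have perm: "?\<pi> permutes ?V" by (rule bij_imp_permutes) simp
      have sub: "map_prod \<kappa> \<kappa> ` parcs K \<subseteq> parcs K"
        using \<kappa> by (auto simp: injective_homs_def edges_ok_def)
      have "parcs K \<subseteq> ?V \<times> ?V" using K.in_arcsD1 K.in_arcsD2 by auto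
      then have inj2: "inj_on (map_prod \<kappa> \<kappa>) (parcs K)"
        using map_prod_inj_on[OF inj inj] inj_on_subset by blast
      have surj: "map_prod \<kappa> \<kappa> ` parcs K = parcs K"
        by (rule endo_inj_surj[OF K.pair_finite_arcs sub inj2])
      have "(x, y) \<in> parcs K \<longleftrightarrow> (\<kappa> x, \<kappa> y) \<in> parcs K" if "x \<in> ?V" "y \<in> ?V" for x y
      proof
        assume "(\<kappa> x, \<kappa> y) \<in> parcs K"
        then have "(\<kappa> x, \<kappa> y) \<in> map_prod \<kappa> \<kappa> ` parcs K" by (simp only: surj)
        then obtain x' y' where xy: "(x', y') \<in> parcs K" "\<kappa> x = \<kappa> x'" "\<kappa> y = \<kappa> y'" by auto
        then have "x = x'" "y = y'"
          using inj that K.in_arcsD1[OF xy(1)] K.in_arcsD2[OF xy(1)] by (auto dest: inj_onD)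
        then show "(x, y) \<in> parcs K" using xy by simp
      qed (use sub in auto)
      then show "?\<pi> \<in> ?A" using perm by (simp add: automorphism_def)
    qed
    fix \<pi> assume "\<pi> \<in> ?A"
    then have "\<pi> x = x" if "x \<notin> ?V" for x using that perm by (auto simp: permutes_def)
    then show "(\<lambda>x. if x \<in> ?V then restrict \<pi> ?V x else x) = \<pi>" by auto
  next
    fix \<kappa> assume "\<kappa> \<in> injective_homs K"
    then show "restrict (\<lambda>x. if x \<in> ?V then \<kappa> x else x) ?V = \<kappa>"
      by (auto simp: injective_homs_def PiE_iff extensional_def fun_eq_iff)
  qed
  then have "p dvd card ?A" using dvd bij_betw_same_card by metis
  moreover have "finite ?A"
    using finite_subset[OF _ finite_permutations[OF K.pair_finite_verts], of ?A] perm by auto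
  moreover have "id \<in> ?A" by (simp add: automorphism_def permutes_id)
  moreover have "f \<circ> g \<in> ?A" if "f \<in> ?A" "g \<in> ?A" for f g
  proof -
    have "g x \<in> ?V" if "x \<in> ?V" for x using \<open>g \<in> ?A\<close> perm permutes_in_image that by fastforce
    then show ?thesis using that permutes_compose by (auto simp: automorphism_def)
  qed
  moreover have "bij f \<and> inv f \<in> ?A" if f: "f \<in> ?A" for f
  proof -
    have pf: "f permutes ?V" using f perm by simp
    have "inv f x \<in> ?V" if "x \<in> ?V" for x using permutes_in_image[OF permutes_inv[OF pf]] that by simp
    moreover have "f (inv f x) = x" for x using permutes_inverses(1)[OF pf] .
    ultimately have "inv f \<in> ?A"
      using f permutes_inv[OF pf] by (simp add: automorphism_def)
    then show ?thesis using permutes_bij[OF pf] by simp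
  qed
  ultimately obtain f where "f \<in> ?A" "f \<noteq> id" "f ^^ p = id"
    using cauchy_functions[OF p, of ?A] by blast
  then show False using rigid by (auto simp: rigid_def)
qed

lemma few_leaves:
  assumes p: "prime p" and K: "pair_graph K" and rigid: "rigid p K"
    and L: "L \<subseteq> pverts K" "\<And>x y. x \<in> L \<Longrightarrow> (x, y) \<in> parcs K \<longleftrightarrow> y = b"
  shows "card L < p"
proof (rule ccontr)
  interpret K: pair_graph K by fact
  assume "\<not> card L < p"
  then obtain L' where L': "L' \<subseteq> L" "card L' = p" "finite L'"
    using obtain_subset_with_card_n[of p L] by auto
  obtain f where f: "bij_betw f {..<p} L'"
    using ex_bij_betw_nat_finite[OF L'(3)] L'(2) by (auto simp: atLeast0LessThan)
  define ix where "ix = the_inv_into {..<p} f"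
  define \<pi> where "\<pi> x = (if x \<in> L' then f (Suc (ix x) mod p) else x)" for x
  have p1: "1 < p" using p by (rule prime_gt_1_nat)
  have inj: "inj_on f {..<p}" using f by (simp add: bij_betw_def)
  have fL: "f i \<in> L'" if "i < p" for i
    using f that by (auto simp: bij_betw_def)
  have ix: "ix (f i) = i" if "i < p" for i
    using f that unfolding ix_def bij_betw_def by (simp add: the_inv_into_f_f)
  have ex_index: "\<exists>i<p. x = f i" if "x \<in> L'" for x using f that unfolding bij_betw_def by auto
  have \<pi>f: "\<pi> (f i) = f (Suc i mod p)" if "i < p" for i using fL that ix by (simp add: \<pi>_def)
  have pow: "(\<pi> ^^ n) (f i) = f ((i + n) mod p)" if "i < p" for i n
  proof (induction n)
    case (Suc n)
    have "(i + n) mod p < p" using p1 by simp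
    from \<pi>f[OF this] Suc show ?case by (simp add: mod_Suc_eq)
  qed (use that in simp)
  have out: "(\<pi> ^^ n) x = x" if "x \<notin> L'" for x n using that by (induction n) (auto simp: \<pi>_def)
  have "\<pi> ^^ p = id"
  proof
    fix x show "(\<pi> ^^ p) x = id x"
    proof (cases "x \<in> L'")
      case True
      then obtain i where "i < p" "x = f i" using ex_index by blast
      then show ?thesis using pow[of i p] by simp
    qed (simp add: out)
  qed
  have \<pi>L: "\<pi> x \<in> L' \<longleftrightarrow> x \<in> L'" for x
  proof
    assume "x \<in> L'"
    then show "\<pi> x \<in> L'" using p1 fL by (simp add: \<pi>_def)
  qed (auto simp: \<pi>_def split: if_splits)
  have LV: "L' \<subseteq> pverts K" using L(1) L'(1) by auto
  have "\<pi> permutes pverts K"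
  proof -
    have "bij \<pi>"
    proof (rule o_bij)
      have "\<pi> ^^ (p - 1) \<circ> \<pi> = \<pi> ^^ Suc (p - 1)" by (simp only: funpow_Suc_right)
      then show "\<pi> ^^ (p - 1) \<circ> \<pi> = id" using \<open>\<pi> ^^ p = id\<close> p1 by simp
      have "\<pi> \<circ> \<pi> ^^ (p - 1) = \<pi> ^^ Suc (p - 1)" by simp
      then show "\<pi> \<circ> \<pi> ^^ (p - 1) = id" using \<open>\<pi> ^^ p = id\<close> p1 by simp
    qed
    moreover have "\<pi> x = x" if "x \<notin> pverts K" for x using that LV by (auto simp: \<pi>_def)
    ultimately show ?thesis by (auto simp: permutes_def bij_iff)
  qed
  moreover have "(x, y) \<in> parcs K \<longleftrightarrow> (\<pi> x, \<pi> y) \<in> parcs K" for x y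
  proof -
    have leaf: "(x, y) \<in> parcs K \<longleftrightarrow> y = b" "(y, x) \<in> parcs K \<longleftrightarrow> y = b" if "x \<in> L'" for x y
      using L(2)[of x y] that L'(1) K.arcs_symmetric by blast+
    have b: "b \<notin> L'" using leaf(1)[of b b] K.no_loops' by blast
    then have \<pi>b: "\<pi> z = b \<longleftrightarrow> z = b" for z using \<pi>L[of z] by (auto simp: \<pi>_def)
    consider "x \<in> L'" | "y \<in> L'" | "x \<notin> L'" "y \<notin> L'" by blast
    then show ?thesis
    proof cases
      case 1
      then show ?thesis using leaf(1)[of x y] leaf(1)[of "\<pi> x" "\<pi> y"] \<pi>L \<pi>b by simp
    next
      case 2
      then show ?thesis using leaf(2)[of y x] leaf(2)[of "\<pi> y" "\<pi> x"] \<pi>L \<pi>b by simp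
    qed (simp add: \<pi>_def)
  qed
  ultimately have "automorphism K \<pi>" by (simp add: automorphism_def)
  with \<open>\<pi> ^^ p = id\<close> have "\<pi> = id" using rigid by (auto simp: rigid_def)
  moreover have "\<pi> (f 0) \<noteq> f 0"
    using \<pi>f[of 0] p1 inj_onD[OF inj, of 1 0] by auto
  ultimately show False by simp
qed

context sqfree_graph
begin

definition reaches_end :: "nat \<Rightarrow> 'a \<Rightarrow> 'a \<Rightarrow> bool" where
  "reaches_end p a b \<longleftrightarrow> (\<exists>x k. nb_walk p x k \<and> x 0 = a \<and> x 1 = b \<and> \<not> [card (nb (x k)) = 1] (mod p))"

text \<open>The degree of the base point is left open. The last condition forbids backtracking there
  and makes the two vertices picked out by the selector distinct.\<close>

definition closed_nb_walk :: "nat \<Rightarrow> (nat \<Rightarrow> 'a) \<Rightarrow> nat \<Rightarrow> bool" where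
  "closed_nb_walk p x k \<longleftrightarrow> nb_walk p x k \<and> x k = x 0 \<and> x 1 \<noteq> x (k - 1)"

lemma reaches_end_extend:
  assumes "(a, b) \<in> E" "a \<noteq> c" "[card (nb b) = 1] (mod p)" "reaches_end p b c"
  shows "reaches_end p a b"
proof -
  obtain x k where x: "nb_walk p x k" "x 0 = b" "x 1 = c" "\<not> [card (nb (x k)) = 1] (mod p)"
    using assms(4) by (auto simp: reaches_end_def)
  have "nb_walk p (case_nat a x) (Suc k)"
    unfolding nb_walk_def
  proof (intro conjI allI impI)
    show "(case_nat a x i, case_nat a x (Suc i)) \<in> E" if "i < Suc k" for i
      using that x(1,2) assms(1) by (cases i) (auto simp: nb_walk_def)
    show "case_nat a x i \<noteq> case_nat a x (Suc (Suc i))" if "Suc (Suc i) \<le> Suc k" for i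
      using that x(1,3) assms(2) by (cases i) (auto simp: nb_walk_def)
    show "[card (nb (case_nat a x i)) = 1] (mod p)" if i: "0 < i \<and> i < Suc k" for i
    proof -
      obtain m where m: "i = Suc m" using i by (cases i) auto
      show ?thesis using i x(1,2) assms(3) unfolding m by (cases m) (auto simp: nb_walk_def)
    qed
  qed simp
  then show ?thesis
    unfolding reaches_end_def using x(2,4) by (intro exI[of _ "case_nat a x"] exI[of _ "Suc k"]) simp
qed

text \<open>A walk that never reaches a vertex of degree other than 1 modulo \<open>p\<close> can be
  continued forever, because \<open>next_vertex\<close> always offers a continuation that is neither
  a step back nor a leaf. In a finite graph it must repeat a vertex.\<close>

lemma reaches_end_or_closed:
  assumes next_vertex: "\<And>a b. (a, b) \<in> E \<Longrightarrow> [card (nb b) = 1] (mod p) \<Longrightarrow> 2 \<le> card (nb b) \<Longrightarrow>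
      \<exists>c. c \<noteq> a \<and> (b, c) \<in> E \<and> 2 \<le> card (nb c)"
    and ab: "(a, b) \<in> E" "2 \<le> card (nb b)" and not: "\<not> reaches_end p a b"
  shows "\<exists>x k. closed_nb_walk p x k"
proof -
  let ?P = "\<lambda>(a, b). (a, b) \<in> E \<and> 2 \<le> card (nb b) \<and> \<not> reaches_end p a b"
  have deg: "[card (nb b) = 1] (mod p)" if "(a, b) \<in> E" "\<not> reaches_end p a b" for a b
  proof (rule ccontr)
    assume "\<not> ?thesis"
    moreover have "nb_walk p (case_nat a (\<lambda>_. b)) 1"
      using that(1) by (auto simp: nb_walk_def)
    ultimately have "reaches_end p a b"
      unfolding reaches_end_def by (intro exI[of _ "case_nat a (\<lambda>_. b)"] exI[of _ 1]) simp
    then show False using that by simp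
  qed
  \<comment> \<open>The choices are directed edges rather than vertices, since the next step must
    avoid the previous vertex.\<close>
  have "\<exists>s. \<forall>n. ?P (s n) \<and> (fst (s (Suc n)) = snd (s n) \<and> fst (s n) \<noteq> snd (s (Suc n)))"
  proof (rule dependent_nat_choice)
    show "\<exists>x. ?P x" using ab not by (intro exI[of _ "(a, b)"]) simp
    fix e and n :: nat
    assume e: "?P e"
    obtain a b where ab: "e = (a, b)" by force
    have d: "[card (nb b) = 1] (mod p)" using e unfolding ab by (intro deg) auto
    obtain c where c: "c \<noteq> a" "(b, c) \<in> E" "2 \<le> card (nb c)"
      using next_vertex[OF _ d, of a] e ab by auto
    have "\<not> reaches_end p b c" using reaches_end_extend[OF _ c(1)[symmetric] d] e ab by auto
    then show "\<exists>y. ?P y \<and> (fst y = snd e \<and> fst e \<noteq> snd y)"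
      using c ab by (intro exI[of _ "(b, c)"]) auto
  qed
  then obtain s where s': "\<forall>n. ?P (s n) \<and> (fst (s (Suc n)) = snd (s n) \<and> fst (s n) \<noteq> snd (s (Suc n)))"
    by (rule exE)
  note s = conjunct1[OF spec[OF s']] conjunct1[OF conjunct2[OF spec[OF s']]]
    conjunct2[OF conjunct2[OF spec[OF s']]]
  define x where "x n = fst (s n)" for n
  have sx: "s n = (x n, x (Suc n))" for n by (simp add: x_def s(2))
  have adj: "(x n, x (Suc n)) \<in> E" for n using s(1)[of n] sx by simp
  have nonback: "x n \<noteq> x (Suc (Suc n))" for n using s(3)[of n] sx by simp
  have degs: "[card (nb (x (Suc n))) = 1] (mod p)" for n
    using s(1)[of n] unfolding sx by (intro deg) auto
  have "range x \<subseteq> V" using adj E_V by blast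
  then have "\<not> inj x" using finite_V finite_imageD finite_subset infinite_UNIV_nat by metis
  then have ex: "\<exists>j. \<exists>i<j. x i = x j" unfolding inj_def by (metis linorder_neqE_nat)
  \<comment> \<open>With the first repetition, all vertices before \<open>x j\<close> are distinct.
    This yields \<open>x (Suc i) \<noteq> x (j - 1)\<close>, as the two indices differ in a loopless
    walk without backtracking.\<close>
  define j where "j = (LEAST j. \<exists>i<j. x i = x j)"
  obtain i where i: "i < j" "x i = x j" using LeastI_ex[OF ex] unfolding j_def by blast
  have least: "\<not> (\<exists>i<j'. x i = x j')" if "j' < j" for j' using not_less_Least that unfolding j_def by blast
  have "j \<noteq> Suc i" using i adj[of i] irrefl_E by auto
  moreover have "j \<noteq> Suc (Suc i)" using i nonback[of i] by auto
  ultimately have j: "Suc (Suc i) < j" using i by simp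
  then have "x (Suc i) \<noteq> x (j - 1)" using least[of "j - 1"] by (metis One_nat_def Suc_lessE diff_Suc_1 lessI)
  moreover have "nb_walk p (\<lambda>t. x (i + t)) (j - i)"
    unfolding nb_walk_def
  proof (intro conjI allI impI)
    show "[card (nb (x (i + t))) = 1] (mod p)" if "0 < t \<and> t < j - i" for t
      using degs[of "i + t - 1"] that by simp
  qed (use j adj nonback in auto)
  ultimately have "closed_nb_walk p (\<lambda>t. x (i + t)) (j - i)"
    unfolding closed_nb_walk_def using i j by simp
  then show ?thesis by blast
qed

lemma join_walks:
  assumes "reaches_end p a b" "reaches_end p b a"
  shows "\<exists>x k. nb_walk p x k \<and> \<not> [card (nb (x 0)) = 1] (mod p) \<and> \<not> [card (nb (x k)) = 1] (mod p)"
proof -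
  obtain r k where r: "nb_walk p r k" "r 0 = a" "r 1 = b" "\<not> [card (nb (r k)) = 1] (mod p)"
    using assms(1) by (auto simp: reaches_end_def)
  obtain l m where l: "nb_walk p l m" "l 0 = b" "l 1 = a" "\<not> [card (nb (l m)) = 1] (mod p)"
    using assms(2) by (auto simp: reaches_end_def)
  have km: "0 < k" "0 < m" using r(1) l(1) by (auto simp: nb_walk_def)
  \<comment> \<open>Both walks contain the edge between \<open>a\<close> and \<open>b\<close>, in
    opposite directions. The reversed \<open>l\<close> ends with \<open>a\<close>, \<open>b\<close>
    at the positions \<open>m - 1\<close> and \<open>m\<close>, and \<open>r\<close> starts with the
    same two vertices, whence its shift by \<open>m - 1\<close>. As the overlap has two vertices,
    any three consecutive ones lie in a single walk, so backtracking cannot occur at the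
    seam.\<close>
  define w where "w i = (if i \<le> m then l (m - i) else r (Suc i - m))" for i
  have wl: "w i = l (m - i)" if "i \<le> m" for i using that by (simp add: w_def)
  have wr: "w i = r (Suc i - m)" if mi: "m \<le> Suc i" for i
  proof -
    consider "Suc i = m" | "i = m" | "m < i" using mi by linarith
    then show ?thesis using r(2,3) l(2,3) by cases (auto simp: w_def)
  qed
  have "nb_walk p w (m + k - 1)"
    unfolding nb_walk_def
  proof (intro conjI allI impI)
    show "0 < m + k - 1" using km by simp
    show "(w i, w (Suc i)) \<in> E" if i: "i < m + k - 1" for i
    proof (cases "i < m")
      case True
      then have "(l (m - Suc i), l (Suc (m - Suc i))) \<in> E" using l(1) by (auto simp: nb_walk_def)
      then show ?thesis using True sym_E by (simp add: wl Suc_diff_Suc)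
    next
      case False
      then have "(r (Suc i - m), r (Suc (Suc i - m))) \<in> E" using r(1) i km by (auto simp: nb_walk_def)
      then show ?thesis using False by (simp add: wr Suc_diff_le)
    qed
    show "w i \<noteq> w (Suc (Suc i))" if i: "Suc (Suc i) \<le> m + k - 1" for i
    proof (cases "Suc (Suc i) \<le> m")
      case True
      then have "l (m - Suc (Suc i)) \<noteq> l (Suc (Suc (m - Suc (Suc i))))" using l(1) by (auto simp: nb_walk_def)
      moreover have "Suc (Suc (m - Suc (Suc i))) = m - i" using True by simp
      ultimately show ?thesis using True by (simp add: wl)
    next
      case False
      then have "r (Suc i - m) \<noteq> r (Suc (Suc (Suc i - m)))" using r(1) i km by (auto simp: nb_walk_def)
      moreover have "Suc (Suc (Suc i - m)) = Suc (Suc (Suc i)) - m" using False by simp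
      ultimately show ?thesis using False by (simp add: wr)
    qed
    show "[card (nb (w i)) = 1] (mod p)" if i: "0 < i \<and> i < m + k - 1" for i
    proof (cases "i < m")
      case True
      then show ?thesis using l(1) i by (simp add: wl nb_walk_def)
    next
      case False
      then show ?thesis using r(1) i km by (simp add: wr nb_walk_def)
    qed
  qed
  moreover have "w 0 = l m" by (simp add: wl)
  moreover have "w (m + k - 1) = r k" using km wr[of "m + k - 1"] by simp
  ultimately show ?thesis using r(4) l(4) by metis
qed

end

lemma walk_exists:
  assumes p: "prime p" and K: "sqfree K" and rigid: "rigid p K"
    and ab: "(a, b) \<in> parcs K" "2 \<le> card {y. (a, y) \<in> parcs K}" "2 \<le> card {y. (b, y) \<in> parcs K}"
  shows "(\<exists>x k. sqfree_graph.nb_walk (parcs K) p x k \<and>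
      \<not> [card {y. (x 0, y) \<in> parcs K} = 1] (mod p) \<and> \<not> [card {y. (x k, y) \<in> parcs K} = 1] (mod p)) \<or>
    (\<exists>x k. sqfree_graph.closed_nb_walk (parcs K) p x k)"
proof -
  interpret sqfree_graph "pverts K" "parcs K" using K by (simp add: sqfree_def)
  have pg: "pair_graph K" using K by (simp add: sqfree_def)
  \<comment> \<open>The number of neighbours of \<open>b\<close> other than \<open>a\<close> is
    positive and divisible by \<open>p\<close>. If all of them were leaves, \<open>b\<close> would
    carry at least \<open>p\<close> leaves.\<close>
  have next_vertex: "\<exists>c. c \<noteq> a \<and> (b, c) \<in> parcs K \<and> 2 \<le> card (nb c)"
    if "(a, b) \<in> parcs K" "[card (nb b) = 1] (mod p)" "2 \<le> card (nb b)" for a b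
  proof (rule ccontr)
    assume no: "\<not> ?thesis"
    let ?L = "nb b - {a}"
    have leaf: "(x, y) \<in> parcs K \<longleftrightarrow> y = b" if "x \<in> ?L" for x y
    proof -
      have "card (nb x) < 2" using no that by auto
      moreover have bx: "b \<in> nb x" using that sym_E by auto
      ultimately have "card (nb x) \<le> 1" by simp
      then have "nb x = {b}" using bx card_le_Suc0_iff_eq[OF finite_nb[of x]] by auto
      then show ?thesis by (metis nb_iff singleton_iff)
    qed
    have "card ?L < p" using nb_subset by (intro few_leaves[OF p pg rigid _ leaf]) auto
    moreover have a: "a \<in> nb b" using that(1) sym_E by simp
    then have "card ?L = card (nb b) - 1" using finite_nb by simp
    moreover have "p dvd card (nb b) - 1"
      using that(2,3) by (metis cong_altdef_nat le_trans one_le_numeral)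
    ultimately have "card (nb b) - 1 = 0" using nat_dvd_not_less by fastforce
    then show False using that(3) by simp
  qed
  show ?thesis
  proof (cases "\<exists>x k. closed_nb_walk p x k")
    case False
    have "reaches_end p a b" "reaches_end p b a"
      using reaches_end_or_closed[OF next_vertex ab(1)] reaches_end_or_closed[OF next_vertex sym_E[OF ab(1)]]
        ab(2,3) False unfolding nb_def by blast+
    from join_walks[OF this] show ?thesis unfolding nb_def by blast
  qed blast
qed

text \<open>A component without edges is a single vertex. Otherwise take an edge from
  \<open>a\<close> to a leaf \<open>b\<close>: all neighbours of \<open>a\<close> turn out to be
  leaves, so nothing beyond \<open>a\<close> and its neighbours can be reached and \<open>a\<close>
  is the centre.\<close>

lemma union_of_stars_if_leaves:
  assumes K: "pair_graph K"
    and leaf: "\<And>a b. (a, b) \<in> parcs K \<Longrightarrow> card {y. (a, y) \<in> parcs K} < 2 \<or> card {y. (b, y) \<in> parcs K} < 2"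
  shows "union_of_stars K"
  unfolding union_of_stars_def
proof
  interpret K: pair_graph K by fact
  fix C assume "C \<in> pre_digraph.sccs (with_proj K)"
  then have C: "induced_subgraph C (with_proj K)" "strongly_connected C"
    by (auto simp: pre_digraph.sccs_def)
  define S where "S = verts C"
  define C' where "C' = \<lparr>pverts = S, parcs = parcs K \<inter> S \<times> S\<rparr>"
  have S: "S \<subseteq> pverts K" using C(1) by (auto simp: induced_subgraph_def subgraph_def S_def)
  have CC: "C = with_proj C'"
    using C(1) by (auto simp: induced_subgraph_def subgraph_def compatible_def with_proj_def C'_def S_def
        intro!: pre_digraph.equality)
  have ne: "S \<noteq> {}" and reach: "(u, v) \<in> (parcs K \<inter> S \<times> S)\<^sup>*" if "u \<in> S" "v \<in> S" for u v
    using C(2) that unfolding strongly_connected_def reachable_def CC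
    by (auto simp: C'_def dest: rtrancl_on_rtranclI)
  have S0: "S \<noteq> {}" using C(2) by (simp add: strongly_connected_def S_def)
  have nb_leaf: "{y. (b, y) \<in> parcs K} = {a}" if ab: "(a, b) \<in> parcs K" "card {y. (b, y) \<in> parcs K} < 2" for a b
  proof -
    have fin: "finite {y. (b, y) \<in> parcs K}"
      by (rule finite_subset[OF _ K.pair_finite_verts]) (use K.in_arcsD2 in auto)
    have "a \<in> {y. (b, y) \<in> parcs K}" using ab K.arcs_symmetric by simp
    then show ?thesis using fin ab(2) card_le_Suc0_iff_eq[OF fin] by auto
  qed
  have "\<exists>a \<in> S. parcs K \<inter> S \<times> S = {a} \<times> (S - {a}) \<union> (S - {a}) \<times> {a}"
  proof (cases "parcs K \<inter> S \<times> S = {}")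
    case True
    obtain a where a: "a \<in> S" using S0 by blast
    have "v = a" if "v \<in> S" for v using reach[OF a that] unfolding True by simp
    then have "S = {a}" using a by blast
    then show ?thesis using True by auto
  next
    case False
    then obtain c d where cd: "(c, d) \<in> parcs K" "c \<in> S" "d \<in> S" by auto
    have "\<exists>a b. (a, b) \<in> parcs K \<and> a \<in> S \<and> b \<in> S \<and> card {y. (b, y) \<in> parcs K} < 2"
      using leaf[OF cd(1)] cd K.arcs_symmetric by blast
    then obtain a b where ab: "(a, b) \<in> parcs K" "a \<in> S" "b \<in> S" "card {y. (b, y) \<in> parcs K} < 2" by blast
    \<comment> \<open>If \<open>a\<close> has degree 1 as well, its only neighbour is the leaf
      \<open>b\<close>. Otherwise the hypothesis \<open>leaf\<close> makes the other end of each
      edge at \<open>a\<close> a leaf.\<close>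
    have leaves: "{y. (c, y) \<in> parcs K} = {a}" if ac: "(a, c) \<in> parcs K" for c
    proof (cases "card {y. (a, y) \<in> parcs K} < 2")
      case True
      then have "{y. (a, y) \<in> parcs K} = {b}" using nb_leaf[OF K.arcs_symmetric[OF ab(1)]] by simp
      then have "c = b" using ac by blast
      then show ?thesis using nb_leaf[OF ab(1,4)] by simp
    next
      case False
      then show ?thesis using leaf[OF ac] nb_leaf[OF ac] by blast
    qed
    have in_star: "v = a \<or> (a, v) \<in> parcs K" if "v \<in> S" for v
      using reach[OF ab(2) that]
    proof (induction rule: rtrancl_induct)
      case (step y z)
      then show ?case using leaves[of y] by blast
    qed simp
    have "parcs K \<inter> S \<times> S = {a} \<times> (S - {a}) \<union> (S - {a}) \<times> {a}"
    proof (intro set_eqI iffI)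
      fix e assume e: "e \<in> parcs K \<inter> S \<times> S"
      obtain u v where uv: "e = (u, v)" by force
      have "u \<noteq> v" using e uv K.no_loops' by auto
      moreover have "u = a \<or> v = a"
      proof (cases "u = a")
        case False
        then have "(a, u) \<in> parcs K" using in_star[of u] e uv by simp
        from leaves[OF this] show ?thesis using e uv by auto
      qed simp
      ultimately show "e \<in> {a} \<times> (S - {a}) \<union> (S - {a}) \<times> {a}" using e uv by auto
    next
      fix e assume "e \<in> {a} \<times> (S - {a}) \<union> (S - {a}) \<times> {a}"
      then show "e \<in> parcs K \<inter> S \<times> S" using in_star ab(2) K.arcs_symmetric by blast
    qed
    then show ?thesis using ab(2) by blast
  qed
  then obtain a where a: "a \<in> S" "parcs K \<inter> S \<times> S = {a} \<times> (S - {a}) \<union> (S - {a}) \<times> {a}" by blast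
  have "finite S" using S K.pair_finite_verts finite_subset by blast
  then have "complete_bipartite_digraph 1 (card (S - {a})) (with_proj C')"
    unfolding complete_bipartite_digraph_pair_def C'_def pair_pre_digraph.simps
  proof (intro conjI exI)
    show "S = {a} \<union> (S - {a})" using a(1) by blast
    show "parcs K \<inter> S \<times> S = {a} \<times> (S - {a}) \<union> (S - {a}) \<times> {a}" by (rule a(2))
  qed simp_all
  then show "star C" unfolding star_def CC by blast
qed

section \<open>Weights of the two kinds of walks and the final reduction\<close>

section \<open>The reduction\<close>

text \<open>The map \<kappa> acts as an automorphism, so it preserves degrees as well as adjacency
  and distinctness. This is why it suffices to pin a walk up to automorphism.\<close>

lemma injective_homs_walk:
  fixes K :: "'a pair_pre_digraph" and x :: "nat \<Rightarrow> 'a"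
  assumes K: "sqfree K" and \<kappa>: "\<kappa> \<in> injective_homs K" and x: "range x \<subseteq> pverts K"
    and walk: "sqfree_graph.nb_walk (parcs K) p x k"
  shows "sqfree_graph.nb_walk (parcs K) p (\<kappa> \<circ> x) k"
    and "card {y. (\<kappa> (x i), y) \<in> parcs K} = card {y. (x i, y) \<in> parcs K}"
    and "\<kappa> (x i) = \<kappa> (x j) \<longleftrightarrow> x i = x j" and "\<kappa> (x i) \<in> pverts K"
proof -
  interpret sqfree_graph "pverts K" "parcs K" using K by (simp add: sqfree_def)
  let ?V = "pverts K"
  let ?E = "parcs K"
  have inj: "inj_on \<kappa> ?V" and \<kappa>V: "\<And>v. v \<in> ?V \<Longrightarrow> \<kappa> v \<in> ?V" and \<kappa>E: "\<And>u v. (u, v) \<in> ?E \<Longrightarrow> (\<kappa> u, \<kappa> v) \<in> ?E"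
    using \<kappa> by (auto simp: injective_homs_def edges_ok_def)
  have EV: "?E \<subseteq> ?V \<times> ?V" using E_V by auto
  have finE: "finite ?E" by (rule finite_subset[OF EV]) (simp add: finite_V)
  have "inj_on (map_prod \<kappa> \<kappa>) ?E"
    using map_prod_inj_on[OF inj inj] EV inj_on_subset by blast
  moreover have "map_prod \<kappa> \<kappa> ` ?E \<subseteq> ?E" using \<kappa>E by auto
  ultimately have surj: "map_prod \<kappa> \<kappa> ` ?E = ?E" using endo_inj_surj[OF finE] by blast
  have nb: "nb (\<kappa> v) = \<kappa> ` nb v" if v: "v \<in> ?V" for v
  proof
    show "\<kappa> ` nb v \<subseteq> nb (\<kappa> v)" using \<kappa>E by auto
    show "nb (\<kappa> v) \<subseteq> \<kappa> ` nb v"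
    proof
      fix y assume "y \<in> nb (\<kappa> v)"
      then have "(\<kappa> v, y) \<in> map_prod \<kappa> \<kappa> ` ?E" by (simp add: surj)
      then obtain v' w where vw: "(v', w) \<in> ?E" "\<kappa> v = \<kappa> v'" "y = \<kappa> w" by auto
      then have "v = v'" using inj v E_V by (auto dest: inj_onD)
      then show "y \<in> \<kappa> ` nb v" using vw by auto
    qed
  qed
  have card_nb: "card (nb (\<kappa> v)) = card (nb v)" if "v \<in> ?V" for v
    unfolding nb[OF that] using inj nb_subset by (intro card_image) (rule inj_on_subset)
  have xV: "x i \<in> ?V" for i using x by auto
  show "card {y. (\<kappa> (x i), y) \<in> ?E} = card {y. (x i, y) \<in> ?E}"
    using card_nb[OF xV[of i]] by (simp add: nb_def)
  show eq: "\<kappa> (x i) = \<kappa> (x j) \<longleftrightarrow> x i = x j" for i j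
    using inj xV by (auto dest: inj_onD)
  show "\<kappa> (x i) \<in> ?V" using \<kappa>V xV by simp
  show "nb_walk p (\<kappa> \<circ> x) k"
    using walk \<kappa>E card_nb xV eq by (simp add: nb_walk_def)
qed

text \<open>For \<open>j = 0\<close> the gadget is the bare edge \<open>(U, W)\<close>. Otherwise
  \<open>W\<close> touches only the first fresh vertex, which is split off before the general
  statement about inner chains applies.\<close>

lemma chain_edge_slots:
  assumes "range x \<subseteq> C"
  shows "chain x j 0 U W \<subseteq> edge_slots C j"
proof (cases j)
  case 0
  then show ?thesis by (simp add: edge_slots_def)
next
  case (Suc j')
  have "chain x j' (Suc 0) U (Fresh 0) \<subseteq>
    {(y, Fresh i) | y i. i < Suc 0 + j' \<and> y \<in> insert U (Const ` C \<union> Fresh ` {..<i})}"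
    by (rule chain_inner_slots[OF assms]) simp
  also have "\<dots> \<subseteq> edge_slots C j" unfolding edge_slots_def Suc by auto
  finally have 1: "chain x j' (Suc 0) U (Fresh 0) \<subseteq> edge_slots C j" .
  have "x j \<in> C" using assms by auto
  then have "{(Const (x j), Fresh 0), (W, Fresh 0)} \<subseteq> edge_slots C j"
    by (simp add: edge_slots_def Suc)
  with 1 show ?thesis by (simp add: Suc)
qed

text \<open>For \<open>j = 0\<close> the second chain would be the single edge from
  \<open>Fresh 0\<close> to \<open>U\<close>, which runs against the required orientation.\<close>

lemma selector_vertex_slots:
  assumes "range x \<subseteq> C" and "0 < j"
  shows "selector x j \<subseteq> vertex_slots C (Suc (j + j))"
proof -
  obtain j' where j: "j = Suc j'" using assms(2) by (cases j) auto
  have "chain x j (Suc 0) U (Fresh 0) \<subseteq>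
    {(y, Fresh i) | y i. i < Suc 0 + j \<and> y \<in> insert U (Const ` C \<union> Fresh ` {..<i})}"
    by (rule chain_inner_slots[OF assms(1)]) simp
  also have "\<dots> \<subseteq> vertex_slots C (Suc (j + j))" unfolding vertex_slots_def by auto
  finally have 1: "chain x j 1 U (Fresh 0) \<subseteq> vertex_slots C (Suc (j + j))" by simp
  have "chain x j' (Suc (1 + j)) (Fresh 0) (Fresh (1 + j)) \<subseteq>
    {(y, Fresh i) | y i. i < Suc (1 + j) + j' \<and> y \<in> insert U (Const ` C \<union> Fresh ` {..<i})}"
    by (rule chain_inner_slots[OF assms(1)]) simp
  also have "\<dots> \<subseteq> vertex_slots C (Suc (j + j))" unfolding vertex_slots_def j by auto
  finally have 2: "chain x j' (Suc (1 + j)) (Fresh 0) (Fresh (1 + j)) \<subseteq> vertex_slots C (Suc (j + j))" .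
  have 3: "{(Const (x j), Fresh (1 + j)), (U, Fresh (1 + j))} \<subseteq> vertex_slots C (Suc (j + j))"
    using assms by (auto simp: vertex_slots_def)
  have 4: "{(Const (x 0), U), (Const (x 0), Fresh 0)} \<subseteq> vertex_slots C (Suc (j + j))"
    using assms by (auto simp: vertex_slots_def)
  have "chain x j (1 + j) (Fresh 0) U = {(Const (x j), Fresh (1 + j)), (U, Fresh (1 + j))} \<union>
    chain x j' (Suc (1 + j)) (Fresh 0) (Fresh (1 + j))"
    by (subst (1) j, subst (4) j) (simp add: j)
  then show ?thesis unfolding selector_def using 1 2 3 4 by blast
qed

text \<open>
  The images under \<open>\<kappa>\<close> of the vertices \<open>x 0\<close> and \<open>x k\<close> are pinned; the left and right vertices of
  the instance range over their neighbourhoods, and \<open>x 1\<close> and \<open>x (k - 1)\<close> stand for "not in the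
  independent set".
\<close>

lemma weights_of_open_walk:
  fixes K :: "'a pair_pre_digraph"
  assumes K: "sqfree K" and x: "range x \<subseteq> pverts K" "sqfree_graph.nb_walk (parcs K) p x (Suc j)"
    and \<kappa>: "\<kappa> \<in> injective_homs K" and es: "bis_edge_list l n es"
  shows "[int (bis_weight (pverts K) (parcs K) {(Const (x 0), U)} {(Const (x (Suc j)), U)} 0
      (chain x j 0 U W) j l n (set es) \<kappa>) =
    bis_sum (int (card {y. (x 0, y) \<in> parcs K}) - 1) (int (card {y. (x (Suc j), y) \<in> parcs K}) - 1)
      l n (set es)] (mod int p)"
proof -
  interpret sqfree_graph "pverts K" "parcs K" using K by (simp add: sqfree_def)
  let ?y = "\<kappa> \<circ> x"
  have y: "nb_walk p ?y (Suc j)" by (rule injective_homs_walk(1)[OF K \<kappa> x])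
  have deg: "card (nb (?y i)) = card {y. (x i, y) \<in> parcs K}" for i
    using injective_homs_walk(2)[OF K \<kappa> x] by (simp add: nb_def)
  have adj: "(?y 0, ?y 1) \<in> parcs K" "(?y j, ?y (Suc j)) \<in> parcs K" using y by (auto simp: nb_walk_def)
  have unary: "gadget_count (pverts K) (parcs K) {(Const v, U)} 0 \<kappa> a b = of_bool (a \<in> nb (\<kappa> v))" for v a b
    by (simp add: gadget_count_def edges_ok_def)
  show ?thesis
    unfolding deg[symmetric]
  proof (rule bis_weight_cong_bis_sum[OF finite_V nb_subset _ nb_subset _ es])
    show "?y 1 \<in> nb (?y 0)" "?y j \<in> nb (?y (Suc j))" using adj sym_E by auto
    show "[gadget_count (pverts K) (parcs K) (chain x j 0 U W) j \<kappa> a b = of_bool (a = ?y 1 \<or> b = ?y j)] (mod p)"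
      if "a \<in> nb (?y 0)" "b \<in> nb (?y (Suc j))" for a b
      unfolding gadget_count_chain[OF finite_V] by (rule link_cong[OF y _ that]) simp
  qed (simp_all add: unary)
qed

text \<open>
  On a closed walk the two chains run through it in both directions; both can be completed only from
  \<open>x 1\<close> and from \<open>x (k - 1)\<close>.
\<close>

lemma weights_of_closed_walk:
  fixes K :: "'a pair_pre_digraph"
  assumes K: "sqfree K" and x: "range x \<subseteq> pverts K" "sqfree_graph.nb_walk (parcs K) p x (Suc j)"
    and closed: "x (Suc j) = x 0" "x 1 \<noteq> x j"
    and \<kappa>: "\<kappa> \<in> injective_homs K" and es: "bis_edge_list l n es"
  shows "[int (bis_weight (pverts K) (parcs K) (selector x j) (selector x j) (Suc (j + j))
      (chain x j 0 U W) j l n (set es) \<kappa>) = bis_sum 1 1 l n (set es)] (mod int p)"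
proof -
  interpret sqfree_graph "pverts K" "parcs K" using K by (simp add: sqfree_def)
  let ?y = "\<kappa> \<circ> x"
  let ?S = "{?y 1, ?y j}"
  let ?link = "link (pverts K) (parcs K) ?y j"
  have y: "nb_walk p ?y (Suc j)" by (rule injective_homs_walk(1)[OF K \<kappa> x])
  have adj: "(?y 0, ?y 1) \<in> parcs K" "(?y j, ?y (Suc j)) \<in> parcs K" using y by (auto simp: nb_walk_def)
  have y_closed: "?y (Suc j) = ?y 0" using closed by simp
  have ne: "?y 1 \<noteq> ?y j" using closed(2) injective_homs_walk(3)[OF K \<kappa> x] by simp
  have S: "?S \<subseteq> nb (?y 0)" using adj sym_E y_closed by auto
  have link: "[?link a b = of_bool (a = ?y 1 \<or> b = ?y j)] (mod p)" if "a \<in> nb (?y 0)" "b \<in> nb (?y 0)" for a b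
    by (rule link_cong[OF y lessI that(1)]) (use that(2) in \<open>simp only: y_closed\<close>)
  have unary: "[gadget_count (pverts K) (parcs K) (selector x j) (Suc (j + j)) \<kappa> a a = of_bool (a \<in> ?S)] (mod p)" for a
  proof (cases "a \<in> nb (?y 0)")
    case False
    then have "a \<notin> ?S" using S by blast
    then show ?thesis using False unfolding gadget_count_selector[OF finite_V] by simp
  next
    case True
    have count: "gadget_count (pverts K) (parcs K) (selector x j) (Suc (j + j)) \<kappa> a a =
      (\<Sum>z \<in> nb (?y 0). ?link a z * ?link z a)"
      unfolding gadget_count_selector[OF finite_V] using True finite_V nb_subset
      by (intro sum.mono_neutral_cong_right) auto
    have "(\<Sum>z \<in> nb (?y 0). of_bool (a = ?y 1 \<or> z = ?y j) * of_bool (z = ?y 1 \<or> a = ?y j)) =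
      (\<Sum>z \<in> nb (?y 0). if z = a then of_bool (a \<in> ?S) else (0 :: nat))"
    proof (rule sum.cong[OF refl])
      fix z
      have "(a = ?y 1 \<or> z = ?y j) \<and> (z = ?y 1 \<or> a = ?y j) \<longleftrightarrow> z = a \<and> a \<in> ?S"
        using ne by (simp only: insert_iff empty_iff) metis
      then show "of_bool (a = ?y 1 \<or> z = ?y j) * of_bool (z = ?y 1 \<or> a = ?y j) =
        (if z = a then of_bool (a \<in> ?S) else (0 :: nat))"
        by (simp only: of_bool_conj[symmetric]) simp
    qed
    then have both: "(\<Sum>z \<in> nb (?y 0). of_bool (a = ?y 1 \<or> z = ?y j) * of_bool (z = ?y 1 \<or> a = ?y j)) =
      (of_bool (a \<in> ?S) :: nat)"
      using True finite_nb[of "?y 0"] by (simp only: sum.delta if_True)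
    have "[(\<Sum>z \<in> nb (?y 0). ?link a z * ?link z a) =
      (\<Sum>z \<in> nb (?y 0). of_bool (a = ?y 1 \<or> z = ?y j) * of_bool (z = ?y 1 \<or> a = ?y j))] (mod p)"
      by (intro cong_sum cong_mult link True)
    then show ?thesis unfolding count both .
  qed
  have "[int (bis_weight (pverts K) (parcs K) (selector x j) (selector x j) (Suc (j + j))
      (chain x j 0 U W) j l n (set es) \<kappa>) = bis_sum (int (card ?S) - 1) (int (card ?S) - 1) l n (set es)] (mod int p)"
  proof (rule bis_weight_cong_bis_sum[OF finite_V _ _ _ _ es unary unary])
    show "?S \<subseteq> pverts K" "?S \<subseteq> pverts K" using S nb_subset by blast+
    show "?y 1 \<in> ?S" "?y j \<in> ?S" by auto
    show "[gadget_count (pverts K) (parcs K) (chain x j 0 U W) j \<kappa> a b = of_bool (a = ?y 1 \<or> b = ?y j)] (mod p)"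
      if "a \<in> ?S" "b \<in> ?S" for a b
      unfolding gadget_count_chain[OF finite_V] using that S by (intro link) auto
  qed
  then show ?thesis using ne by simp
qed

lemma Z_BIS_eq_bis_sum:
  assumes G: "pair_graph G" "pverts G = {..<n}" and bip: "bipartition G {..<l} R"
    and es: "set es = {(u, v) \<in> parcs G. u < v}" "distinct es"
  shows "bis_edge_list l n es" and "Z_BIS lam1 lam2 G {..<l} R = bis_sum lam1 lam2 l n (set es)"
proof -
  interpret pair_graph G by (rule G(1))
  have VR: "{..<n} = {..<l} \<union> R" "{..<l} \<inter> R = {}" "parcs G \<subseteq> {..<l} \<times> R \<union> R \<times> {..<l}"
    using bip G(2) by (auto simp: bipartition_def)
  have ln: "l \<le> n" using VR(1) by (metis Un_upper1 lessThan_subset_iff)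
  have R: "R = {l..<n}"
  proof (intro set_eqI iffI)
    fix v assume "v \<in> R"
    then have "v \<in> {..<n}" "v \<notin> {..<l}" using VR(1,2) by blast+
    then show "v \<in> {l..<n}" by auto
  next
    fix v assume "v \<in> {l..<n}"
    then have "v \<in> {..<n}" "v \<notin> {..<l}" by auto
    then show "v \<in> R" using VR(1) by blast
  qed
  show "bis_edge_list l n es"
    unfolding bis_edge_list_def using ln es VR(3) unfolding R by fastforce
  have "independent_sets G = {I \<in> Pow {..<n}. \<forall>(u, w) \<in> set es. \<not> (u \<in> I \<and> w \<in> I)}"
  proof (intro set_eqI iffI)
    fix I assume "I \<in> {I \<in> Pow {..<n}. \<forall>(u, w) \<in> set es. \<not> (u \<in> I \<and> w \<in> I)}"
    then have I: "I \<subseteq> {..<n}" "\<And>u w. (u, w) \<in> set es \<Longrightarrow> \<not> (u \<in> I \<and> w \<in> I)" by auto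
    have "(u, v) \<notin> parcs G" if "u \<in> I" "v \<in> I" for u v
    proof
      assume uv: "(u, v) \<in> parcs G"
      then have "u \<noteq> v" using no_loops' by blast
      then have "(u, v) \<in> set es \<or> (v, u) \<in> set es"
        using uv arcs_symmetric[OF uv] es(1) by (auto simp: neq_iff)
      then show False using I(2) that by blast
    qed
    then show "I \<in> independent_sets G" using I(1) by (simp add: independent_sets_def G(2))
  qed (auto simp: independent_sets_def G(2) es(1))
  then show "Z_BIS lam1 lam2 G {..<l} R = bis_sum lam1 lam2 l n (set es)"
    by (simp add: Z_BIS_def bis_sum_def R)
qed

text \<open>Pinning is carried out in \<open>K\<close>, whereas the oracle counts homomorphisms to
  \<open>H\<close>. The congruence of the counts lets the residues for \<open>H\<close> replace
  those for \<open>K\<close> in the weighted sum.\<close>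

lemma reduction_from_weights:
  fixes H K :: "'a pair_pre_digraph"
  assumes p: "prime p" and K: "sqfree K" "rigid p K"
    and HK: "\<And>G :: nat pair_pre_digraph. pair_graph G \<Longrightarrow> [card (homs G H) = card (homs G K)] (mod p)"
    and T: "finite TL" "finite TR" "finite TE" "TL \<subseteq> vertex_slots (pverts K) f"
      "TR \<subseteq> vertex_slots (pverts K) f" "TE \<subseteq> edge_slots (pverts K) g"
    and weights: "\<And>l n es \<kappa>. bis_edge_list l n es \<Longrightarrow> \<kappa> \<in> injective_homs K \<Longrightarrow>
      [int (bis_weight (pverts K) (parcs K) TL TR f TE g l n (set es) \<kappa>) =
        bis_sum lam1 lam2 l n (set es)] (mod int p)"
  shows "turing_reducible (bis_problem p lam1 lam2) (graph_hom_problem p H)"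
proof -
  have pg: "pair_graph K" using K(1) by (simp add: sqfree_def)
  obtain qs where qs: "\<forall>(D, k) \<in> set qs. valid_blueprint D"
    and sum: "\<forall>l n es. bis_edge_list l n es \<longrightarrow>
      nat (bis_sum lam1 lam2 l n (set es) mod int p) = (\<Sum>(D, k) \<leftarrow> qs.
        k * (card (homs (query_graph D (sides l n) es) K) mod p)) mod p"
    by (rule pinning[where Z = "bis_sum lam1 lam2", OF p pg T card_injective_homs[OF p pg K(2)] weights])
  have enc: "encodes_graph (graph_code (query_size D n (length es))
          (query_edges D (sides l n) es))
        (query_graph D (sides l n) es)"
    if "bis_edge_list l n es" "(D, k) \<in> set qs" for l n es D k
  proof -
    have len: "length (sides l n) = n"
      using that(1) by (simp add: bis_edge_list_def)
    have "valid_blueprint D" using qs that(2) by auto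
    moreover have "distinct es" "\<And>u w. (u, w) \<in> set es \<Longrightarrow> u < w \<and> w < n"
      using that(1) by (fastforce simp: bis_edge_list_def)+
    ultimately show ?thesis
      using encodes_query_graph[of D es "sides l n"] unfolding len by blast
  qed
  show ?thesis
  proof (rule turing_reducible_by_queries)
    show "0 < p" using p by (rule prime_gt_0_nat)
    fix G l n es R
    assume G: "encodes_graph (graph_code n es) G" "pverts G = {..<n}" and bip: "bipartition G {..<l} R"
      and es: "set es = {(u, v) \<in> parcs G. u < v}" "distinct es"
    have "pair_graph G" using G(1) by (simp add: encodes_graph_def)
    note Z = Z_BIS_eq_bis_sum[OF this G(2) bip es]
    show "encodes_graph (graph_code (query_size D n (length es))
          (query_edges D (sides l n) es))
        (query_graph D (sides l n) es)"
      if "(D, k) \<in> set qs" for D k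
      using enc[OF Z(1) that] .
    let ?Q = "\<lambda>D. query_graph D (sides l n) es"
    have "card (homs (?Q D) K) mod p = card (homs (?Q D) H) mod p" if "(D, k) \<in> set qs" for D k
      using HK[of "?Q D"] enc[OF Z(1) that] by (simp add: encodes_graph_def cong_def)
    then have "(\<Sum>(D, k) \<leftarrow> qs. k * (card (homs (?Q D) K) mod p)) =
      (\<Sum>(D, k) \<leftarrow> qs. k * (card (homs (?Q D) H) mod p))"
      by (intro arg_cong[where f = sum_list] map_cong) auto
    then show "nat (Z_BIS lam1 lam2 G {..<l} R mod int p) =
      (\<Sum>(D, k) \<leftarrow> qs. k * (card (homs (?Q D) H) mod p)) mod p"
      unfolding Z(2) using sum Z(1) by simp
  qed
qed

theorem theorem2:
  fixes p :: nat and H H_red :: "'a pair_pre_digraph"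
  assumes "prime p"
    and "pair_graph H"
    and "square_free H"
    and "reduced_form p H H_red"
    and "\<not> union_of_stars H_red"
  shows "\<exists>lam1 lam2 :: int. \<not> [lam1 = 0] (mod int p) \<and> \<not> [lam2 = 0] (mod int p) \<and>
    turing_reducible (bis_problem p lam1 lam2) (graph_hom_problem p H)"
proof -
  have "reduces_to p H H_red" using assms(4) by (simp add: reduced_form_def)
  from reduces_to_counts[OF assms(1) this sqfreeI[OF assms(2,3)]]
  have K: "sqfree H_red" and HK: "\<And>G :: nat pair_pre_digraph. pair_graph G \<Longrightarrow>
      [card (homs G H) = card (homs G H_red)] (mod p)" by auto
  have pg: "pair_graph H_red" using K by (simp add: sqfree_def)
  have rigid: "rigid p H_red"
    unfolding rigid_def using reduced_form_rigid[OF assms(1,4) pg] by blast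
  interpret sqfree_graph "pverts H_red" "parcs H_red" using K by (simp add: sqfree_def)
  let ?V = "pverts H_red"
  let ?E = "parcs H_red"
  obtain a b where ab: "(a, b) \<in> ?E" "\<not> card {y. (a, y) \<in> ?E} < 2" "\<not> card {y. (b, y) \<in> ?E} < 2"
    using union_of_stars_if_leaves[OF pg] assms(5) by blast
  \<comment> \<open>A walk is constrained only up to its length \<open>k\<close>. Freezing it from
    there on makes all its values vertices, as required for constants of a gadget.\<close>
  have trim: "range (\<lambda>i. x (min i k)) \<subseteq> ?V" "nb_walk p (\<lambda>i. x (min i k)) k" if "nb_walk p x k" for x k
  proof -
    have "x i \<in> ?V" if "i \<le> k" for i
    proof (cases "i < k")
      case True
      then show ?thesis using \<open>nb_walk p x k\<close> E_V by (auto simp: nb_walk_def)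
    next
      case False
      then have "(x (k - 1), x i) \<in> ?E"
        using \<open>nb_walk p x k\<close> \<open>i \<le> k\<close> by (cases k) (auto simp: nb_walk_def)
      then show ?thesis using E_V by blast
    qed
    then show "range (\<lambda>i. x (min i k)) \<subseteq> ?V" by auto
    show "nb_walk p (\<lambda>i. x (min i k)) k"
      using that by (auto simp: nb_walk_def min_def)
  qed
  from walk_exists[OF assms(1) K rigid ab(1)] ab(2,3)
  consider x k where "nb_walk p x k" "\<not> [card {y. (x 0, y) \<in> ?E} = 1] (mod p)"
      "\<not> [card {y. (x k, y) \<in> ?E} = 1] (mod p)"
    | x k where "closed_nb_walk p x k"
    unfolding not_less by blast
  then show ?thesis
  proof cases
    case 1
    define x' where "x' = (\<lambda>i. x (min i k))"
    obtain j where k: "k = Suc j" using 1(1) by (cases k) (auto simp: nb_walk_def)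
    have x': "range x' \<subseteq> ?V" "nb_walk p x' (Suc j)" using trim[OF 1(1)] unfolding x'_def k by auto
    have deg: "\<not> [int (card {y. (x' i, y) \<in> ?E}) - 1 = 0] (mod int p)" if "i \<in> {0, Suc j}" for i
    proof -
      have "\<not> [card {y. (x' i, y) \<in> ?E} = 1] (mod p)" using that 1(2,3) by (auto simp: x'_def k)
      then have "\<not> [int (card {y. (x' i, y) \<in> ?E}) = int 1] (mod int p)" unfolding cong_int_iff .
      then show ?thesis unfolding cong_diff_iff_cong_0 by simp
    qed
    have slots: "{(Const (x' i), U)} \<subseteq> vertex_slots ?V 0" for i
      using x'(1) by (auto simp: vertex_slots_def)
    have "turing_reducible (bis_problem p (int (card {y. (x' 0, y) \<in> ?E}) - 1)
        (int (card {y. (x' (Suc j), y) \<in> ?E}) - 1)) (graph_hom_problem p H)"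
      by (rule reduction_from_weights[OF assms(1) K rigid HK _ _ finite_chain slots[of 0]
        slots[of "Suc j"] chain_edge_slots[OF x'(1), of j] weights_of_open_walk[OF K x']]) simp_all
    then show ?thesis using deg[of 0] deg[of "Suc j"] by blast
  next
    case 2
    define x' where "x' = (\<lambda>i. x (min i k))"
    have walk: "nb_walk p x k" "x k = x 0" "x 1 \<noteq> x (k - 1)" using 2 by (auto simp: closed_nb_walk_def)
    obtain j where k: "k = Suc j" using walk(1) by (cases k) (auto simp: nb_walk_def)
    have x': "range x' \<subseteq> ?V" "nb_walk p x' (Suc j)" using trim[OF walk(1)] unfolding x'_def k by auto
    have "0 < j"
    proof (rule ccontr)
      assume "\<not> 0 < j"
      then have "(x 0, x 0) \<in> ?E" using walk(1,2) by (auto simp: nb_walk_def k)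
      then show False using irrefl_E by blast
    qed
    then have closed: "x' (Suc j) = x' 0" "x' 1 \<noteq> x' j" using walk(2,3) by (auto simp: x'_def k min_def)
    have fin: "finite (selector x' j)" by (simp add: selector_def finite_chain)
    have slots: "selector x' j \<subseteq> vertex_slots ?V (Suc (j + j))"
      by (rule selector_vertex_slots[OF x'(1) \<open>0 < j\<close>])
    have "turing_reducible (bis_problem p 1 1) (graph_hom_problem p H)"
      by (rule reduction_from_weights[OF assms(1) K rigid HK fin fin finite_chain slots slots
        chain_edge_slots[OF x'(1), of j] weights_of_closed_walk[OF K x' closed]])
    moreover have "\<not> [1 = 0 :: int] (mod int p)"
      using prime_gt_1_nat[OF assms(1)] by (auto simp: cong_0_iff)
    ultimately show ?thesis by blast
  qed
qed

end
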